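(* There is an algorithm that, given an instance $(G_1,G_2,h)$ of Maximum Common Star Forest Subgraph, decides it in time $2^{\mathcal{O}(h)}\cdot n$, where $n$ is the number of vertices of the input graphs. In particular, the problem is fixed-parameter tractable when parameterized by $h$.
   Context: A non-trivial star is a tree on at least $2$ vertices of diameter at most $2$. A star forest is a vertex-disjoint union of non-trivial stars (so it has no isolated vertices). A graph $H$ is a subgraph of a graph $G$ if there is an injective map $\phi:V(H)\to V(G)$ with $\{\phi(u),\phi(v)\}\in E(G)$ for every $\{u,v\}\in E(H)$. Maximum Common Star Forest Subgraph: given undirected simple graphs $G_1,G_2$ and a non-negative integer $h$, decide whether there is a star forest $H$ on at least $h$ vertices that is a subgraph of both $G_1$ and $G_2$. *)

theory Defs
  imports Complex_Main "HOL-Library.Landau_Symbols"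
begin

section \<open>Graphs, stars and star forests\<close>

record 'a graph =
  verts :: "'a set"
  edges :: "'a set set"

definition simple_graph :: "'a graph \<Rightarrow> bool" where
  "simple_graph G \<longleftrightarrow> finite (verts G) \<and>
     (\<forall>e \<in> edges G. \<exists>u \<in> verts G. \<exists>v \<in> verts G. u \<noteq> v \<and> e = {u, v})"

definition subgraph :: "'a graph \<Rightarrow> 'b graph \<Rightarrow> bool" where
  "subgraph H G \<longleftrightarrow> (\<exists>\<phi>. \<phi> ` verts H \<subseteq> verts G \<and> inj_on \<phi> (verts H) \<and>
     (\<forall>u v. {u, v} \<in> edges H \<longrightarrow> {\<phi> u, \<phi> v} \<in> edges G))"

definition walk :: "'a graph \<Rightarrow> 'a list \<Rightarrow> bool" where
  "walk G p \<longleftrightarrow> p \<noteq> [] \<and> set p \<subseteq> verts G \<and> successively (\<lambda>u v. {u, v} \<in> edges G) p"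

definition connected_graph :: "'a graph \<Rightarrow> bool" where
  "connected_graph G \<longleftrightarrow> verts G \<noteq> {} \<and>
     (\<forall>u \<in> verts G. \<forall>v \<in> verts G. \<exists>p. walk G p \<and> hd p = u \<and> last p = v)"

definition cycle :: "'a graph \<Rightarrow> 'a list \<Rightarrow> bool" where
  "cycle G p \<longleftrightarrow> walk G p \<and> distinct p \<and> 3 \<le> length p \<and> {last p, hd p} \<in> edges G"

definition tree :: "'a graph \<Rightarrow> bool" where
  "tree G \<longleftrightarrow> simple_graph G \<and> connected_graph G \<and> (\<nexists>p. cycle G p)"

text \<open>
  Distance and diameter are only meaningful for connected graphs; they are only used for trees.
\<close>

definition distance :: "'a graph \<Rightarrow> 'a \<Rightarrow> 'a \<Rightarrow> nat" where
  "distance G u v = (LEAST k. \<exists>p. walk G p \<and> hd p = u \<and> last p = v \<and> length p = Suc k)"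

definition diameter :: "'a graph \<Rightarrow> nat" where
  "diameter G = Max {distance G u v | u v. u \<in> verts G \<and> v \<in> verts G}"

definition nontrivial_star :: "'a graph \<Rightarrow> bool" where
  "nontrivial_star S \<longleftrightarrow> tree S \<and> 2 \<le> card (verts S) \<and> diameter S \<le> 2"

text \<open>The union of the empty family, the graph without vertices, counts as a star forest.\<close>

definition star_forest :: "'a graph \<Rightarrow> bool" where
  "star_forest H \<longleftrightarrow> (\<exists>F. finite F \<and> (\<forall>S \<in> F. nontrivial_star S) \<and>
     (\<forall>S \<in> F. \<forall>T \<in> F. S \<noteq> T \<longrightarrow> verts S \<inter> verts T = {}) \<and>
     verts H = \<Union> (verts ` F) \<and> edges H = \<Union> (edges ` F))"


section \<open>A word RAM\<close>

text \<open>
  Algorithms are while-programs on a random access machine. The machine has a read-only input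
  array and a work memory that is initially zero. All values are words of \<open>w\<close> bits, and a program
  gets stuck as soon as a value of \<open>2 ^ w\<close> or more occurs. Every operation takes unit time.
  Subtraction is truncated and division by zero gives zero.
\<close>

datatype exp =
    Const nat
  | Mem exp
  | Inp exp
  | Add exp exp
  | Sub exp exp
  | Mul exp exp
  | Div exp exp

datatype com =
    Skip
  | Store exp exp
  | Seq com com
  | Cond exp com com
  | While exp com

type_synonym mem = "nat \<Rightarrow> nat"

definition word :: "nat \<Rightarrow> nat \<Rightarrow> nat option" where
  "word w v = (if v < 2 ^ w then Some v else None)"

definition binop :: "nat \<Rightarrow> (nat \<Rightarrow> nat \<Rightarrow> nat) \<Rightarrow> nat option \<Rightarrow> nat option \<Rightarrow> nat option" where
  "binop w f a b = Option.bind a (\<lambda>m. Option.bind b (\<lambda>n. word w (f m n)))"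

primrec eval :: "nat \<Rightarrow> nat list \<Rightarrow> mem \<Rightarrow> exp \<Rightarrow> nat option" where
  "eval w x s (Const k) = word w k"
| "eval w x s (Mem e) = Option.bind (eval w x s e) (\<lambda>i. word w (s i))"
| "eval w x s (Inp e) =
     Option.bind (eval w x s e) (\<lambda>i. word w (if i < length x then x ! i else 0))"
| "eval w x s (Add d e) = binop w (+) (eval w x s d) (eval w x s e)"
| "eval w x s (Sub d e) = binop w (-) (eval w x s d) (eval w x s e)"
| "eval w x s (Mul d e) = binop w (*) (eval w x s d) (eval w x s e)"
| "eval w x s (Div d e) = binop w (div) (eval w x s d) (eval w x s e)"

primrec cost :: "exp \<Rightarrow> nat" where
  "cost (Const k) = 1"
| "cost (Mem e) = cost e + 1"
| "cost (Inp e) = cost e + 1"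
| "cost (Add d e) = cost d + cost e + 1"
| "cost (Sub d e) = cost d + cost e + 1"
| "cost (Mul d e) = cost d + cost e + 1"
| "cost (Div d e) = cost d + cost e + 1"

text \<open>
  \<open>exec w x P s t s'\<close>: with word length \<open>w\<close> and input \<open>x\<close>, program \<open>P\<close> started in memory \<open>s\<close>
  halts after \<open>t\<close> steps in memory \<open>s'\<close>. Conditions are true when non-zero.
\<close>

inductive exec :: "nat \<Rightarrow> nat list \<Rightarrow> com \<Rightarrow> mem \<Rightarrow> nat \<Rightarrow> mem \<Rightarrow> bool" for w x where
  Skip: "exec w x Skip s 1 s"
| Store: "eval w x s d = Some i \<Longrightarrow> eval w x s e = Some v \<Longrightarrow>
    exec w x (Store d e) s (cost d + cost e + 1) (s(i := v))"
| Seq: "exec w x P s t s' \<Longrightarrow> exec w x Q s' t' s'' \<Longrightarrow> exec w x (Seq P Q) s (t + t') s''"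
| Cond_True: "eval w x s e = Some v \<Longrightarrow> v \<noteq> 0 \<Longrightarrow> exec w x P s t s' \<Longrightarrow>
    exec w x (Cond e P Q) s (cost e + 1 + t) s'"
| Cond_False: "eval w x s e = Some 0 \<Longrightarrow> exec w x Q s t s' \<Longrightarrow>
    exec w x (Cond e P Q) s (cost e + 1 + t) s'"
| While_True: "eval w x s e = Some v \<Longrightarrow> v \<noteq> 0 \<Longrightarrow> exec w x P s t s' \<Longrightarrow>
    exec w x (While e P) s' t' s'' \<Longrightarrow> exec w x (While e P) s (cost e + 1 + t + t') s''"
| While_False: "eval w x s e = Some 0 \<Longrightarrow> exec w x (While e P) s (cost e + 1) s"

inductive_cases exec_elims:
  "exec w x Skip s t s'" "exec w x (Store d e) s t s'" "exec w x (Seq P Q) s t s'"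
  "exec w x (Cond e P Q) s t s'" "exec w x (While e P) s t s'"

lemma exec_deterministic:
  "exec w x P s t s' \<Longrightarrow> exec w x P s u s'' \<Longrightarrow> t = u \<and> s' = s''"
proof (induction arbitrary: u s'' rule: exec.induct)
  case Skip
  then show ?case by (rule exec_elims(1)) simp
next
  case Store
  from Store.prems show ?case
    by (rule exec_elims(2)) (simp add: Store.hyps)
next
  case Seq
  from Seq.prems show ?case
    by (rule exec_elims(3)) (drule Seq.IH(1), simp, drule Seq.IH(2), simp)
next
  case Cond_True
  from Cond_True.prems show ?case
    by (rule exec_elims(4)) (drule Cond_True.IH, simp, simp add: Cond_True.hyps)
next
  case Cond_False
  from Cond_False.prems show ?case
    by (rule exec_elims(4)) (simp add: Cond_False.hyps, drule Cond_False.IH, simp)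
next
  case While_True
  from While_True.prems show ?case
    by (rule exec_elims(5)) (drule While_True.IH(1), simp, drule While_True.IH(2), simp, simp add: While_True.hyps)
next
  case While_False
  from While_False.prems show ?case
    by (rule exec_elims(5)) (simp_all add: While_False.hyps)
qed


section \<open>Decision problems and fixed-parameter tractability\<close>

text \<open>
  A decision problem consists of an encoding relation between instances and inputs and of the
  predicate that holds for the yes-instances. An algorithm has to be correct on every encoding of
  an instance; it leaves its answer in memory cell \<open>0\<close>. \<open>T\<close> bounds the running time and \<open>L\<close> the
  word length.
\<close>

definition decides_within ::
  "com \<Rightarrow> ('i \<Rightarrow> nat list \<Rightarrow> bool) \<Rightarrow> ('i \<Rightarrow> bool) \<Rightarrow>
   ('i \<Rightarrow> nat list \<Rightarrow> real) \<Rightarrow> ('i \<Rightarrow> nat list \<Rightarrow> real) \<Rightarrow> bool" where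
  "decides_within P enc Q T L \<longleftrightarrow> (\<forall>i x. enc i x \<longrightarrow>
     (\<exists>w t s. real w \<le> L i x \<and> real t \<le> T i x \<and>
        exec w x P (\<lambda>_. 0) t s \<and> s 0 = (if Q i then 1 else 0)))"

definition computable :: "(nat \<Rightarrow> nat) \<Rightarrow> bool" where
  "computable g \<longleftrightarrow> (\<exists>P. \<forall>k. \<exists>w t s. exec w [k] P (\<lambda>_. 0) t s \<and> s 0 = g k)"

text \<open>
  Operations take unit time whatever the word length, so the word length has to be bounded as well.
\<close>

definition fixed_parameter_tractable ::
  "('i \<Rightarrow> nat list \<Rightarrow> bool) \<Rightarrow> ('i \<Rightarrow> bool) \<Rightarrow> ('i \<Rightarrow> nat) \<Rightarrow> bool" where
  "fixed_parameter_tractable enc Q \<kappa> \<longleftrightarrow> (\<exists>P g d. computable g \<and>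
     decides_within P enc Q (\<lambda>i x. real (g (\<kappa> i) * length x ^ d))
                            (\<lambda>i x. real (g (\<kappa> i) * length x ^ d)))"


section \<open>Maximum Common Star Forest Subgraph\<close>

text \<open>
  Graphs are given by adjacency lists. \<open>L ! i\<close> lists, in any order and by index, the neighbours of
  the \<open>i\<close>-th vertex in some enumeration \<open>vs\<close> of the vertices.
\<close>

definition adjacency_lists :: "'a graph \<Rightarrow> nat list list \<Rightarrow> bool" where
  "adjacency_lists G L \<longleftrightarrow> (\<exists>vs. distinct vs \<and> set vs = verts G \<and> length L = length vs \<and>
     (\<forall>i < length vs. distinct (L ! i) \<and>
        set (L ! i) = {j. j < length vs \<and> {vs ! i, vs ! j} \<in> edges G}))"

text \<open>
  In memory, the number of vertices comes first, then the offset of each list (and the end of the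
  last list) relative to the start of the first list, then the lists themselves.
\<close>

definition graph_words :: "nat list list \<Rightarrow> nat list" where
  "graph_words L = length L # map (\<lambda>i. length (concat (take i L))) [0..<Suc (length L)] @ concat L"

type_synonym mcsf_instance = "nat graph \<times> nat graph \<times> nat"

fun mcsf_input :: "mcsf_instance \<Rightarrow> nat list \<Rightarrow> bool" where
  "mcsf_input (G\<^sub>1, G\<^sub>2, h) x \<longleftrightarrow> simple_graph G\<^sub>1 \<and> simple_graph G\<^sub>2 \<and>
     (\<exists>L\<^sub>1 L\<^sub>2. adjacency_lists G\<^sub>1 L\<^sub>1 \<and> adjacency_lists G\<^sub>2 L\<^sub>2 \<and>
        x = h # graph_words L\<^sub>1 @ graph_words L\<^sub>2)"

fun mcsf :: "mcsf_instance \<Rightarrow> bool" where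
  "mcsf (G\<^sub>1, G\<^sub>2, h) \<longleftrightarrow> (\<exists>H :: nat graph. star_forest H \<and> h \<le> card (verts H) \<and>
     subgraph H G\<^sub>1 \<and> subgraph H G\<^sub>2)"

fun parameter :: "mcsf_instance \<Rightarrow> nat" where
  "parameter (G\<^sub>1, G\<^sub>2, h) = h"

fun num_verts :: "mcsf_instance \<Rightarrow> nat" where
  "num_verts (G\<^sub>1, G\<^sub>2, h) = card (verts G\<^sub>1) + card (verts G\<^sub>2)"

end

theory Submission
  imports Defs
begin

text \<open>
  A star forest can be listed star by star, each centre followed by its leaves, so a common star
  forest on at least \<open>h\<close> vertices has a prefix on \<open>h\<close> or \<open>h + 1\<close> vertices that is again a star
  forest. Its shape is a bit pattern telling centres from leaves, and it suffices to decide for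
  each of the \<open>2\<^sup>O\<^sup>(\<^sup>h\<^sup>)\<close> patterns whether both graphs contain it. Every adjacency list may be cut
  off after \<open>h + 1\<close> entries, since the other vertices of the forest cannot occupy all of them; this
  makes the running time linear in the number of vertices.

  A recursion along the pattern enumerates the sequences of vertices in which every leaf is
  adjacent to its centre, but not whether they are injective. Hence every sequence is weighted with
  the square of the Vandermonde determinant of its vertices, which is positive for an injective
  sequence and zero otherwise, so the total weight is positive iff the pattern occurs. By the
  Laplace expansion of both factors the total is computed by dynamic programming over pairs of
  subsets of at most \<open>h + 1\<close> columns. To keep the numbers small, the computation is done modulo each
  of \<open>O(h\<^sup>2)\<close> consecutive numbers larger than the number of vertices: if all of them divided a positive
  total, it would be larger than the total can be.
\<close>

section \<open>Vandermonde determinants and consecutive divisors\<close>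

text \<open>The weight is a square because determinants of different sequences may have opposite
  signs and cancel, whereas a sum of squares is positive as soon as one of them is. The price of the
  second factor is only another factor \<open>2 ^ K\<close> in the size of the table.

  The total weight may have about \<open>h^2\<close> times as many bits as a modulus, too many for a
  word, so only residues are computed. No modulus is known in advance to be good, and it has to be
  good for both graphs at once. Hence the product of the two totals is bounded by a power of the
  smallest modulus: not all of the consecutive candidates divide a positive number that small, and a
  candidate that does not divide the product divides neither factor. The candidates need not be
  prime, so nothing has to be sieved or drawn at random. A bad modulus can only hide a positive
  total, never feign one.

  The second prefix length is forced by a cut right after a centre, which would leave a star without
  leaves. In the listing a centre is followed by a leaf, so one more vertex repairs this.\<close>

definition sg :: "nat set \<Rightarrow> nat \<Rightarrow> int" where
  "sg S i = (- 1) ^ card {l \<in> S. l < i}"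

text \<open>The determinant of the matrix with rows \<open>q\<close>, columns \<open>S\<close> and
  entries \<open>a ^ i\<close>, by Laplace expansion along the first row. It is zero unless
  \<open>S\<close> has exactly \<open>length q\<close> elements.\<close>

primrec minor :: "nat list \<Rightarrow> nat set \<Rightarrow> int" where
  "minor [] S = (if S = {} then 1 else 0)"
| "minor (a # q) S = (\<Sum>i\<in>S. sg S i * int a ^ i * minor q (S - {i}))"

lemma sg_remove_less:
  assumes "finite S" "i \<in> S" "i < j"
  shows "sg (S - {i}) j = - sg S j" "sg (S - {j}) i = sg S i"
proof -
  have "{l \<in> S. l < j} = insert i {l \<in> S - {i}. l < j}" using assms by auto
  then have "card {l \<in> S. l < j} = Suc (card {l \<in> S - {i}. l < j})"
    using assms(1) by simp
  then show "sg (S - {i}) j = - sg S j" by (simp add: sg_def)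
  have "{l \<in> S - {j}. l < i} = {l \<in> S. l < i}" using assms by auto
  then show "sg (S - {j}) i = sg S i" by (simp add: sg_def)
qed

text \<open>Removing the smaller column lowers the rank of the larger one by one, while removing the
  larger leaves the smaller alone; so the two orders of deleting a pair differ in sign.\<close>

lemma sg_swap:
  assumes "finite S" "i \<in> S" "j \<in> S" "i \<noteq> j"
  shows "sg S j * sg (S - {j}) i = - (sg S i * sg (S - {i}) j)"
  using assms sg_remove_less[of S i j] sg_remove_less[of S j i]
  by (cases "i < j") (auto simp: not_less_iff_gr_or_eq)

text \<open>Once two rows are expanded into a sum over ordered pairs of columns, exchanging the rows
  is a reindexing of the pairs.\<close>

lemma minor_two:
  assumes "finite S"
  shows "minor (a # b # q) S =
    (\<Sum>(i, j)\<in>{(i, j). i \<in> S \<and> j \<in> S \<and> i \<noteq> j}.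
       sg S i * sg (S - {i}) j * int a ^ i * int b ^ j * minor q (S - {i, j}))"
proof -
  have "{(i, j). i \<in> S \<and> j \<in> S \<and> i \<noteq> j} = (SIGMA i:S. S - {i})" by auto
  moreover have "S - {i} - {j} = S - {i, j}" for i j by auto
  ultimately show ?thesis
    using assms by (simp add: sum.Sigma[symmetric] sum_distrib_left mult_ac)
qed

lemma minor_swap:
  assumes "finite S"
  shows "minor (b # a # q) S = - minor (a # b # q) S"
proof -
  let ?P = "{(i, j). i \<in> S \<and> j \<in> S \<and> i \<noteq> j}"
  have "minor (b # a # q) S = (\<Sum>(i, j)\<in>?P.
       sg S j * sg (S - {j}) i * int b ^ j * int a ^ i * minor q (S - {j, i}))"
    unfolding minor_two[OF assms]
    by (rule sum.reindex_bij_witness[of _ prod.swap prod.swap]) auto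
  also have "\<dots> = (\<Sum>(i, j)\<in>?P.
       - (sg S i * sg (S - {i}) j * int a ^ i * int b ^ j * minor q (S - {i, j})))"
  proof (rule sum.cong[OF refl], clarify)
    fix i j assume "i \<in> S" "j \<in> S" "i \<noteq> j"
    then show "sg S j * sg (S - {j}) i * int b ^ j * int a ^ i * minor q (S - {j, i}) =
        - (sg S i * sg (S - {i}) j * int a ^ i * int b ^ j * minor q (S - {i, j}))"
      unfolding sg_swap[OF assms \<open>i \<in> S\<close> \<open>j \<in> S\<close> \<open>i \<noteq> j\<close>]
      by (simp add: insert_commute mult_ac)
  qed
  also have "\<dots> = - minor (a # b # q) S"
    unfolding minor_two[OF assms] by (simp add: sum_negf split_beta)
  finally show ?thesis .
qed

text \<open>Two equal adjacent rows make the value its own negative. Otherwise one exchange moves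
  \<open>a\<close> past \<open>b\<close>, and the expansion along \<open>b\<close> leaves instances
  for the shorter list.\<close>

lemma minor_member:
  "finite S \<Longrightarrow> a \<in> set q \<Longrightarrow> minor (a # q) S = 0"
proof (induction q arbitrary: S)
  case (Cons b q)
  show ?case
  proof (cases "a = b")
    case True
    then show ?thesis using minor_swap[OF Cons.prems(1), of a a q] by (simp del: minor.simps)
  next
    case False
    then have "minor (a # q) (S - {i}) = 0" for i
      using Cons by (intro Cons.IH) auto
    then have "minor (b # a # q) S = 0"
      by (simp only: minor.simps(2)[of b "a # q"]) simp
    then show ?thesis using minor_swap[OF Cons.prems(1), of a b q] by (simp del: minor.simps)
  qed
qed simp

lemma minor_not_distinct:
  "finite S \<Longrightarrow> \<not> distinct q \<Longrightarrow> minor q S = 0"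
proof (induction q arbitrary: S)
  case (Cons a q)
  show ?case
  proof (cases "a \<in> set q")
    case False
    then have "minor q (S - {i}) = 0" for i using Cons by (intro Cons.IH) auto
    then show ?thesis by simp
  qed (use minor_member Cons.prems in blast)
qed simp

text \<open>
  As a function of its first entry the Vandermonde determinant is a polynomial whose roots include
  the remaining entries and whose leading coefficient is the next smaller determinant.
\<close>

lemma minor_distinct:
  "distinct q \<Longrightarrow> minor q {..<length q} \<noteq> 0"
proof (induction q)
  case (Cons a q)
  let ?m = "length q"
  define c :: "nat \<Rightarrow> real" where
    "c i = of_int (sg {..?m} i * minor q ({..?m} - {i}))" for i
  have minor_c: "of_int (minor (z # q) {..?m}) = (\<Sum>i\<le>?m. c i * real z ^ i)" for z
    by (simp add: c_def mult_ac)
  have "{..?m} - {?m} = {..<?m}" by auto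
  then have "c ?m \<noteq> 0" using Cons by (simp add: c_def sg_def)
  then have fin: "finite {z. (\<Sum>i\<le>?m. c i * z ^ i) = 0}"
    and card: "card {z. (\<Sum>i\<le>?m. c i * z ^ i) = 0} \<le> ?m"
    using polyfun_rootbound[of c ?m ?m] by auto
  show ?case
  proof
    assume "minor (a # q) {..<length (a # q)} = 0"
    \<comment> \<open>For \<open>z = a\<close> this is the assumption, for the others a row is
      repeated: \<open>Suc ?m\<close> roots of a polynomial of degree \<open>?m\<close>.\<close>
    then have "minor (z # q) {..?m} = 0" if "z \<in> set (a # q)" for z
      using that minor_member[of "{..?m}" z q] by (auto simp: lessThan_Suc_atMost simp del: minor.simps)
    then have "real ` set (a # q) \<subseteq> {z. (\<Sum>i\<le>?m. c i * z ^ i) = 0}"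
      using minor_c by (auto simp del: minor.simps) (metis of_int_0)+
    then have "card (real ` set (a # q)) \<le> ?m"
      using card card_mono[OF fin] by (meson le_trans)
    moreover have "card (real ` set (a # q)) = Suc ?m"
      using Cons.prems by (subst card_image) (auto simp: distinct_card inj_on_def)
    ultimately show False by simp
  qed
qed simp

lemma minor_nonzero_iff:
  "minor q {..<length q} \<noteq> 0 \<longleftrightarrow> distinct q"
  using minor_distinct minor_not_distinct[of "{..<length q}" q] by auto

text \<open>Each expansion has at most \<open>K\<close> summands, and each of them contributes a
  factor of at most \<open>N ^ K\<close>.\<close>

lemma abs_minor_le:
  assumes "\<And>a. a \<in> set q \<Longrightarrow> a \<le> N" "S \<subseteq> {..<K}" "1 \<le> N"
  shows "\<bar>minor q S\<bar> \<le> int ((K * N ^ K) ^ length q)"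
  using assms
proof (induction q arbitrary: S)
  case (Cons a q)
  have fin: "finite S" using Cons.prems(2) finite_subset by blast
  have S: "card S \<le> K" using Cons.prems(2) card_mono[of "{..<K}" S] by simp
  let ?B = "int ((K * N ^ K) ^ length q)"
  have summand: "\<bar>sg S i * int a ^ i * minor q (S - {i})\<bar> \<le> int (N ^ K) * ?B" if "i \<in> S" for i
  proof -
    have "a ^ i \<le> N ^ i" using Cons.prems by (intro power_mono) auto
    also have "\<dots> \<le> N ^ K" using Cons.prems that by (intro power_increasing) auto
    finally have "int a ^ i \<le> int (N ^ K)" by (metis of_nat_le_iff of_nat_power)
    moreover have "\<bar>minor q (S - {i})\<bar> \<le> ?B" using Cons.prems by (intro Cons.IH) auto
    ultimately have "int a ^ i * \<bar>minor q (S - {i})\<bar> \<le> int (N ^ K) * ?B"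
      by (intro mult_mono) auto
    then show ?thesis by (simp add: abs_mult sg_def power_abs)
  qed
  have "\<bar>minor (a # q) S\<bar> \<le> (\<Sum>i\<in>S. int (N ^ K) * ?B)"
    unfolding minor.simps using sum_abs sum_mono[OF summand] by (rule order.trans)
  also have "\<dots> \<le> int K * (int (N ^ K) * ?B)"
    using S by (auto intro!: mult_right_mono)
  finally show ?case by (simp add: algebra_simps)
qed simp

section \<open>Common multiples of consecutive integers\<close>

text \<open>
  This rests on the partial fraction expansion of \<open>1 / (M (M + 1) \<dots> (M + t))\<close>.
\<close>

lemma prod_dvd_fact:
  assumes "\<And>i. i \<le> t \<Longrightarrow> M + int i dvd V"
  shows "(\<Prod>i\<le>t. M + int i) dvd V * fact t"
  using assms
proof (induction t arbitrary: M)
  case (Suc t)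
  have 1: "(\<Prod>i\<le>t. M + int i) dvd V * fact t" using Suc.prems by (intro Suc.IH) auto
  have 2: "(\<Prod>i\<le>t. (M + 1) + int i) dvd V * fact t"
  proof (rule Suc.IH)
    fix i assume "i \<le> t"
    then show "M + 1 + int i dvd V" using Suc.prems[of "i + 1"] by (simp add: algebra_simps)
  qed
  have P1: "(\<Prod>i\<le>Suc t. M + int i) = (\<Prod>i\<le>t. M + int i) * (M + int (Suc t))"
    by (simp add: algebra_simps)
  have P2: "(\<Prod>i\<le>Suc t. M + int i) = M * (\<Prod>i\<le>t. (M + 1) + int i)"
    by (subst prod.atMost_Suc_shift) (simp add: algebra_simps)
  have "(\<Prod>i\<le>Suc t. M + int i) dvd V * fact t * (M + int (Suc t))"
    unfolding P1 using 1 by (rule mult_dvd_mono) simp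
  moreover have "(\<Prod>i\<le>Suc t. M + int i) dvd M * (V * fact t)"
    unfolding P2 using 2 by (intro mult_dvd_mono) simp
  \<comment> \<open>The difference is \<open>V * fact t * int (Suc t)\<close>. In fractions:
    \<open>1 / (M ... (M + t))\<close> minus \<open>1 / ((M + 1) ... (M + t + 1))\<close> equals
    \<open>(t + 1) / (M ... (M + t + 1))\<close>.\<close>
  ultimately have "(\<Prod>i\<le>Suc t. M + int i) dvd V * fact t * (M + int (Suc t)) - M * (V * fact t)"
    by (rule dvd_diff)
  then show ?case by (simp add: algebra_simps)
qed simp

text \<open>If all candidates divided \<open>V\<close>, their product, at least
  \<open>M ^ (t + 1)\<close>, would divide \<open>V * fact t\<close>. As
  \<open>t * t \<le> M\<close>, the factorial is worth at most \<open>t / 2\<close> powers of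
  \<open>M\<close>, so \<open>V\<close> would be at least \<open>M ^ e\<close>.\<close>

lemma exists_nondivisor:
  fixes M t V e :: nat
  assumes "0 < V" "V < M ^ e" "t * t \<le> M" "2 * e \<le> t"
  shows "\<exists>i\<le>t. \<not> (M + i) dvd V"
proof (rule ccontr)
  assume "\<not> ?thesis"
  then have dvd: "(M + i) dvd V" if "i \<le> t" for i using that by blast
  have "(\<Prod>i\<le>t. int M + int i) dvd int V * fact t"
  proof (rule prod_dvd_fact)
    fix i assume "i \<le> t"
    then show "int M + int i dvd int V" using dvd of_nat_dvd_iff[of "M + i" V] by simp
  qed
  then have "int (\<Prod>i\<le>t. M + i) dvd int (V * fact t)" by simp
  then have "(\<Prod>i\<le>t. M + i) dvd V * fact t" unfolding of_nat_dvd_iff .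
  then have "(\<Prod>i\<le>t. M + i) \<le> V * fact t" using assms(1) by (intro dvd_imp_le) auto
  moreover have "M ^ Suc t \<le> (\<Prod>i\<le>t. M + i)"
    using prod_mono[of "{..t}" "\<lambda>_. M" "\<lambda>i. M + i"] by simp
  moreover have "fact t \<le> t ^ t" using fact_le_power[of t, where 'a = nat] by simp
  ultimately have le: "M ^ Suc t \<le> V * t ^ t" by (meson le_trans mult_le_mono2)
  have M: "0 < M" using assms by (cases M; cases e) auto
  \<comment> \<open>Squaring turns \<open>t ^ t\<close> into \<open>(t * t) ^ t \<le> M ^ t\<close>
    without halving an exponent.\<close>
  have "(M ^ Suc t) ^ 2 \<le> (V * t ^ t) ^ 2" using le by (rule power_mono) simp
  also have "\<dots> = V ^ 2 * (t * t) ^ t" by (simp add: power_mult_distrib power2_eq_square mult_ac)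
  also have "\<dots> \<le> V ^ 2 * M ^ t" using assms by (intro mult_le_mono power_mono) auto
  also have "\<dots> < (M ^ e) ^ 2 * M ^ t" using assms M by (intro mult_strict_right_mono power_strict_mono) auto
  also have "\<dots> = M ^ (2 * e + t)" by (simp add: power_add power_mult mult.commute)
  also have "\<dots> \<le> M ^ (2 * Suc t)" using assms M by (intro power_increasing) auto
  finally have "(M ^ Suc t) ^ 2 < M ^ (2 * Suc t)" .
  then show False by (metis power_mult mult.commute less_irrefl)
qed

section \<open>Star forests and their patterns\<close>

definition star :: "'a \<Rightarrow> 'a set \<Rightarrow> 'a graph" where
  "star c A = \<lparr>verts = insert c A, edges = {{c, a} | a. a \<in> A}\<rparr>"

lemma star_simps [simp]:
  "verts (star c A) = insert c A" "edges (star c A) = {{c, a} | a. a \<in> A}"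
  by (simp_all add: star_def)

text \<open>Serves connectedness and the diameter bound at once, hence the bound on the
  length.\<close>

lemma star_walk:
  assumes "u \<in> insert c A" "v \<in> insert c A"
  shows "\<exists>p k. walk (star c A) p \<and> hd p = u \<and> last p = v \<and> length p = Suc k \<and> k \<le> 2"
proof -
  have "walk (star c A) [c]" "\<And>a. a \<in> A \<Longrightarrow> walk (star c A) [c, a]"
    "\<And>a. a \<in> A \<Longrightarrow> walk (star c A) [a, c]" "\<And>a b. a \<in> A \<Longrightarrow> b \<in> A \<Longrightarrow> walk (star c A) [a, c, b]"
    by (auto simp: walk_def insert_commute)
  note walks = this
  consider "u = c" "v = c" | "u = c" "v \<in> A" | "u \<in> A" "v = c" | "u \<in> A" "v \<in> A"
    using assms by auto
  then show ?thesis
  proof cases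
    case 1
    then show ?thesis using walks(1)
      by (intro exI[of _ "[c]"] exI[of _ 0]) auto
  next
    case 2
    then show ?thesis using walks(2)
      by (intro exI[of _ "[c, v]"] exI[of _ 1]) auto
  next
    case 3
    then show ?thesis using walks(3)
      by (intro exI[of _ "[u, c]"] exI[of _ 1]) auto
  next
    case 4
    then show ?thesis using walks(4)
      by (intro exI[of _ "[u, c, v]"] exI[of _ 2]) auto
  qed
qed

text \<open>Every edge contains \<open>c\<close>, but the first, the second and the closing edge of
  a cycle have no common vertex.\<close>

lemma star_no_cycle: "\<not> cycle (star c A) p"
proof
  assume p: "cycle (star c A) p"
  then obtain a b d q where q: "p = a # b # d # q"
    unfolding cycle_def by (metis Suc_le_length_iff numeral_3_eq_3)
  then have "c \<in> {a, b}" "c \<in> {b, d}" "c \<in> {last p, a}"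
    using p unfolding cycle_def walk_def by (auto simp del: last.simps)
  moreover have "last p \<in> set (d # q)" using q by auto
  ultimately show False using p q unfolding cycle_def by auto
qed

lemma nontrivial_star_star:
  assumes "finite A" "A \<noteq> {}" "c \<notin> A"
  shows "nontrivial_star (star c A)"
proof -
  have "simple_graph (star c A)"
    using assms by (auto simp: simple_graph_def)
  moreover have "connected_graph (star c A)"
    unfolding connected_graph_def star_simps using star_walk[of _ c A] by blast
  moreover have "2 \<le> card (insert c A)"
    using assms by (simp add: card_gt_0_iff Suc_le_eq)
  moreover have "diameter (star c A) \<le> 2"
    unfolding diameter_def
  proof (rule Max.boundedI)
    have "{distance (star c A) u v |u v. u \<in> verts (star c A) \<and> v \<in> verts (star c A)} =
      (\<lambda>(u, v). distance (star c A) u v) ` (insert c A \<times> insert c A)"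
      by auto
    then show "finite {distance (star c A) u v |u v. u \<in> verts (star c A) \<and> v \<in> verts (star c A)}"
      using assms(1) by simp
    show "{distance (star c A) u v |u v. u \<in> verts (star c A) \<and> v \<in> verts (star c A)} \<noteq> {}"
      by auto
    fix k assume "k \<in> {distance (star c A) u v |u v. u \<in> verts (star c A) \<and> v \<in> verts (star c A)}"
    then obtain u v where uv: "u \<in> insert c A" "v \<in> insert c A" "k = distance (star c A) u v" by auto
    obtain p d where "walk (star c A) p \<and> hd p = u \<and> last p = v \<and> length p = Suc d" "d \<le> 2"
      using star_walk[OF uv(1,2)] by blast
    then have "k \<le> d" unfolding uv(3) distance_def by (blast intro: Least_le)
    then show "k \<le> 2" using \<open>d \<le> 2\<close> by simp
  qed
  ultimately show ?thesis
    by (simp add: nontrivial_star_def tree_def star_no_cycle)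
qed

text \<open>Connectedness makes the least length in \<open>distance\<close> attained, so the
  numerical bound on the diameter becomes a walk on at most three vertices.\<close>

lemma nontrivial_star_short_walk:
  assumes S: "nontrivial_star S" and uv: "u \<in> verts S" "v \<in> verts S"
  shows "u = v \<or> {u, v} \<in> edges S \<or> (\<exists>y\<in>verts S. {u, y} \<in> edges S \<and> {y, v} \<in> edges S)"
proof -
  have fin: "finite (verts S)" and conn: "connected_graph S"
    using S by (auto simp: nontrivial_star_def tree_def simple_graph_def)
  have "{distance S u v |u v. u \<in> verts S \<and> v \<in> verts S} =
      (\<lambda>(u, v). distance S u v) ` (verts S \<times> verts S)"
    by auto
  then have "finite {distance S u v |u v. u \<in> verts S \<and> v \<in> verts S}"
    using fin by simp
  then have "distance S u v \<le> diameter S"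
    unfolding diameter_def using uv by (intro Max_ge) auto
  then have le: "distance S u v \<le> 2" using S by (simp add: nontrivial_star_def)
  obtain p where p: "walk S p" "hd p = u" "last p = v"
    using conn uv unfolding connected_graph_def by blast
  then have "length p = Suc (length p - 1)" by (cases p) (auto simp: walk_def)
  then have "\<exists>k p. walk S p \<and> hd p = u \<and> last p = v \<and> length p = Suc k" using p by blast
  then have "\<exists>p. walk S p \<and> hd p = u \<and> last p = v \<and> length p = Suc (distance S u v)"
    unfolding distance_def by (rule LeastI_ex)
  then obtain p where p: "walk S p" "hd p = u" "last p = v" "length p = Suc (distance S u v)" by blast
  consider "length p = 1" | "length p = 2" | "length p = 3" using p(4) le by linarith
  then show ?thesis
    by cases (use p in \<open>auto simp: walk_def numeral_eq_Suc length_Suc_conv\<close>)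
qed

lemma no_short_cycles:
  assumes "tree S" "set p \<subseteq> verts S" "distinct p" "3 \<le> length p"
    "successively (\<lambda>u v. {u, v} \<in> edges S) p" "{last p, hd p} \<in> edges S"
  shows False
  using assms unfolding tree_def cycle_def walk_def by (metis list.size(3) not_numeral_le_zero)

lemma tree_edge_verts:
  assumes "tree S" "{u, v} \<in> edges S"
  shows "u \<in> verts S \<and> v \<in> verts S \<and> u \<noteq> v"
  using assms unfolding tree_def simple_graph_def by (metis doubleton_eq_iff insert_absorb2)

text \<open>The ends \<open>u\<close> and \<open>z\<close> are joined by at most two edges, and
  these close a cycle of length 3, 4 or 5.\<close>

lemma no_induced_path:
  assumes S: "nontrivial_star S"
    and e: "{u, c} \<in> edges S" "{c, d} \<in> edges S" "{d, z} \<in> edges S"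
    and n: "u \<noteq> d" "z \<noteq> c" "{c, z} \<notin> edges S"
  shows False
proof -
  have t: "tree S" using S by (simp add: nontrivial_star_def)
  have v: "u \<in> verts S" "c \<in> verts S" "d \<in> verts S" "z \<in> verts S" and ne: "u \<noteq> c" "c \<noteq> d" "d \<noteq> z"
    using tree_edge_verts[OF t] e by blast+
  have sym: "{a, b} \<in> edges S \<longleftrightarrow> {b, a} \<in> edges S" for a b by (simp add: insert_commute)
  have uz: "u \<noteq> z" using n e sym by auto
  consider "{u, z} \<in> edges S" | y where "y \<in> verts S" "{u, y} \<in> edges S" "{y, z} \<in> edges S"
    using nontrivial_star_short_walk[OF S v(1,4)] uz by blast
  then show False
  proof cases
    case 1
    then show False
      using v ne n e sym uz by (intro no_short_cycles[OF t, of "[u, c, d, z]"]) auto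
  next
    case 2
    then have y: "y \<noteq> u" "y \<noteq> z" using tree_edge_verts[OF t] by blast+
    have "y \<noteq> c" using 2 n by auto
    show False
    proof (cases "y = d")
      case True
      then show False
        using v ne n e 2 sym uz by (intro no_short_cycles[OF t, of "[u, c, d]"]) auto
    next
      case False
      then show False
        using v ne n e 2 y \<open>y \<noteq> c\<close> sym uz by (intro no_short_cycles[OF t, of "[u, c, d, z, y]"]) auto
    qed
  qed
qed

text \<open>If \<open>u\<close> is not adjacent to some \<open>v\<close>, the midpoint
  \<open>c\<close> between them is the centre: a vertex \<open>z\<close> not adjacent to
  \<open>c\<close> would be reached through some \<open>d\<close>, giving a forbidden path that
  starts in \<open>u\<close>, or in \<open>v\<close> if \<open>d = u\<close>.\<close>

lemma nontrivial_star_centre: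
  assumes S: "nontrivial_star S"
  obtains c where "c \<in> verts S" "\<And>z. z \<in> verts S \<Longrightarrow> z \<noteq> c \<Longrightarrow> {c, z} \<in> edges S"
proof -
  have t: "tree S" using S by (simp add: nontrivial_star_def)
  have sym: "{a, b} \<in> edges S \<longleftrightarrow> {b, a} \<in> edges S" for a b by (simp add: insert_commute)
  have "verts S \<noteq> {}" using S by (auto simp: nontrivial_star_def)
  then obtain u where u: "u \<in> verts S" by blast
  show ?thesis
  proof (cases "\<forall>z\<in>verts S. z \<noteq> u \<longrightarrow> {u, z} \<in> edges S")
    case True
    then show ?thesis using u that by blast
  next
    case False
    then obtain v where v: "v \<in> verts S" "v \<noteq> u" "{u, v} \<notin> edges S" by blast
    then obtain c where c: "c \<in> verts S" "{u, c} \<in> edges S" "{c, v} \<in> edges S"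
      using nontrivial_star_short_walk[OF S u v(1)] by blast
    have "{c, z} \<in> edges S" if z: "z \<in> verts S" "z \<noteq> c" for z
    proof (rule ccontr)
      assume nz: "{c, z} \<notin> edges S"
      then obtain d where d: "{c, d} \<in> edges S" "{d, z} \<in> edges S"
        using nontrivial_star_short_walk[OF S c(1) z(1)] z by blast
      show False
      proof (cases "d = u")
        case True
        then show False using no_induced_path[OF S _ d _ z(2) nz, of v] c v sym by blast
      next
        case False
        then show False using no_induced_path[OF S c(2) d _ z(2) nz] by blast
      qed
    qed
    then show ?thesis using c that by blast
  qed
qed

section \<open>Patterns and the sequences that fit them\<close>

text \<open>
  A pattern \<open>b\<close> marks the positions of leaves; \<open>ctr b i\<close> is the position of the centre of the star to
  which position \<open>i\<close> belongs.
\<close>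

primrec ctr :: "(nat \<Rightarrow> bool) \<Rightarrow> nat \<Rightarrow> nat" where
  "ctr b 0 = 0"
| "ctr b (Suc i) = (if b (Suc i) then ctr b i else Suc i)"

text \<open>Without two consecutive centres every star but possibly the last has a leaf. The last
  one is left open so that prefixes remain patterns; where it has to be complete,
  \<open>b (t - 1)\<close> is demanded separately.\<close>

definition pattern :: "(nat \<Rightarrow> bool) \<Rightarrow> nat \<Rightarrow> bool" where
  "pattern b t \<longleftrightarrow> (0 < t \<longrightarrow> \<not> b 0) \<and> (\<forall>i. Suc i < t \<longrightarrow> b i \<or> b (Suc i))"

text \<open>\<open>P\<close> and \<open>R\<close> are kept abstract because the same notion is used
  for the vertices of a forest, for indices into adjacency lists and for truncated lists.\<close>

definition fits :: "(nat \<Rightarrow> bool) \<Rightarrow> ('a \<Rightarrow> bool) \<Rightarrow> ('a \<Rightarrow> 'a \<Rightarrow> bool) \<Rightarrow> 'a list \<Rightarrow> bool" where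
  "fits b P R w \<longleftrightarrow> pattern b (length w) \<and>
     (\<forall>i < length w. if b i then R (w ! ctr b i) (w ! i) else P (w ! i))"

lemma ctr_le: "ctr b i \<le> i"
  by (induction i) (auto intro: le_SucI)

lemma ctr_centre: "\<not> b 0 \<Longrightarrow> \<not> b (ctr b i)"
  by (induction i) auto

lemma ctr_self: "\<not> b i \<Longrightarrow> ctr b i = i"
  by (cases i) auto

lemma ctr_cong: "(\<And>j. j \<le> i \<Longrightarrow> b j = b' j) \<Longrightarrow> ctr b i = ctr b' i"
  by (induction i) auto

lemma fits_Nil [simp]: "fits b P R []"
  by (simp add: fits_def pattern_def)

text \<open>The recursion on the last position, which the enumeration \<open>seqs\<close> follows
  step by step.\<close>

lemma fits_snoc:
  "fits b P R (w @ [y]) \<longleftrightarrow> fits b P R w \<and>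
     (if b (length w) then w \<noteq> [] \<and> R (w ! ctr b (length w - 1)) y
      else P y \<and> (w \<noteq> [] \<longrightarrow> b (length w - 1)))"
proof (cases w rule: rev_cases)
  case Nil
  then show ?thesis by (auto simp: fits_def pattern_def)
next
  case (snoc v z)
  have lt: "ctr b i < length w" if "i < length w" for i
    using ctr_le[of b i] that by simp
  let ?n = "length w"
  let ?Q = "\<lambda>v i. if b i then R (v ! ctr b i) (v ! i) else P (v ! i)"
  have pat: "pattern b (Suc ?n) \<longleftrightarrow> pattern b ?n \<and> (b (?n - 1) \<or> b ?n)"
    using snoc by (auto simp: pattern_def less_Suc_eq)
  have "(\<forall>i < Suc ?n. ?Q (w @ [y]) i) \<longleftrightarrow> (\<forall>i < ?n. ?Q (w @ [y]) i) \<and> ?Q (w @ [y]) ?n"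
    by (auto simp only: less_Suc_eq)
  also have "(\<forall>i < ?n. ?Q (w @ [y]) i) \<longleftrightarrow> (\<forall>i < ?n. ?Q w i)"
    using lt by (simp add: nth_append)
  also have "?Q (w @ [y]) ?n \<longleftrightarrow> (if b ?n then R (w ! ctr b (?n - 1)) y else P y)"
    using snoc lt[of "?n - 1"] by (simp add: nth_append)
  finally have "fits b P R (w @ [y]) \<longleftrightarrow> pattern b (Suc ?n) \<and> (\<forall>i < ?n. ?Q w i) \<and>
      (if b ?n then R (w ! ctr b (?n - 1)) y else P y)"
    unfolding fits_def length_append_singleton by (rule arg_cong)
  also have "\<dots> \<longleftrightarrow> (pattern b ?n \<and> (\<forall>i < ?n. ?Q w i)) \<and>
      (if b ?n then R (w ! ctr b (?n - 1)) y else P y \<and> b (?n - 1))"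
    unfolding pat by (cases "b ?n") (simp_all only: if_True if_False simp_thms conj_ac)
  finally show ?thesis unfolding fits_def using snoc by (simp cong: if_cong)
qed

lemma fits_append: "fits b P R (u @ v) \<Longrightarrow> fits b P R u"
proof (induction v rule: rev_induct)
  case (snoc y v)
  then have "fits b P R ((u @ v) @ [y])" by simp
  then show ?case using snoc.IH unfolding fits_snoc by blast
qed simp

lemma fits_take: "fits b P R w \<Longrightarrow> fits b P R (take m w)"
  by (rule fits_append[of b P R "take m w" "drop m w"]) simp

lemma fits_cong:
  assumes "\<And>i. i < length w \<Longrightarrow> b i = b' i"
  shows "fits b P R w = fits b' P R w"
proof -
  have "pattern b (length w) = pattern b' (length w)" using assms by (auto simp: pattern_def)
  moreover have "ctr b i = ctr b' i" if "i < length w" for i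
    using that assms by (intro ctr_cong) auto
  ultimately show ?thesis using assms by (simp add: fits_def)
qed

lemma fits_map:
  assumes "fits b P R w" "\<And>v. P v \<Longrightarrow> P' (f v)" "\<And>u v. R u v \<Longrightarrow> R' (f u) (f v)"
  shows "fits b P' R' (map f w)"
proof -
  have "ctr b i < length w" if "i < length w" for i
    using ctr_le[of b i] that by simp
  then show ?thesis using assms by (auto simp: fits_def)
qed

text \<open>
  At most \<open>K - 1\<close> of the first \<open>K\<close> entries of a list are occupied by the other vertices, so a
  leaf from beyond them can be exchanged.
\<close>

lemma fits_truncate:
  assumes "fits b P (\<lambda>u v. v \<in> set (L u)) w" "distinct w" "length w \<le> K" "\<And>u. P u \<Longrightarrow> distinct (L u)"
  shows "\<exists>w'. length w' = length w \<and> distinct w' \<and> fits b P (\<lambda>u v. v \<in> set (take K (L u))) w'"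
proof -
  have "\<exists>w'. length w' = length w \<and> distinct w' \<and> fits b P (\<lambda>u v. v \<in> set (L u)) w' \<and>
      (\<forall>i<j. b i \<longrightarrow> w' ! i \<in> set (take K (L (w' ! ctr b i))))" if "j \<le> length w" for j
    using that
  proof (induction j)
    case 0
    then show ?case using assms(1,2) by blast
  next
    case (Suc j)
    then obtain w' where w': "length w' = length w" "distinct w'" "fits b P (\<lambda>u v. v \<in> set (L u)) w'"
      "\<And>i. i < j \<Longrightarrow> b i \<Longrightarrow> w' ! i \<in> set (take K (L (w' ! ctr b i)))" by auto
    let ?c = "w' ! ctr b j"
    show ?case
    proof (cases "b j \<and> w' ! j \<notin> set (take K (L ?c))")
      case False
      then show ?thesis using w' by (auto simp: less_Suc_eq)
    next
      case True
      have j: "j < length w'" using Suc.prems w'(1) by simp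
      have b0: "\<not> b 0" using w'(3) j by (auto simp: fits_def pattern_def)
      \<comment> \<open>A leaf is the centre of no position, so exchanging it affects only its own
        adjacency condition and keeps the exchanges made before.\<close>
      have ne: "ctr b i \<noteq> j" for i using ctr_centre[of b i] b0 True by metis
      have "\<not> b (ctr b j)" "ctr b j < length w'" using ctr_centre[of b j] b0 ctr_le[of b j] j by auto
      then have "P ?c" using w'(3) by (auto simp: fits_def)
      have "w' ! j \<in> set (L ?c)" using w'(3) j True by (auto simp: fits_def)
      then have "K < length (L ?c)" using True by (metis not_less take_all)
      then have "card (set (take K (L ?c))) = K"
        using assms(4)[OF \<open>P ?c\<close>] by (subst distinct_card) auto
      moreover have "card (set w' - {w' ! j}) < K"
        using j w'(1,2) assms(3) by (simp add: distinct_card)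
      ultimately have "\<not> set (take K (L ?c)) \<subseteq> set w' - {w' ! j}"
        using card_mono[of "set w' - {w' ! j}"] by (metis List.finite_set finite_Diff not_le)
      then obtain y where y: "y \<in> set (take K (L ?c))" "y \<notin> set w'" using True by blast
      let ?w = "w'[j := y]"
      have ctr: "?w ! ctr b i = w' ! ctr b i" for i using ne[of i] by simp
      have "distinct ?w" using w'(2) y(2) by (simp add: distinct_list_update)
      moreover have "fits b P (\<lambda>u v. v \<in> set (L u)) ?w"
        unfolding fits_def ctr
        using w'(3) True y(1) j by (auto simp: fits_def nth_list_update dest: in_set_takeD)
      moreover have "b i \<longrightarrow> ?w ! i \<in> set (take K (L (?w ! ctr b i)))" if "i < Suc j" for i
        unfolding ctr using that w'(4) y(1) j by (auto simp: nth_list_update less_Suc_eq)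
      ultimately show ?thesis using w'(1) by (metis length_list_update)
    qed
  qed
  from this[of "length w"] obtain w' where w': "length w' = length w" "distinct w'"
    "fits b P (\<lambda>u v. v \<in> set (L u)) w'" "\<forall>i<length w. b i \<longrightarrow> w' ! i \<in> set (take K (L (w' ! ctr b i)))"
    by auto
  then have "fits b P (\<lambda>u v. v \<in> set (take K (L u))) w'" by (simp add: fits_def)
  then show ?thesis using w' by blast
qed

text \<open>The values of \<open>b\<close> beyond \<open>w\<close> are arbitrary and have to be
  overwritten. The preceding star must already have a leaf, since otherwise two centres would be
  consecutive.\<close>

lemma fits_append_star:
  assumes w: "fits b P R w" "w \<noteq> [] \<longrightarrow> b (length w - 1)"
    and c: "P c" "\<And>y. y \<in> set ys \<Longrightarrow> R c y"
  shows "fits (\<lambda>i. if i < length w then b i else i \<noteq> length w) P R (w @ c # ys)"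
    (is "fits ?b P R _")
  using c(2)
proof (induction ys rule: rev_induct)
  case Nil
  have "fits ?b P R w" using w(1) by (subst fits_cong[where b' = b]) auto
  then show ?case using c(1) w(2) by (simp add: fits_snoc)
next
  case (snoc y ys)
  have ctr: "ctr ?b (length w + k) = length w" for k
    by (induction k) (auto simp: ctr_self)
  have "fits ?b P R (w @ c # ys)" using snoc by auto
  moreover have "R ((w @ c # ys) ! ctr ?b (length w + length ys)) y"
    using snoc.prems unfolding ctr by simp
  ultimately have "fits ?b P R ((w @ c # ys) @ [y])"
    unfolding fits_snoc by simp
  then show ?case by simp
qed

section \<open>Passing between star forests and patterns\<close>

lemma star_forest_sequence:
  assumes "star_forest H"
  shows "\<exists>b w. distinct w \<and> set w = verts H \<and> (w \<noteq> [] \<longrightarrow> b (length w - 1)) \<and>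
    fits b (\<lambda>v. v \<in> verts H) (\<lambda>u v. {u, v} \<in> edges H) w"
proof -
  obtain F where F: "finite F" "\<forall>S\<in>F. nontrivial_star S"
    "\<forall>S\<in>F. \<forall>T\<in>F. S \<noteq> T \<longrightarrow> verts S \<inter> verts T = {}"
    "verts H = \<Union> (verts ` F)" "edges H = \<Union> (edges ` F)"
    using assms unfolding star_forest_def by (elim exE conjE) (rule that)
  \<comment> \<open>Stars are appended one at a time. Ending in a leaf belongs to the claim because
    a new centre may only follow a leaf.\<close>
  have "\<exists>b w. distinct w \<and> set w = \<Union> (verts ` F') \<and> (w \<noteq> [] \<longrightarrow> b (length w - 1)) \<and>
    fits b (\<lambda>v. v \<in> verts H) (\<lambda>u v. {u, v} \<in> edges H) w" if "finite F'" "F' \<subseteq> F" for F'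
    using that
  proof (induction F')
    case empty
    show ?case by (intro exI[of _ "\<lambda>_. True"] exI[of _ "[]"]) simp
  next
    case (insert S F')
    then obtain b w where w: "distinct w" "set w = \<Union> (verts ` F')" "w \<noteq> [] \<longrightarrow> b (length w - 1)"
      "fits b (\<lambda>v. v \<in> verts H) (\<lambda>u v. {u, v} \<in> edges H) w" by auto
    have S: "S \<in> F" "nontrivial_star S" using insert F by auto
    have finS: "finite (verts S)" and card: "2 \<le> card (verts S)"
      using S(2) by (auto simp: nontrivial_star_def tree_def simple_graph_def)
    obtain c where c: "c \<in> verts S" "\<And>z. z \<in> verts S \<Longrightarrow> z \<noteq> c \<Longrightarrow> {c, z} \<in> edges S"
      using nontrivial_star_centre[OF S(2)] by blast
    obtain ys where ys: "set ys = verts S - {c}" "distinct ys"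
      using finite_distinct_list[of "verts S - {c}"] finS by auto
    have "ys \<noteq> []"
    proof
      assume "ys = []"
      then have "verts S \<subseteq> {c}" using ys by auto
      then have "card (verts S) \<le> 1" using card_mono[of "{c}" "verts S"] by simp
      then show False using card by simp
    qed
    have disj: "verts S \<inter> set w = {}"
    proof -
      have "verts S \<inter> verts T = {}" if "T \<in> F'" for T
        using F(3) S(1) insert.hyps(2) insert.prems that by (metis insert_subset subsetD)
      then show ?thesis unfolding w(2) by blast
    qed
    let ?b = "\<lambda>i. if i < length w then b i else i \<noteq> length w"
    have "fits ?b (\<lambda>v. v \<in> verts H) (\<lambda>u v. {u, v} \<in> edges H) (w @ c # ys)"
    proof (rule fits_append_star)
      show "c \<in> verts H" using c(1) S(1) F(4) by blast
      show "{c, y} \<in> edges H" if "y \<in> set ys" for y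
        using that c(2) S(1) ys(1) F(5) by blast
    qed (use w in auto)
    moreover have "distinct (w @ c # ys)" "set (w @ c # ys) = \<Union> (verts ` insert S F')"
      using w ys c(1) disj by auto
    moreover have "?b (length (w @ c # ys) - 1)" using \<open>ys \<noteq> []\<close> by simp
    ultimately show ?case
      by (intro exI[of _ ?b] exI[of _ "w @ c # ys"] conjI impI)
  qed
  from this[of F] show ?thesis using F by simp
qed

text \<open>The forest lives on the positions and not on the vertices of a host, so that one and the
  same forest can be embedded into both graphs.\<close>

lemma pattern_star_forest:
  assumes pat: "pattern b t" and last: "0 < t \<longrightarrow> b (t - 1)"
  shows "star_forest \<lparr>verts = {..<t}, edges = {{ctr b i, i} | i. i < t \<and> b i}\<rparr>"
proof -
  define A where "A c = {i. i < t \<and> b i \<and> ctr b i = c}" for c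
  define F where "F = (\<lambda>c. star c (A c)) ` {c. c < t \<and> \<not> b c}"
  have b0: "\<not> b 0" if "i < t" for i using pat that by (auto simp: pattern_def)
  have ctr: "ctr b i < t" "\<not> b (ctr b i)" if "i < t" for i
    using ctr_le[of b i] ctr_centre[of b i] b0[OF that] that by auto
  have star: "nontrivial_star (star c (A c))" if c: "c < t" "\<not> b c" for c
  proof (rule nontrivial_star_star)
    show "finite (A c)" by (simp add: A_def)
    show "c \<notin> A c" using c by (simp add: A_def)
    \<comment> \<open>The last position is a leaf, so a centre has a successor, and that is a leaf
      since centres are not consecutive.\<close>
    have "Suc c < t" using c last by (metis Suc_lessI diff_Suc_1 zero_less_Suc)
    then have "Suc c \<in> A c" using pat c ctr_self[of b c] by (auto simp: A_def pattern_def)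
    then show "A c \<noteq> {}" by blast
  qed
  have disj: "verts (star c (A c)) \<inter> verts (star d (A d)) = {}"
    if "\<not> b c" "\<not> b d" "c \<noteq> d" for c d
    using that by (auto simp: A_def)
  have "verts (star c (A c)) \<subseteq> {..<t}" if "c < t" for c
    using that by (auto simp: A_def)
  moreover have "i \<in> \<Union> (verts ` F)" if "i < t" for i
    using that ctr[OF that] by (cases "b i") (auto simp: F_def A_def)
  ultimately have V: "{..<t} = \<Union> (verts ` F)" by (auto simp: F_def)
  have E: "{{ctr b i, i} | i. i < t \<and> b i} = \<Union> (edges ` F)"
    using ctr by (auto simp: F_def A_def)
  show ?thesis
    unfolding star_forest_def
    by (rule exI[of _ F]) (use star disj V E in \<open>auto simp: F_def\<close>)
qed

section \<open>The weighted enumeration\<close>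

text \<open>
  Sequences are built in reverse. Row \<open>0\<close> holds the sequences that end with a complete star, row
  \<open>Suc v\<close> those whose current centre is \<open>v\<close>. \<open>N\<close> need not be symmetric: it will be the truncated
  adjacency lists.
\<close>

primrec seqs :: "(nat \<Rightarrow> bool) \<Rightarrow> (nat \<Rightarrow> nat list) \<Rightarrow> nat \<Rightarrow> nat \<Rightarrow> nat \<Rightarrow> nat list list" where
  "seqs b N n 0 row = (if row = 0 then [[]] else [])"
| "seqs b N n (Suc t) row =
     (let ext = \<lambda>v. if b t then concat (map (\<lambda>y. map ((#) y) (seqs b N n t (Suc v))) (N v))
                    else map ((#) v) (seqs b N n t 0)
      in case row of 0 \<Rightarrow> if b t then concat (map ext [0..<n]) else [] | Suc v \<Rightarrow> ext v)"

declare seqs.simps(2) [simp del]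

lemma seqs_Suc_Suc:
  "seqs b N n (Suc t) (Suc v) =
     (if b t then concat (map (\<lambda>y. map ((#) y) (seqs b N n t (Suc v))) (N v))
      else map ((#) v) (seqs b N n t 0))"
  by (simp add: seqs.simps(2))

lemma seqs_Suc_0:
  "seqs b N n (Suc t) 0 = (if b t then concat (map (\<lambda>v. seqs b N n (Suc t) (Suc v)) [0..<n]) else [])"
  by (simp add: seqs.simps(2))

text \<open>One induction for both parts, since leaves extend the row of their centre while centres
  start from row 0. Multiplicities in the lists do not matter: they change the total weight but not
  whether it is positive.\<close>

lemma set_seqs:
  "set (seqs b N n t 0) = {q. length q = t \<and> (0 < t \<longrightarrow> b (t - 1)) \<and>
     fits b (\<lambda>v. v < n) (\<lambda>u v. v \<in> set (N u)) (rev q)}" (is "?A t")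
  "v < n \<Longrightarrow> set (seqs b N n t (Suc v)) = {q. length q = t \<and> 0 < t \<and>
     fits b (\<lambda>v. v < n) (\<lambda>u v. v \<in> set (N u)) (rev q) \<and> rev q ! ctr b (t - 1) = v}" (is "_ \<Longrightarrow> ?B t v")
proof -
  let ?fits = "fits b (\<lambda>v. v < n) (\<lambda>u v. v \<in> set (N u))"
  have ctr: "ctr b (length w - 1) < length w" if "w \<noteq> []" for w :: "nat list"
    using ctr_le[of b "length w - 1"] that by (cases w) auto
  have centre: "w ! ctr b (length w - 1) < n" if "w \<noteq> []" "?fits w" for w
  proof -
    have "\<not> b 0" using that by (cases w) (auto simp: fits_def pattern_def)
    then have "\<not> b (ctr b (length w - 1))" by (rule ctr_centre)
    then show ?thesis using ctr[OF that(1)] that(2) by (auto simp: fits_def)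
  qed
  have AB: "?A t \<and> (\<forall>v<n. ?B t v)"
  proof (induction t)
    case 0
    show ?case by auto
  next
    case (Suc t)
    have B: "?B (Suc t) v" if v: "v < n" for v
    proof (rule set_eqI)
      fix q
      show "q \<in> set (seqs b N n (Suc t) (Suc v)) \<longleftrightarrow> q \<in> {q. length q = Suc t \<and> 0 < Suc t \<and>
          ?fits (rev q) \<and> rev q ! ctr b (Suc t - 1) = v}"
      proof (cases "length q = Suc t")
        case False
        then show ?thesis using Suc v by (auto simp: seqs_Suc_Suc split: if_splits)
      next
        case True
        then obtain y p where q: "q = y # p" "length p = t" by (metis length_Suc_conv)
        show ?thesis
        proof (cases "b t")
          case True
          have "ctr b t = ctr b (t - 1)" if "0 < t" using that True by (cases t) auto
          moreover have "ctr b (t - 1) < t" if "0 < t" using ctr_le[of b "t - 1"] that by simp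
          ultimately show ?thesis
            using Suc v True q by (auto simp: seqs_Suc_Suc fits_snoc nth_append)
        next
          case False
          then show ?thesis
            using Suc v q by (auto simp: seqs_Suc_Suc fits_snoc nth_append ctr_self)
        qed
      qed
    qed
    moreover have "?A (Suc t)"
    proof (cases "b t")
      case True
      then have "set (seqs b N n (Suc t) 0) = (\<Union>v<n. {q. length q = Suc t \<and> 0 < Suc t \<and>
          ?fits (rev q) \<and> rev q ! ctr b (Suc t - 1) = v})"
        using B by (auto simp: seqs_Suc_0)
      also have "\<dots> = {q. length q = Suc t \<and> ?fits (rev q)}"
      proof -
        \<comment> \<open>Every fitting sequence has a current centre below \<open>n\<close>, so the
          union over all rows misses none.\<close>
        have "rev q ! ctr b t < n" if "length q = Suc t" "?fits (rev q)" for q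
          using centre[of "rev q"] that by (cases q) auto
        then show ?thesis by auto
      qed
      finally show ?thesis using True by simp
    qed (simp add: seqs_Suc_0)
    ultimately show ?case by (intro conjI allI impI)
  qed
  then show "?A t" by (rule conjunct1)
  assume "v < n"
  then show "?B t v" by (rule AB[THEN conjunct2, rule_format])
qed

section \<open>Column sets as bit masks and the recurrence for the table\<close>

text \<open>
  A table index of \<open>2K\<close> bits encodes the two sets of columns that have been used by the two
  determinants.
\<close>

definition lo :: "nat \<Rightarrow> nat \<Rightarrow> nat set" where
  "lo K idx = {i. i < K \<and> bit idx i}"

definition hi :: "nat \<Rightarrow> nat \<Rightarrow> nat set" where
  "hi K idx = {i. i < K \<and> bit idx (K + i)}"

text \<open>The two minors share the sequence but not the columns, because each expansion deletes a
  column of its own. They are made to coincide at the index \<open>full K t\<close>.\<close>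

definition table :: "(nat \<Rightarrow> bool) \<Rightarrow> (nat \<Rightarrow> nat list) \<Rightarrow> nat \<Rightarrow> nat \<Rightarrow> nat \<Rightarrow> nat \<Rightarrow> nat \<Rightarrow> int" where
  "table b N n K t row idx = (\<Sum>q\<leftarrow>seqs b N n t row. minor q (lo K idx) * minor q (hi K idx))"

lemma finite_lo [simp]: "finite (lo K idx)" and finite_hi [simp]: "finite (hi K idx)"
  by (auto simp: lo_def hi_def)

lemma power_le_of_bit: "2 ^ i \<le> idx" if "bit idx i" for idx :: nat
proof (rule ccontr)
  assume "\<not> 2 ^ i \<le> idx"
  then have "idx div 2 ^ i = 0" by simp
  then show False using that by (simp add: bit_iff_odd)
qed

text \<open>The machine has no bit operations: a column is removed from a set by subtracting its
  power of two, which causes no borrow since the bit is set.\<close>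

lemma bit_diff_power:
  "bit (idx - 2 ^ i) l \<longleftrightarrow> bit idx l \<and> l \<noteq> i" if "bit idx i" for idx :: nat
proof -
  have "2 ^ i \<le> idx" using that by (rule power_le_of_bit)
  then have "int (idx - 2 ^ i) = unset_bit i (int idx)"
    using that by (simp add: unset_bit_eq of_nat_diff bit_of_nat_iff_bit)
  then have "bit (int (idx - 2 ^ i)) l \<longleftrightarrow> bit (int idx) l \<and> l \<noteq> i"
    by (auto simp: bit_unset_bit_iff)
  then show ?thesis by (simp only: bit_of_nat_iff_bit)
qed

text \<open>The inequality guarantees that the truncated subtraction, here and on the machine, is
  not cut off.\<close>

lemma lo_hi_diff:
  assumes "i < K" "j < K" "bit idx i" "bit idx (K + j)"
  shows "lo K (idx - 2 ^ i - 2 ^ (K + j)) = lo K idx - {i}"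
    "hi K (idx - 2 ^ i - 2 ^ (K + j)) = hi K idx - {j}"
    "2 ^ i + 2 ^ (K + j) \<le> idx"
proof -
  have b: "bit (idx - 2 ^ i) (K + j)" using assms bit_diff_power[OF assms(3)] by simp
  show "lo K (idx - 2 ^ i - 2 ^ (K + j)) = lo K idx - {i}"
    "hi K (idx - 2 ^ i - 2 ^ (K + j)) = hi K idx - {j}"
    unfolding lo_def hi_def using assms bit_diff_power[OF assms(3)] bit_diff_power[OF b] by auto
  show "2 ^ i + 2 ^ (K + j) \<le> idx"
    using power_le_of_bit[OF b] power_le_of_bit[OF assms(3)] by simp
qed

text \<open>Laplace expansion of both factors along the row of \<open>y\<close>, written as an
  operator on tables so that, being linear, it applies to the sum over all sequences.\<close>

definition contrib :: "nat \<Rightarrow> nat \<Rightarrow> (nat \<Rightarrow> int) \<Rightarrow> nat \<Rightarrow> int" where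
  "contrib K y f idx = (\<Sum>i\<in>lo K idx. \<Sum>j\<in>hi K idx.
     sg (lo K idx) i * int y ^ i * (sg (hi K idx) j * int y ^ j) * f (idx - 2 ^ i - 2 ^ (K + j)))"

lemma contrib_sum_list:
  "contrib K y (\<lambda>idx. \<Sum>q\<leftarrow>qs. g q idx) idx = (\<Sum>q\<leftarrow>qs. contrib K y (g q) idx)"
  by (induction qs) (simp_all add: contrib_def distrib_left sum.distrib)

lemma minor_contrib:
  "minor (y # q) (lo K idx) * minor (y # q) (hi K idx) =
   contrib K y (\<lambda>idx. minor q (lo K idx) * minor q (hi K idx)) idx"
  unfolding contrib_def minor.simps sum_product
proof (intro sum.cong refl)
  fix i j assume "i \<in> lo K idx" "j \<in> hi K idx"
  then have "i < K" "j < K" "bit idx i" "bit idx (K + j)" by (auto simp: lo_def hi_def)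
  note d = lo_hi_diff[OF this]
  show "sg (lo K idx) i * int y ^ i * minor q (lo K idx - {i}) * (sg (hi K idx) j * int y ^ j * minor q (hi K idx - {j})) =
      sg (lo K idx) i * int y ^ i * (sg (hi K idx) j * int y ^ j) *
      (minor q (lo K (idx - 2 ^ i - 2 ^ (K + j))) * minor q (hi K (idx - 2 ^ i - 2 ^ (K + j))))"
    unfolding d by (simp only: mult_ac)
qed

text \<open>Only the empty sequence remains, and its minors vanish unless both column sets are
  empty. Below the bound \<open>idx\<close> has no bits outside these two sets.\<close>

lemma table_0:
  assumes "idx < 2 ^ K * 2 ^ K"
  shows "table b N n K 0 row idx = (if row = 0 \<and> idx = 0 then 1 else 0)"
proof -
  have "lo K idx = {} \<and> hi K idx = {} \<longleftrightarrow> idx = 0"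
  proof
    assume e: "lo K idx = {} \<and> hi K idx = {}"
    have "\<not> bit idx i" for i
    proof (cases "i < K")
      case True
      then show ?thesis using e by (auto simp: lo_def)
    next
      case False
      then obtain j where j: "i = K + j" by (metis le_Suc_ex not_less)
      show ?thesis
      proof (cases "j < K")
        case True
        then show ?thesis using e j by (auto simp: hi_def)
      next
        case False
        have "idx < 2 ^ (K + K)" using assms by (simp add: power_add)
        also have "\<dots> \<le> 2 ^ i" using False j by (intro power_increasing) auto
        finally show ?thesis using power_le_of_bit[of idx i] by auto
      qed
    qed
    then show "idx = 0" by (intro bit_eqI) auto
  qed (auto simp: lo_def hi_def)
  then show ?thesis by (auto simp: table_def)
qed

lemma table_eq:
  "table b N n K t row = (\<lambda>idx. \<Sum>q\<leftarrow>seqs b N n t row. minor q (lo K idx) * minor q (hi K idx))"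
  by (rule ext) (simp add: table_def)

text \<open>By linearity of \<open>contrib\<close> all sequences of a row are extended by
  \<open>y\<close> at once; this is what replaces their enumeration.\<close>

lemma table_Suc_Suc:
  "table b N n K (Suc t) (Suc v) idx =
     (\<Sum>y\<leftarrow>(if b t then N v else [v]). contrib K y (table b N n K t (if b t then Suc v else 0)) idx)"
proof -
  have *: "(\<Sum>q\<leftarrow>map ((#) y) qs. minor q (lo K idx) * minor q (hi K idx)) =
      contrib K y (\<lambda>idx. \<Sum>q\<leftarrow>qs. minor q (lo K idx) * minor q (hi K idx)) idx" for y qs
    unfolding contrib_sum_list minor_contrib[symmetric] by (simp add: comp_def)
  show ?thesis
  proof (cases "b t")
    case True
    have "(\<Sum>q\<leftarrow>concat (map (\<lambda>y. map ((#) y) qs) ys). minor q (lo K idx) * minor q (hi K idx)) =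
      (\<Sum>y\<leftarrow>ys. contrib K y (\<lambda>idx. \<Sum>q\<leftarrow>qs. minor q (lo K idx) * minor q (hi K idx)) idx)" for ys qs
      by (induction ys) (simp_all add: * del: map_map)
    then show ?thesis using True by (simp add: table_eq seqs_Suc_Suc del: map_map)
  next
    case False
    then show ?thesis by (simp add: table_eq seqs_Suc_Suc * del: map_map)
  qed
qed

lemma table_Suc_0:
  "table b N n K (Suc t) 0 idx = (if b t then \<Sum>v<n. table b N n K (Suc t) (Suc v) idx else 0)"
proof -
  have "(\<Sum>q\<leftarrow>concat (map f [0..<n]). g q) = (\<Sum>v<n. \<Sum>q\<leftarrow>f v. g q)" for f :: "nat \<Rightarrow> nat list list" and g :: "nat list \<Rightarrow> int"
    by (induction n) simp_all
  then show ?thesis by (simp add: table_def seqs_Suc_0)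
qed

text \<open>Both halves of this number are the mask \<open>2 ^ t - 1\<close>, so both determinants
  use the columns below \<open>t\<close> and are Vandermonde determinants.\<close>

definition full :: "nat \<Rightarrow> nat \<Rightarrow> nat" where
  "full K t = (2 ^ t - 1) * (2 ^ K + 1)"

lemma lo_hi_full:
  assumes "t \<le> K"
  shows "lo K (full K t) = {..<t}" "hi K (full K t) = {..<t}"
proof -
  let ?a = "2 ^ t - 1 :: nat"
  have a: "?a = mask t" by (simp add: mask_eq_exp_minus_1)
  have "?a < 2 ^ t" by simp
  also have "\<dots> \<le> 2 ^ K" using assms by (intro power_increasing) auto
  finally have lt: "?a < 2 ^ K" .
  have full: "full K t = ?a + 2 ^ K * ?a" by (simp add: full_def algebra_simps)
  have "bit (full K t) i \<longleftrightarrow> i < t" if "i < K" for i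
  proof -
    \<comment> \<open>The upper half is a multiple of \<open>2 ^ i\<close> with an even cofactor,
      hence it does not touch bit \<open>i\<close>.\<close>
    have "(2 ^ K :: nat) = 2 ^ i * 2 ^ (K - i)" using that by (simp flip: power_add)
    then have "full K t = ?a + (2 ^ (K - i) * ?a) * 2 ^ i"
      unfolding full by (simp only: mult_ac)
    then have "full K t div 2 ^ i = 2 ^ (K - i) * ?a + ?a div 2 ^ i"
      by (simp only: div_mult_self1 power_not_zero zero_neq_numeral not_False_eq_True)
    moreover have "even (2 ^ (K - i) * ?a)" using that by simp
    ultimately have "bit (full K t) i \<longleftrightarrow> bit ?a i" by (simp only: bit_iff_odd) simp
    then show ?thesis unfolding a by (simp add: bit_mask_iff)
  qed
  then show "lo K (full K t) = {..<t}" using assms by (auto simp: lo_def)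
  have "bit (full K t) (K + i) \<longleftrightarrow> i < t" for i
  proof -
    have "full K t div 2 ^ (K + i) = full K t div 2 ^ K div 2 ^ i"
      unfolding power_add by (rule div_mult2_eq)
    also have "full K t div 2 ^ K = ?a"
      unfolding full using div_mult_self2[of "2 ^ K" ?a ?a] div_less[OF lt] by simp
    finally have "bit (full K t) (K + i) \<longleftrightarrow> bit ?a i" unfolding bit_iff_odd by (rule arg_cong)
    then show ?thesis unfolding a by (simp add: bit_mask_iff)
  qed
  then have "hi K (full K t) = {i. i < K \<and> i < t}" unfolding hi_def by (simp only:)
  also have "\<dots> = {..<t}" using assms less_le_trans[of _ t K] by blast
  finally show "hi K (full K t) = {..<t}" .
qed

lemma full_less:
  assumes "t \<le> K"
  shows "full K t < 2 ^ K * 2 ^ K"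
proof -
  define a W :: nat where "a = 2 ^ t - 1" and "W = 2 ^ K"
  have "(2 :: nat) ^ t \<le> 2 ^ K" using assms by (rule power_increasing) simp
  then have "a + 1 \<le> W" by (simp add: a_def W_def)
  then have "a * W + a < (a + 1) * W" by simp
  also have "\<dots> \<le> W * W" using \<open>a + 1 \<le> W\<close> by (rule mult_right_mono) simp
  finally show ?thesis unfolding full_def a_def[symmetric] W_def[symmetric] by (simp add: distrib_left)
qed

lemma table_full:
  assumes "t \<le> K"
  shows "table b N n K t 0 (full K t) = (\<Sum>q\<leftarrow>seqs b N n t 0. (minor q {..<t}) ^ 2)"
  unfolding table_def lo_hi_full[OF assms] by (simp only: power2_eq_square)

lemma table_full_nonneg:
  assumes "t \<le> K"
  shows "0 \<le> table b N n K t 0 (full K t)"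
  unfolding table_full[OF assms] by (rule sum_list_nonneg) auto

lemma table_full_pos_iff:
  assumes "t \<le> K"
  shows "0 < table b N n K t 0 (full K t) \<longleftrightarrow> (\<exists>q\<in>set (seqs b N n t 0). distinct q)"
proof -
  have len: "length q = t" if "q \<in> set (seqs b N n t 0)" for q
    using that by (simp add: set_seqs)
  have "0 < table b N n K t 0 (full K t) \<longleftrightarrow> table b N n K t 0 (full K t) \<noteq> 0"
    using table_full_nonneg[OF assms, of b N n] by auto
  also have "\<dots> \<longleftrightarrow> (\<exists>q\<in>set (seqs b N n t 0). (minor q {..<t}) ^ 2 \<noteq> 0)"
    unfolding table_full[OF assms] by (subst sum_list_nonneg_eq_0_iff) auto
  also have "\<dots> \<longleftrightarrow> (\<exists>q\<in>set (seqs b N n t 0). distinct q)"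
    using len minor_nonzero_iff by (intro bex_cong) auto
  finally show ?thesis .
qed

text \<open>One factor \<open>m\<close> for the choice of a neighbour and one for the sum over all
  rows that forms row 0. The bound is crude but only enters an exponent.\<close>

lemma length_seqs_le:
  assumes "n \<le> m" "1 \<le> m" "\<And>v. v < n \<Longrightarrow> length (N v) \<le> m"
  shows "row \<le> n \<Longrightarrow> length (seqs b N n t row) \<le> (m * m) ^ t"
proof (induction t arbitrary: row)
  case (Suc t)
  have 1: "length (seqs b N n (Suc t) (Suc v)) \<le> m * (m * m) ^ t" if "v < n" for v
  proof (cases "b t")
    case True
    have "length (concat (map (\<lambda>y. map ((#) y) qs) ys)) = length ys * length qs" for qs :: "nat list list" and ys
      by (induction ys) auto
    then have "length (seqs b N n (Suc t) (Suc v)) = length (N v) * length (seqs b N n t (Suc v))"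
      using True by (simp add: seqs_Suc_Suc)
    also have "\<dots> \<le> m * (m * m) ^ t"
      using that assms Suc.IH by (intro mult_le_mono) auto
    finally show ?thesis .
  next
    case False
    then have "length (seqs b N n (Suc t) (Suc v)) \<le> 1 * (m * m) ^ t"
      using Suc.IH[of 0] by (simp add: seqs_Suc_Suc)
    also have "\<dots> \<le> m * (m * m) ^ t" using assms by (intro mult_le_mono) auto
    finally show ?thesis .
  qed
  show ?case
  proof (cases row)
    case 0
    have "length (concat (map (\<lambda>v. seqs b N n (Suc t) (Suc v)) [0..<k])) \<le> k * (m * (m * m) ^ t)" if "k \<le> n" for k
      using that
    proof (induction k)
      case (Suc k)
      then show ?case using 1[of k] by simp
    qed simp
    from this[of n] have "length (seqs b N n (Suc t) 0) \<le> n * (m * (m * m) ^ t)"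
      by (simp add: seqs_Suc_0)
    also have "\<dots> \<le> m * (m * (m * m) ^ t)" using assms by (intro mult_right_mono) auto
    finally show ?thesis using 0 by (simp add: mult_ac)
  next
    case (Suc v)
    then have "length (seqs b N n (Suc t) row) \<le> 1 * (m * (m * m) ^ t)" using 1 Suc.prems by simp
    also have "\<dots> \<le> m * (m * (m * m) ^ t)" using assms by (intro mult_right_mono) auto
    finally show ?thesis by (simp add: mult_ac)
  qed
qed simp

text \<open>There are at most \<open>m ^ (2 * K)\<close> sequences, each weighted with a square of
  at most \<open>m ^ (2 * K * (K + 1))\<close>.\<close>

lemma table_full_le:
  assumes "n \<le> m" "1 \<le> m" "\<And>v. v < n \<Longrightarrow> length (N v) \<le> m" "t \<le> K" "K \<le> m"
    and N: "\<And>v y. v < n \<Longrightarrow> y \<in> set (N v) \<Longrightarrow> y < n"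
  shows "table b N n K t 0 (full K t) \<le> int (m ^ (2 * K * K + 4 * K))"
proof -
  let ?B = "(m * m ^ K) ^ K"
  have "(minor q {..<t}) ^ 2 \<le> int (?B ^ 2)" if q: "q \<in> set (seqs b N n t 0)" for q
  proof -
    have f: "fits b (\<lambda>v. v < n) (\<lambda>u v. v \<in> set (N u)) (rev q)" and len: "length q = t"
      using q by (auto simp: set_seqs)
    have "\<forall>a\<in>set (rev q). a < n"
    proof
      fix a assume "a \<in> set (rev q)"
      then obtain i where i: "i < length (rev q)" "rev q ! i = a" by (metis in_set_conv_nth)
      have "\<not> b 0" using f i by (auto simp: fits_def pattern_def)
      then have "rev q ! ctr b i < n"
        using f ctr_le[of b i] ctr_centre[of b i] i by (auto simp: fits_def)
      then show "a < n" using f i N by (auto simp: fits_def split: if_splits)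
    qed
    then have "\<bar>minor q {..<t}\<bar> \<le> int ((K * m ^ K) ^ length q)"
      using assms by (intro abs_minor_le) auto
    also have "(K * m ^ K) ^ length q \<le> ?B"
      unfolding len using assms by (intro order.trans[OF power_mono[of "K * m ^ K" "m * m ^ K"]] power_increasing mult_le_mono) auto
    finally have "\<bar>minor q {..<t}\<bar> \<le> int ?B" by simp
    then have "\<bar>minor q {..<t}\<bar> ^ 2 \<le> int ?B ^ 2" by (intro power_mono) auto
    then show ?thesis by simp
  qed
  then have "(\<Sum>q\<leftarrow>seqs b N n t 0. (minor q {..<t}) ^ 2) \<le> (\<Sum>q\<leftarrow>seqs b N n t 0. int (?B ^ 2))"
    by (intro sum_list_mono)
  also have "\<dots> = int (length (seqs b N n t 0) * ?B ^ 2)"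
    by (simp add: sum_list_triv)
  also have "length (seqs b N n t 0) * ?B ^ 2 \<le> (m * m) ^ K * ?B ^ 2"
    using length_seqs_le[of n m N 0 b t] assms
    by (intro mult_le_mono order.trans[OF _ power_increasing[of t K "m * m"]]) auto
  also have "\<dots> = m ^ (2 * K * K + 4 * K)"
    unfolding power2_eq_square[symmetric, of m] power_Suc[symmetric] power_mult[symmetric] power_add[symmetric]
    by (simp add: algebra_simps)
  finally show ?thesis unfolding table_full[OF assms(4)] by simp
qed

section \<open>Embeddings of forests as sequences of indices, and back\<close>

lemma adjacency_fits_index:
  assumes "adjacency_lists G L" "subgraph H G" "simple_graph G"
    and "distinct w" "set w \<subseteq> verts H" "fits b (\<lambda>v. v \<in> verts H) (\<lambda>u v. {u, v} \<in> edges H) w"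
  shows "\<exists>w'. length w' = length w \<and> distinct w' \<and>
    fits b (\<lambda>v. v < length L) (\<lambda>u v. v \<in> set (L ! u)) w'"
proof -
  obtain vs where vs: "distinct vs" "set vs = verts G" "length L = length vs"
    and nbs: "\<forall>i < length vs. distinct (L ! i) \<and> set (L ! i) = {j. j < length vs \<and> {vs ! i, vs ! j} \<in> edges G}"
    using assms(1) unfolding adjacency_lists_def by (elim exE conjE) (rule that)
  have adj: "set (L ! i) = {j. j < length vs \<and> {vs ! i, vs ! j} \<in> edges G}" if "i < length vs" for i
    using nbs that by simp
  obtain \<phi> where \<phi>: "\<phi> ` verts H \<subseteq> verts G" "inj_on \<phi> (verts H)"
    "\<forall>u v. {u, v} \<in> edges H \<longrightarrow> {\<phi> u, \<phi> v} \<in> edges G"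
    using assms(2) unfolding subgraph_def by (elim exE conjE) (rule that)
  have \<phi>V: "\<phi> v \<in> verts G" if "v \<in> verts H" for v using \<phi>(1) that by (rule subsetD[OF _ imageI])
  define ix where "ix u = (SOME i. i < length vs \<and> vs ! i = u)" for u
  have ix: "ix u < length vs \<and> vs ! ix u = u" if "u \<in> verts G" for u
  proof -
    have "u \<in> set vs" using that vs(2) by simp
    then have "\<exists>i. i < length vs \<and> vs ! i = u" by (simp add: in_set_conv_nth)
    then show ?thesis unfolding ix_def by (rule someI_ex)
  qed
  define f where "f u = ix (\<phi> u)" for u
  have "inj_on f (verts H)"
  proof (rule inj_onI)
    fix u v assume uv: "u \<in> verts H" "v \<in> verts H" "f u = f v"
    have "\<phi> u = vs ! f u" "vs ! f v = \<phi> v" using ix[OF \<phi>V] uv(1,2) by (simp_all add: f_def)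
    then have "\<phi> u = \<phi> v" unfolding uv(3) by (rule trans)
    then show "u = v" by (rule inj_onD[OF \<phi>(2) _ uv(1,2)])
  qed
  then have "distinct (map f w)" using assms(4,5) by (simp add: distinct_map inj_on_subset)
  moreover have "fits b (\<lambda>v. v < length L) (\<lambda>u v. v \<in> set (L ! u)) (map f w)"
  proof (rule fits_map[OF assms(6)])
    show "f v < length L" if "v \<in> verts H" for v
      using ix \<phi>V that by (simp add: f_def vs(3))
    show "f v \<in> set (L ! f u)" if "{u, v} \<in> edges H" for u v
    proof -
      have e: "{\<phi> u, \<phi> v} \<in> edges G" using \<phi>(3) that by simp
      \<comment> \<open>The edge \<open>{u, v}\<close> comes without the information that its ends
        are vertices of \<open>H\<close>; that the images are vertices is read off from the edge of
        \<open>G\<close>.\<close>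
      then obtain x y where xy: "x \<in> verts G" "y \<in> verts G" "{\<phi> u, \<phi> v} = {x, y}"
        using assms(3) unfolding simple_graph_def by metis
      then have "\<phi> u \<in> verts G" "\<phi> v \<in> verts G" by (auto simp: doubleton_eq_iff)
      then show ?thesis using ix[of "\<phi> u"] ix[of "\<phi> v"] e by (simp add: adj f_def)
    qed
  qed
  ultimately show ?thesis by (intro exI[of _ "map f w"]) simp
qed

lemma adjacency_distinct:
  assumes "adjacency_lists G L" "u < length L"
  shows "distinct (L ! u)" "\<And>v. v \<in> set (L ! u) \<Longrightarrow> v < length L"
  using assms unfolding adjacency_lists_def by force+

lemma subgraph_of_fits:
  assumes "adjacency_lists G L" "distinct w"
    and fits: "fits b (\<lambda>v. v < length L) (\<lambda>u v. v \<in> set (L ! u)) w"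
  shows "subgraph \<lparr>verts = {..<length w}, edges = {{ctr b i, i} | i. i < length w \<and> b i}\<rparr> G"
proof -
  obtain vs where vs: "distinct vs" "set vs = verts G" "length L = length vs"
    and nbs: "\<forall>i < length vs. distinct (L ! i) \<and> set (L ! i) = {j. j < length vs \<and> {vs ! i, vs ! j} \<in> edges G}"
    using assms(1) unfolding adjacency_lists_def by (elim exE conjE) (rule that)
  have adj: "set (L ! i) = {j. j < length vs \<and> {vs ! i, vs ! j} \<in> edges G}" if "i < length vs" for i
    using nbs that by simp
  have centre: "w ! ctr b i < length vs" "ctr b i < length w" if "i < length w" for i
  proof -
    have "\<not> b 0" using fits that by (auto simp: fits_def pattern_def)
    then have "\<not> b (ctr b i)" by (rule ctr_centre)
    moreover show "ctr b i < length w" using ctr_le[of b i] that by simp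
    ultimately show "w ! ctr b i < length vs" using fits vs(3) by (auto simp: fits_def)
  qed
  have lt: "w ! i < length vs" if "i < length w" for i
    using fits that centre[OF that] adj vs(3) by (auto simp: fits_def split: if_splits)
  define \<phi> where "\<phi> i = vs ! (w ! i)" for i
  have edge: "{\<phi> (ctr b i), \<phi> i} \<in> edges G" if i: "i < length w" "b i" for i
  proof -
    have "w ! i \<in> set (L ! (w ! ctr b i))" using fits i by (simp add: fits_def)
    then show ?thesis unfolding \<phi>_def using adj[OF centre(1)[OF i(1)]] by simp
  qed
  show ?thesis
    unfolding subgraph_def
  proof (intro exI[of _ \<phi>] conjI allI impI)
    show "\<phi> ` verts \<lparr>verts = {..<length w}, edges = {{ctr b i, i} | i. i < length w \<and> b i}\<rparr> \<subseteq> verts G"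
      using lt vs(2) by (auto simp: \<phi>_def)
    show "inj_on \<phi> (verts \<lparr>verts = {..<length w}, edges = {{ctr b i, i} | i. i < length w \<and> b i}\<rparr>)"
      using lt vs(1) assms(2) by (auto simp: \<phi>_def inj_on_def nth_eq_iff_index_eq)
    fix u v assume "{u, v} \<in> edges \<lparr>verts = {..<length w}, edges = {{ctr b i, i} | i. i < length w \<and> b i}\<rparr>"
    then obtain i where i: "{u, v} = {ctr b i, i}" "i < length w" "b i" by auto
    then have "{\<phi> u, \<phi> v} = {\<phi> (ctr b i), \<phi> i}" by (auto simp: doubleton_eq_iff)
    then show "{\<phi> u, \<phi> v} \<in> edges G" using edge i by simp
  qed
qed

text \<open>Only the first \<open>K\<close> positions of a pattern matter, so a loop over the
  numbers below \<open>2 ^ K\<close> meets every pattern.\<close>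

lemma pattern_number:
  "\<exists>r < 2 ^ K. \<forall>i < K. bit (r :: nat) i = b i"
proof (intro exI conjI allI impI)
  let ?r = "horner_sum of_bool 2 (map b [0..<K]) :: nat"
  show "?r < 2 ^ K" using horner_sum_of_bool_2_less[of "map b [0..<K]"] by simp
  show "bit ?r i = b i" if "i < K" for i using that by (simp add: bit_horner_sum_bit_iff)
qed

text \<open>Sharing \<open>r\<close> and \<open>t\<close> is the point: two sequences that fit the
  same pattern embed the same forest on positions. Conversely, one prefix of the listing of
  \<open>H\<close> is carried into each graph separately, and there its leaves are moved into the
  truncated lists.\<close>

theorem mcsf_iff_table:
  fixes h :: nat
  assumes "simple_graph G1" "simple_graph G2" "adjacency_lists G1 L1" "adjacency_lists G2 L2"
  defines "K \<equiv> Suc h"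
  defines "table' \<equiv> \<lambda>L r t. table (bit (r :: nat)) (\<lambda>v. take K (L ! v)) (length L) K t 0 (full K t)"
  shows "mcsf (G1, G2, h) \<longleftrightarrow> (\<exists>r < 2 ^ K. \<exists>t\<in>{h, Suc h}. 0 < table' L1 r t \<and> 0 < table' L2 r t)"
proof
  define good where "good L r t w \<longleftrightarrow> distinct w \<and> length w = t \<and> (0 < t \<longrightarrow> bit r (t - 1)) \<and>
      fits (bit r) (\<lambda>v. v < length L) (\<lambda>u v. v \<in> set (take K (L ! u))) w"
    for L :: "nat list list" and r t :: nat and w
  have pos: "0 < table' L r t \<longleftrightarrow> (\<exists>w. good L r t w)" if "t \<in> {h, Suc h}" for L t and r :: nat
  proof -
    have tK: "t \<le> K" using that by (auto simp: K_def)
    have "0 < table' L r t \<longleftrightarrow> (\<exists>q. good L r t (rev q))"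
      unfolding table'_def table_full_pos_iff[OF tK] set_seqs good_def by auto
    also have "\<dots> \<longleftrightarrow> (\<exists>w. good L r t w)"
    proof (intro iffI; elim exE)
      fix w assume "good L r t w"
      then show "\<exists>q. good L r t (rev q)" by (intro exI[of _ "rev w"]) simp
    qed blast
    finally show ?thesis .
  qed
  {
    assume "\<exists>r < 2 ^ K. \<exists>t\<in>{h, Suc h}. 0 < table' L1 r t \<and> 0 < table' L2 r t"
    then obtain r t where t: "t \<in> {h, Suc h}" and "0 < table' L1 r t" "0 < table' L2 r t" by blast
    then obtain w1 w2 where "good L1 r t w1" "good L2 r t w2" using pos[OF t] by blast
    then have last: "0 < t \<longrightarrow> bit r (t - 1)"
      and w1: "distinct w1" "length w1 = t"
        "fits (bit r) (\<lambda>v. v < length L1) (\<lambda>u v. v \<in> set (take K (L1 ! u))) w1"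
      and w2: "distinct w2" "length w2 = t"
        "fits (bit r) (\<lambda>v. v < length L2) (\<lambda>u v. v \<in> set (take K (L2 ! u))) w2"
      unfolding good_def by simp_all
    let ?H = "\<lparr>verts = {..<t}, edges = {{ctr (bit r) i, i} | i. i < t \<and> bit r i}\<rparr>"
    have untake: "fits (bit r) (\<lambda>v. v < length L) (\<lambda>u v. v \<in> set (L ! u)) w"
      if "fits (bit r) (\<lambda>v. v < length L) (\<lambda>u v. v \<in> set (take K (L ! u))) w" for L w
      using fits_map[OF that, of "\<lambda>v. v < length L" id "\<lambda>u v. v \<in> set (L ! u)"] by (auto dest: in_set_takeD)
    have "star_forest ?H"
      using w1 last by (intro pattern_star_forest) (auto simp: fits_def)
    moreover have "h \<le> card (verts ?H)" using t by auto
    moreover have "subgraph ?H G1" using subgraph_of_fits[OF assms(3) w1(1) untake[OF w1(3)]] w1(2) by simp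
    moreover have "subgraph ?H G2" using subgraph_of_fits[OF assms(4) w2(1) untake[OF w2(3)]] w2(2) by simp
    ultimately show "mcsf (G1, G2, h)" unfolding mcsf.simps by (intro exI[of _ ?H] conjI)
  }
  assume "mcsf (G1, G2, h)"
  then obtain H :: "nat graph" where H: "star_forest H" "h \<le> card (verts H)" "subgraph H G1" "subgraph H G2"
    by auto
  obtain b w where w: "distinct w" "set w = verts H" "w \<noteq> [] \<longrightarrow> b (length w - 1)"
    "fits b (\<lambda>v. v \<in> verts H) (\<lambda>u v. {u, v} \<in> edges H) w"
    using star_forest_sequence[OF H(1)] by (elim exE conjE) (rule that)
  have len: "h \<le> length w" using H(2) w(1,2) by (metis distinct_card)
  have "\<exists>t\<in>{h, Suc h}. t \<le> length w \<and> (0 < t \<longrightarrow> b (t - 1))"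
  proof (cases "0 < h \<longrightarrow> b (h - 1)")
    case True
    then show ?thesis using len by auto
  next
    case False
    then have "h \<noteq> length w" using w(3) by auto
    then have "h < length w" using len by simp
    \<comment> \<open>Position \<open>h - 1\<close> is a centre, so the next one is a leaf.\<close>
    moreover have "b h" using w(4) False \<open>h < length w\<close> by (cases h) (auto simp: fits_def pattern_def)
    ultimately show ?thesis by auto
  qed
  then obtain t where t: "t \<in> {h, Suc h}" "t \<le> length w" "0 < t \<longrightarrow> b (t - 1)" by blast
  have tK: "t \<le> K" using t(1) by (auto simp: K_def)
  obtain r :: nat where r: "r < 2 ^ K" "\<And>i. i < K \<Longrightarrow> bit r i = b i" using pattern_number by blast
  have "0 < table' L r t" if adj: "adjacency_lists G L" and sub: "subgraph H G" "simple_graph G" for G :: "nat graph" and L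
  proof -
    have f: "fits b (\<lambda>v. v \<in> verts H) (\<lambda>u v. {u, v} \<in> edges H) (take t w)"
      using w(4) by (rule fits_take)
    have "set (take t w) \<subseteq> verts H" using w(2) by (metis set_take_subset)
    then obtain w' where w': "length w' = t" "distinct w'"
      "fits b (\<lambda>v. v < length L) (\<lambda>u v. v \<in> set (L ! u)) w'"
      using adjacency_fits_index[OF adj sub distinct_take[OF w(1)] _ f] t(2) by auto
    then obtain w'' where w'': "length w'' = t" "distinct w''"
      "fits b (\<lambda>v. v < length L) (\<lambda>u v. v \<in> set (take K (L ! u))) w''"
      using fits_truncate[OF w'(3,2), of K] tK adjacency_distinct(1)[OF adj] by auto
    have "fits (bit r) (\<lambda>v. v < length L) (\<lambda>u v. v \<in> set (take K (L ! u))) w''"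
      using w''(3) by (subst fits_cong[where b' = b]) (use w''(1) tK r(2) in auto)
    moreover have "0 < t \<longrightarrow> bit r (t - 1)" using t(3) tK r(2) by auto
    ultimately show ?thesis
      using w'' unfolding pos[OF t(1)] good_def by (intro exI[of _ w''] conjI)
  qed
  then show "\<exists>r < 2 ^ K. \<exists>t\<in>{h, Suc h}. 0 < table' L1 r t \<and> 0 < table' L2 r t"
    using r(1) t(1) assms(1-4) H(3,4) by (intro exI[of _ r] conjI bexI[of _ t])
qed

section \<open>Total correctness of random access programs\<close>

text \<open>\<open>eval\<close> without the word bound, so that programs are verified in ordinary
  arithmetic; \<open>eval_val\<close> settles overflow for all expressions at once.\<close>

primrec val :: "nat list \<Rightarrow> mem \<Rightarrow> exp \<Rightarrow> nat" where
  "val x s (Const k) = k"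
| "val x s (Mem e) = s (val x s e)"
| "val x s (Inp e) = (if val x s e < length x then x ! val x s e else 0)"
| "val x s (Add d e) = val x s d + val x s e"
| "val x s (Sub d e) = val x s d - val x s e"
| "val x s (Mul d e) = val x s d * val x s e"
| "val x s (Div d e) = val x s d div val x s e"

primrec leaves :: "exp \<Rightarrow> nat" where
  "leaves (Const k) = 1"
| "leaves (Mem e) = leaves e"
| "leaves (Inp e) = leaves e"
| "leaves (Add d e) = leaves d + leaves e"
| "leaves (Sub d e) = leaves d + leaves e"
| "leaves (Mul d e) = leaves d + leaves e"
| "leaves (Div d e) = leaves d + leaves e"

primrec consts_below :: "nat \<Rightarrow> exp \<Rightarrow> bool" where
  "consts_below X (Const k) \<longleftrightarrow> k < X"
| "consts_below X (Mem e) \<longleftrightarrow> consts_below X e"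
| "consts_below X (Inp e) \<longleftrightarrow> consts_below X e"
| "consts_below X (Add d e) \<longleftrightarrow> consts_below X d \<and> consts_below X e"
| "consts_below X (Sub d e) \<longleftrightarrow> consts_below X d \<and> consts_below X e"
| "consts_below X (Mul d e) \<longleftrightarrow> consts_below X d \<and> consts_below X e"
| "consts_below X (Div d e) \<longleftrightarrow> consts_below X d \<and> consts_below X e"

lemma leaves_pos: "0 < leaves e"
  by (induction e) auto

text \<open>The sum is the delicate case: it needs \<open>u + v \<le> u * v\<close>, which holds as
  both powers are at least 2.\<close>

lemma power_add_bounds:
  fixes X :: nat
  assumes "a < X ^ i" "b < X ^ j" "2 \<le> X" "0 < i" "0 < j"
  shows "a + b < X ^ (i + j)" "a - b < X ^ (i + j)" "a * b < X ^ (i + j)" "a div b < X ^ (i + j)"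
proof -
  have X: "2 \<le> X ^ i" "2 \<le> X ^ j"
    using assms by (metis le_trans self_le_power le_eq_less_or_eq pos2 less_le_trans One_nat_def Suc_leI)+
  have le: "X ^ i \<le> X ^ (i + j)"
    using assms by (intro power_increasing) auto
  obtain c d where cd: "X ^ i = a + 1 + c" "X ^ j = b + 1 + d"
    using assms(1,2) by (metis Suc_eq_plus1 add_Suc_right less_iff_Suc_add add.assoc add.commute)
  show "a - b < X ^ (i + j)" "a div b < X ^ (i + j)"
    using assms(1) le div_le_dividend[of a b] by linarith+
  show "a * b < X ^ (i + j)"
    unfolding power_add using assms by (intro mult_strict_mono) auto
  have "X ^ i + X ^ j \<le> X ^ i * X ^ j"
  proof -
    obtain u v where "X ^ i = u + 2" "X ^ j = v + 2"
      using X by (metis add.commute le_Suc_ex)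
    then show ?thesis by (simp add: algebra_simps)
  qed
  then show "a + b < X ^ (i + j)"
    using assms(1,2) unfolding power_add by linarith
qed

text \<open>
  The word length is chosen so generously (\<open>X\<^sup>2\<^sup>0 \<le> 2\<^sup>w\<close>) that no expression over a memory with values
  below \<open>X\<close> can overflow if it has at most 20 leaves; only stored values have to be bounded.
\<close>

locale ram =
  fixes w :: nat and x :: "nat list" and X :: nat
  assumes inputs_below: "\<And>v. v \<in> set x \<Longrightarrow> v < X"
    and X_ge: "100 \<le> X"
    and X_le: "X ^ 20 \<le> 2 ^ w"
begin

text \<open>The largest expression of the program, the condition of \<open>check_results\<close>,
  has 18 leaves.\<close>

definition ok :: "exp \<Rightarrow> bool" where
  "ok e \<longleftrightarrow> leaves e \<le> 20 \<and> consts_below 100 e"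

text \<open>That all cells stay below \<open>X\<close> is carried along silently before and after
  the program, so that proofs only bound the values that are stored.\<close>

definition wp :: "com \<Rightarrow> (mem \<Rightarrow> bool) \<Rightarrow> nat \<Rightarrow> mem \<Rightarrow> bool" where
  "wp c Q T s \<longleftrightarrow> (\<forall>a. s a < X) \<longrightarrow>
     (\<exists>t s'. exec w x c s t s' \<and> t \<le> T \<and> (\<forall>a. s' a < X) \<and> Q s')"

lemma val_less:
  assumes "\<forall>a. s a < X" "consts_below 100 e"
  shows "val x s e < X ^ leaves e"
  using assms(2)
proof (induction e)
  case (Const k)
  then show ?case using X_ge by simp
next
  case (Mem e)
  have "X \<le> X ^ leaves e"
    using X_ge leaves_pos by (intro self_le_power) auto
  then show ?case using assms(1) by (auto intro: less_le_trans)
next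
  case (Inp e)
  have "X \<le> X ^ leaves e"
    using X_ge leaves_pos by (intro self_le_power) auto
  moreover have "val x s (Inp e) < X"
    using X_ge inputs_below by (auto simp: nth_mem)
  ultimately show ?case by simp
qed (use X_ge in \<open>auto intro!: power_add_bounds leaves_pos\<close>)

lemma eval_val:
  assumes "\<forall>a. s a < X" "consts_below 100 e" "leaves e \<le> 20"
  shows "eval w x s e = Some (val x s e)"
proof -
  have fits: "val x s e < 2 ^ w" if "consts_below 100 e" "leaves e \<le> 20" for e
  proof -
    have "val x s e < X ^ leaves e" using val_less assms(1) that by blast
    also have "\<dots> \<le> X ^ 20" using that X_ge by (intro power_increasing) auto
    also note X_le
    finally show ?thesis .
  qed
  show ?thesis using assms(2,3)
  proof (induction e)
    case (Inp e)
    then show ?case using fits[of "Inp e"] by (simp add: word_def)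
  qed (use fits in \<open>(fastforce simp: word_def binop_def)+\<close>)
qed

lemma wp_bounded: "((\<And>a. s a < X) \<Longrightarrow> wp c Q T s) \<Longrightarrow> wp c Q T s"
  unfolding wp_def by blast

lemma wp_mono:
  "wp c Q T s \<Longrightarrow> T \<le> T' \<Longrightarrow> (\<And>s'. (\<And>a. s' a < X) \<Longrightarrow> Q s' \<Longrightarrow> Q' s') \<Longrightarrow> wp c Q' T' s"
  unfolding wp_def by (meson le_trans)

lemma wp_time: "wp c Q T s \<Longrightarrow> T \<le> T' \<Longrightarrow> wp c Q T' s"
  by (rule wp_mono)

lemma wp_Skip: "Q s \<Longrightarrow> wp Skip Q 1 s"
  unfolding wp_def by (blast intro: exec.Skip)

lemma wp_Store:
  assumes "Q (s(val x s d := val x s e))" "val x s e < X" "ok d" "ok e"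
  shows "wp (Store d e) Q (cost d + cost e + 1) s"
  unfolding wp_def
proof
  assume s: "\<forall>a. s a < X"
  have "exec w x (Store d e) s (cost d + cost e + 1) (s(val x s d := val x s e))"
    using eval_val s assms unfolding ok_def by (intro exec.Store) auto
  then show "\<exists>t s'. exec w x (Store d e) s t s' \<and> t \<le> cost d + cost e + 1 \<and> (\<forall>a. s' a < X) \<and> Q s'"
    using s assms by (intro exI[of _ "cost d + cost e + 1"] exI[of _ "s(val x s d := val x s e)"]) auto
qed

lemma wp_Seq:
  assumes "wp P (\<lambda>s'. wp P' Q T' s') T s"
  shows "wp (Seq P P') Q (T + T') s"
  using assms unfolding wp_def by (meson exec.Seq add_le_mono)

lemma wp_Cond:
  assumes "val x s e \<noteq> 0 \<Longrightarrow> wp P Q T s" "val x s e = 0 \<Longrightarrow> wp P' Q T s" "ok e"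
  shows "wp (Cond e P P') Q (cost e + 1 + T) s"
proof (rule wp_bounded)
  assume s: "\<And>a. s a < X"
  then have ev: "eval w x s e = Some (val x s e)" using eval_val assms(3) unfolding ok_def by blast
  show "wp (Cond e P P') Q (cost e + 1 + T) s"
  proof (cases "val x s e = 0")
    case True
    then show ?thesis using assms(2) ev unfolding wp_def
      by (metis exec.Cond_False add_le_cancel_left)
  next
    case False
    then show ?thesis using assms(1) ev unfolding wp_def
      by (metis exec.Cond_True add_le_cancel_left)
  qed
qed

end

abbreviation V :: "nat \<Rightarrow> exp" where
  "V k \<equiv> Mem (Const k)"

definition For :: "nat \<Rightarrow> exp \<Rightarrow> com \<Rightarrow> com" where
  "For c b body = Seq (Store (Const c) (Const 0))
     (While (Sub b (V c)) (Seq body (Store (Const c) (Add (V c) (Const 1)))))"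

context ram
begin

text \<open>The truncated difference is non-zero exactly while the counter is below
  \<open>b\<close>. As \<open>b\<close> is evaluated anew in each round, the invariant has to fix
  its value. A round costs \<open>T\<close>, plus \<open>cost b + 4\<close> for the test and 6 for
  the increment; the initial store is absorbed in the 13.\<close>

lemma wp_For:
  assumes Iz: "I 0 (s(c := 0))"
    and step: "\<And>k s. k < N \<Longrightarrow> I k s \<Longrightarrow> s c = k \<Longrightarrow> (\<And>a. s a < X) \<Longrightarrow>
      wp body (\<lambda>s'. s' c = k \<and> I (Suc k) (s'(c := Suc k))) T s"
    and bound: "\<And>k s. k \<le> N \<Longrightarrow> I k s \<Longrightarrow> s c = k \<Longrightarrow> val x s b = N"
    and N: "N < X" and b: "leaves b \<le> 19" "consts_below 100 b" and c: "c < 100"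
    and Q: "\<And>s. I N s \<Longrightarrow> s c = N \<Longrightarrow> (\<And>a. s a < X) \<Longrightarrow> Q s"
  shows "wp (For c b body) Q ((N + 1) * (T + cost b + 13)) s"
proof -
  let ?e = "Sub b (V c)"
  let ?W = "While ?e (Seq body (Store (Const c) (Add (V c) (Const 1))))"
  have oke: "consts_below 100 ?e" "leaves ?e \<le> 20" using b c by auto
  have loop: "wp ?W Q ((d + 1) * (T + cost b + 10)) s" if "I (N - d) s" "s c = N - d" "d \<le> N" for d s
    using that
  proof (induction d arbitrary: s)
    case 0
    show ?case unfolding wp_def
    proof
      assume s: "\<forall>a. s a < X"
      have "val x s ?e = 0" using bound[of N s] 0 by simp
      then have "exec w x ?W s (cost ?e + 1) s"
        using eval_val[OF s oke] by (intro exec.While_False) auto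
      then show "\<exists>t s'. exec w x ?W s t s' \<and> t \<le> (0 + 1) * (T + cost b + 10) \<and> (\<forall>a. s' a < X) \<and> Q s'"
        using s Q 0 by (intro exI[of _ "cost ?e + 1"] exI[of _ s]) auto
    qed
  next
    case (Suc d)
    show ?case unfolding wp_def
    proof
      assume s: "\<forall>a. s a < X"
      let ?k = "N - Suc d"
      have k: "?k < N" "Suc ?k = N - d" using Suc.prems by auto
      have vb: "val x s b = N" using bound[of ?k s] Suc.prems by simp
      then have e: "eval w x s ?e = Some (val x s ?e)" "val x s ?e \<noteq> 0"
        using eval_val[OF s oke] Suc.prems by auto
      obtain t1 s1 where 1: "exec w x body s t1 s1" "t1 \<le> T" "\<forall>a. s1 a < X" "s1 c = ?k" "I (Suc ?k) (s1(c := Suc ?k))"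
        using step[OF k(1) Suc.prems(1,2)] s unfolding wp_def by blast
      let ?s2 = "s1(c := Suc ?k)"
      have "exec w x (Store (Const c) (Add (V c) (Const 1))) s1 (cost (Const c) + cost (Add (V c) (Const 1)) + 1) ?s2"
        by (rule exec.Store) (use eval_val[OF 1(3), of "Const c"] eval_val[OF 1(3), of "Add (V c) (Const 1)"] c 1(4) in auto)
      moreover have cst: "cost (Const c) + cost (Add (V c) (Const 1)) + 1 = 6" by simp
      ultimately have 2: "exec w x (Seq body (Store (Const c) (Add (V c) (Const 1)))) s (t1 + 6) ?s2"
        using exec.Seq[OF 1(1)] by (metis cst)
      have s2: "\<forall>a. ?s2 a < X" using 1(3) N k by auto
      have W: "wp ?W Q ((d + 1) * (T + cost b + 10)) ?s2"
        using 1(5) k Suc.prems(3) by (intro Suc.IH) (simp_all only: fun_upd_same Suc_leD)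
      obtain t3 s3 where 3: "exec w x ?W ?s2 t3 s3" "t3 \<le> (d + 1) * (T + cost b + 10)" "\<forall>a. s3 a < X" "Q s3"
        using W s2 unfolding wp_def by blast
      have "exec w x ?W s (cost ?e + 1 + (t1 + 6) + t3) s3"
        by (rule exec.While_True[OF e 2 3(1)])
      then show "\<exists>t s'. exec w x ?W s t s' \<and> t \<le> (Suc d + 1) * (T + cost b + 10) \<and> (\<forall>a. s' a < X) \<and> Q s'"
        using 1(2) 3 by (intro exI[of _ "cost ?e + 1 + (t1 + 6) + t3"] exI[of _ s3]) auto
    qed
  qed
  have "wp ?W Q ((N + 1) * (T + cost b + 10)) (s(c := 0))"
    using loop[of N "s(c := 0)"] Iz by simp
  then have "wp (For c b body) Q (3 + (N + 1) * (T + cost b + 10)) s"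
    unfolding For_def using c X_ge
    by (intro wp_time[OF wp_Seq[OF wp_Store]]) (auto simp: ok_def)
  then show ?thesis by (rule wp_time) (simp add: algebra_simps)
qed

end

section \<open>The program\<close>

definition same :: "nat set \<Rightarrow> mem \<Rightarrow> mem \<Rightarrow> bool" where
  "same A s s' \<longleftrightarrow> (\<forall>a. a \<notin> A \<longrightarrow> s' a = s a)"

lemma sameD: "same A s s' \<Longrightarrow> a \<notin> A \<Longrightarrow> s' a = s a"
  by (simp add: same_def)

lemma same_refl [simp]: "same A s s"
  by (simp add: same_def)

lemma same_trans: "same A s s' \<Longrightarrow> same B s' s'' \<Longrightarrow> A \<subseteq> C \<Longrightarrow> B \<subseteq> C \<Longrightarrow> same C s s''"
  unfolding same_def by (metis subsetD)

text \<open>The machine has no remainder operation; both arguments occur twice, which doubles leaves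
  and cost.\<close>

definition modE :: "exp \<Rightarrow> exp \<Rightarrow> exp" where
  "modE a m = Sub a (Mul (Div a m) m)"

lemma modE_simps [simp]:
  "val x s (modE a m) = val x s a mod val x s m"
  "leaves (modE a m) = 2 * leaves a + 2 * leaves m"
  "consts_below X (modE a m) \<longleftrightarrow> consts_below X a \<and> consts_below X m"
  "cost (modE a m) = 2 * cost a + 2 * cost m + 3"
  by (auto simp: modE_def minus_div_mult_eq_mod)

text \<open>Lets a loop over the columns maintain the sign by one negation per column of
  \<open>S\<close>, without counting.\<close>

lemma sg_Suc: "finite S \<Longrightarrow> sg S (Suc k) = (if k \<in> S then - sg S k else sg S k)"
proof -
  assume S: "finite S"
  have "{l \<in> S. l < Suc k} = (if k \<in> S then insert k {l \<in> S. l < k} else {l \<in> S. l < k})"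
    by (auto simp: less_Suc_eq)
  then show ?thesis using S by (simp add: sg_def)
qed

lemma sg_0 [simp]: "sg S 0 = 1"
  by (simp add: sg_def)

lemma sum_below_Suc:
  fixes g :: "nat \<Rightarrow> int"
  assumes "finite S"
  shows "(\<Sum>j | j \<in> S \<and> j < Suc k. g j) = (\<Sum>j | j \<in> S \<and> j < k. g j) + (if k \<in> S then g k else 0)"
proof -
  have "{j. j \<in> S \<and> j < Suc k} = (if k \<in> S then insert k {j. j \<in> S \<and> j < k} else {j. j \<in> S \<and> j < k})"
    by (auto simp: less_Suc_eq)
  then show ?thesis using assms by simp
qed

lemma lo_below: "{i. i \<in> lo K idx \<and> i < K} = lo K idx" and hi_below: "{j. j \<in> hi K idx \<and> j < K} = hi K idx"
  by (auto simp: lo_def hi_def)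

lemma mult_mod_residue:
  assumes "int a = A mod int p"
  shows "int (a * y mod p) = A * int y mod int p"
  using assms by (simp add: zmod_int mod_simps)

text \<open>Negation modulo \<open>p\<close> is \<open>p - a\<close>. For \<open>a = 0\<close> this
  is the unreduced value \<open>p\<close>, which the reduction after the next multiplication
  repairs.\<close>

lemma neg_mult_mod_residue:
  assumes "int a = A mod int p" "0 < p"
  shows "int ((p - a) * y mod p) = - A * int y mod int p"
proof -
  have "a < p" using assms by (metis of_nat_less_iff pos_mod_bound of_nat_0_less_iff)
  then have "int ((p - a) * y mod p) = (int p - int a) * int y mod int p"
    by (simp add: zmod_int of_nat_diff)
  also have "(int p - int a) * int y = - int a * int y + int p * int y" by (simp add: algebra_simps)
  also have "\<dots> mod int p = - int a * int y mod int p" by (rule mod_mult_self2)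
  also have "\<dots> = - A * int y mod int p" unfolding assms(1) by (metis mod_minus_eq mod_mult_left_eq)
  finally show ?thesis .
qed

lemma add_mult_mod_residue:
  assumes "int a = A mod int p" "int c = C mod int p" "int m = F mod int p"
  shows "int ((a + c * m) mod p) = (A + C * F) mod int p"
proof -
  have "int ((a + c * m) mod p) = (int a + int c * int m) mod int p" by (simp add: zmod_int)
  also have "\<dots> = (A + C * F) mod int p"
    using assms by (intro mod_add_cong mod_mult_cong) simp_all
  finally show ?thesis .
qed

section \<open>Expansion along one vertex, modulo \<open>p\<close>\<close>

abbreviation "j_tail \<equiv> Seq (Store (Const 27) (modE (Mul (V 27) (V 20)) (V 8))) (Store (Const 26) (Mul (V 26) (Const 2)))"

text \<open>
  Memory cells: 0 answer, 3 \<open>K\<close>, 4 \<open>2\<^sup>K\<close>, 5 \<open>4\<^sup>K\<close>, 6 number of moduli, 7 smallest modulus, 8 modulus,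
  9 pattern, 10 offset of the graph in the input, 11 number of its vertices, 12 position in the
  pattern, 13 its bit, 14 table index, 15 vertex, 16 sum over all vertices, 17 new table entry,
  18 loop over an adjacency list, 19 its length, 20 neighbour, 21 address of the source entry,
  22, 23, 24 first column \<open>i\<close>, \<open>2\<^sup>i\<close> and coefficient, 25, 26, 27 second column \<open>j\<close>, \<open>2\<^sup>K\<^sup>+\<^sup>j\<close> and coefficient,
  28, 29 results for the first graph, 30 offset of the second graph, 31 loop over the moduli,
  32 remaining pattern. The table starts at cell 50.
\<close>

abbreviation "j_add \<equiv> Seq (Store (Const 17) (modE (Add (V 17) (Mul (V 27) (Mem (Sub (Sub (V 21) (V 23)) (V 26))))) (V 8)))
           (Store (Const 27) (Sub (V 8) (V 27)))"

text \<open>The powers of the two deleted columns are subtracted directly from the address of the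
  entry at \<open>idx\<close>. The coefficient is multiplied by the vertex also for columns outside
  the set, since it has to be the right power for the next column.\<close>

definition j_body :: com where
  "j_body = Seq (Cond (modE (Div (V 14) (V 26)) (Const 2))
      j_add Skip)
    j_tail"

definition i_body :: com where
  "i_body = Seq (Cond (modE (Div (V 14) (V 23)) (Const 2))
      (Seq (Store (Const 26) (V 4)) (Seq (Store (Const 27) (V 24))
        (Seq (For 25 (V 3) j_body) (Store (Const 24) (Sub (V 8) (V 24)))))) Skip)
    (Seq (Store (Const 24) (modE (Mul (V 24) (V 20)) (V 8)))
         (Store (Const 23) (Mul (V 23) (Const 2))))"

definition add_contrib :: com where
  "add_contrib = Seq (Store (Const 23) (Const 1)) (Seq (Store (Const 24) (Const 1)) (For 22 (V 3) i_body))"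

context ram
begin

text \<open>\<open>c\<close> is the coefficient of the column fixed by the outer loop. By
  \<open>ge\<close> the source entries lie above the scratch cells, so that every round still finds
  them as they were in \<open>s\<close>.\<close>

lemma wp_j_loop:
  fixes f :: "nat \<Rightarrow> int"
  defines "Mod \<equiv> {17, 25, 26, 27}"
  assumes s: "s 3 = K" "s 8 = p" "s 14 = idx" "s 20 = y" "s 26 = 2 ^ K"
    and c: "int (s 27) = c mod int p" and a: "int (s 17) = a mod int p"
    and f: "\<And>j. j \<in> hi K idx \<Longrightarrow> int (s (s 21 - s 23 - 2 ^ (K + j))) = f j mod int p"
    and ge: "\<And>j. j \<in> hi K idx \<Longrightarrow> 50 \<le> s 21 - s 23 - 2 ^ (K + j)"
    and p: "2 \<le> p" and X: "2 ^ K * 2 ^ K < X"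
  shows "wp (For 25 (V 3) j_body) (\<lambda>s'. same Mod s s' \<and>
      int (s' 17) = (a + (\<Sum>j\<in>hi K idx. c * (sg (hi K idx) j * int y ^ j) * f j)) mod int p)
    ((K + 1) * 150) s"
proof (rule wp_bounded)
  assume bs: "\<And>a. s a < X"
  have pX: "p < X" using bs[of 8] s by simp
  let ?H = "hi K idx"
  let ?g = "\<lambda>j. c * (sg ?H j * int y ^ j) * f j"
  define I where "I k u \<longleftrightarrow> same Mod s u \<and> u 26 = 2 ^ (K + k) \<and>
      int (u 27) = c * (sg ?H k * int y ^ k) mod int p \<and>
      int (u 17) = (a + (\<Sum>j | j \<in> ?H \<and> j < k. ?g j)) mod int p" for k u
  have less: "n < p" if "int n = A mod int p" for n A
    using that p by (metis of_nat_less_iff pos_mod_bound of_nat_0_less_iff less_le_trans zero_less_numeral)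
  show ?thesis
  proof (rule wp_time[OF wp_For[where I = I and N = K and T = 130]])
    show "I 0 (s(25 := 0))"
      using s c a unfolding I_def Mod_def same_def by auto
    show "val x u (V 3) = K" if "I k u" for k u
      using that s unfolding I_def Mod_def same_def by auto
    show "K < X" using bs[of 3] s by simp
    show "same Mod s u \<and> int (u 17) = (a + sum ?g ?H) mod int p" if "I K u" for u
      using that unfolding I_def hi_below by blast
    fix k u assume k: "k < K" and Iu: "I k u" and uk: "u 25 = k" and bu: "\<And>a. u a < X"
    let ?next = "\<lambda>s'. s' 25 = k \<and> I (Suc k) (s'(25 := Suc k))"
    have sm: "same Mod s u" and u26: "u 26 = 2 ^ (K + k)"
      and u27: "int (u 27) = c * (sg ?H k * int y ^ k) mod int p"
      and u17: "int (u 17) = (a + (\<Sum>j | j \<in> ?H \<and> j < k. ?g j)) mod int p"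
      using Iu unfolding I_def by auto
    have u: "u 3 = K" "u 8 = p" "u 14 = idx" "u 20 = y" "u 21 = s 21" "u 23 = s 23"
      using s sameD[OF sm] unfolding Mod_def by auto
    \<comment> \<open>The doubling after the last column stores \<open>2 ^ (2 * K)\<close>, which
      still has to be below \<open>X\<close>.\<close>
    have pw: "2 ^ (K + k) * 2 < X"
    proof -
      have "(2 :: nat) ^ (K + k) * 2 = 2 ^ (K + Suc k)" by simp
      also have "\<dots> \<le> 2 ^ (K + K)" using k by (intro power_increasing) auto
      also have "\<dots> = 2 ^ K * 2 ^ K" by (rule power_add)
      also note X
      finally show ?thesis .
    qed
    have bit: "idx div 2 ^ (K + k) mod 2 \<noteq> 0 \<longleftrightarrow> k \<in> ?H"
      unfolding even_iff_mod_2_eq_zero[symmetric] using k by (simp add: hi_def bit_iff_odd)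
    have modlt: "n mod p < X" for n using pX p by (meson less_trans mod_less_divisor less_le_trans zero_less_numeral)
    \<comment> \<open>Both branches end in the same tail. Demanding only that
      \<open>v 27 * y mod p\<close> be right covers the unchanged and the negated
      coefficient.\<close>
    have rest: "wp j_tail ?next 40 v"
      if v: "same {17, 27} u v" "int (v 27 * y mod p) = c * (sg ?H (Suc k) * int y ^ Suc k) mod int p"
        "int (v 17) = (a + (\<Sum>j | j \<in> ?H \<and> j < Suc k. ?g j)) mod int p" for v
    proof -
      have v': "v 3 = K" "v 8 = p" "v 20 = y" "v 25 = k" "v 26 = 2 ^ (K + k)"
        using u uk u26 sameD[OF v(1)] by auto
      have sv: "same Mod s v" using same_trans[OF sm v(1), of Mod] unfolding Mod_def by simp
      show ?thesis
        by (rule wp_time, (rule wp_Seq wp_Store)+)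
          (use v' v(2,3) pw modlt sv in \<open>auto simp: ok_def I_def Mod_def same_def\<close>)
    qed
    have "wp (Cond (modE (Div (V 14) (V 26)) (Const 2))
      j_add Skip)
      (\<lambda>v. wp j_tail ?next 40 v) 90 u"
    proof (rule wp_time[OF wp_Cond[where T = 70]])
      assume "val x u (modE (Div (V 14) (V 26)) (Const 2)) = 0"
      then have k': "k \<notin> ?H" using bit u u26 by simp
      then show "wp Skip (\<lambda>v. wp j_tail ?next 40 v) 70 u"
        using mult_mod_residue[OF u27, of y] u17
        by (intro wp_time[OF wp_Skip] rest) (simp_all add: sum_below_Suc sg_Suc mult_ac)
    next
      assume "val x u (modE (Div (V 14) (V 26)) (Const 2)) \<noteq> 0"
      then have k': "k \<in> ?H" using bit u u26 by simp
      let ?m = "u (s 21 - s 23 - 2 ^ (K + k))"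
      have "?m = s (s 21 - s 23 - 2 ^ (K + k))"
        using ge[OF k'] by (intro sameD[OF sm]) (auto simp: Mod_def)
      then have m: "int ?m = f k mod int p" using f[OF k'] by simp
      let ?a = "(u 17 + u 27 * ?m) mod p"
      have a': "int ?a = (a + (\<Sum>j | j \<in> ?H \<and> j < Suc k. ?g j)) mod int p"
        using add_mult_mod_residue[OF u17 u27 m] k' by (simp add: sum_below_Suc add.assoc)
      have c': "int ((p - u 27) * y mod p) = c * (sg ?H (Suc k) * int y ^ Suc k) mod int p"
        using neg_mult_mod_residue[OF u27, of y] p k' by (simp add: sg_Suc mult_ac)
      have r: "wp j_tail ?next 40 (u(17 := ?a, 27 := p - u 27))"
        using a' c' by (intro rest) (auto simp: same_def)
      show "wp j_add (\<lambda>v. wp j_tail ?next 40 v) 70 u"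
        by (rule wp_time, (rule wp_Seq)+, (rule wp_Store)+)
          (use r u u26 modlt pX in \<open>simp_all add: ok_def\<close>)
    qed (simp_all add: ok_def)
    then show "wp j_body ?next 130 u"
      unfolding j_body_def by (rule wp_time[OF wp_Seq]) simp
  qed (simp_all)
qed

lemma wp_add_contrib:
  fixes f :: "nat \<Rightarrow> int"
  defines "Mod \<equiv> {17, 22, 23, 24, 25, 26, 27}"
  assumes s: "s 3 = K" "s 4 = 2 ^ K" "s 8 = p" "s 14 = idx" "s 20 = y" "s 21 = b + idx"
    and a: "int (s 17) = a mod int p"
    and f: "\<And>l. l \<le> idx \<Longrightarrow> int (s (b + l)) = f l mod int p"
    and ge: "50 \<le> b" and p: "2 \<le> p" and X: "2 ^ K * 2 ^ K < X"
  shows "wp add_contrib (\<lambda>s'. same Mod s s' \<and> int (s' 17) = (a + contrib K y f idx) mod int p)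
    (300 * ((K + 1) * (K + 1))) s"
proof (rule wp_bounded)
  assume bs: "\<And>a. s a < X"
  have pX: "p < X" using bs[of 8] s by simp
  let ?L = "lo K idx" and ?H = "hi K idx"
  let ?c = "\<lambda>i. sg ?L i * int y ^ i"
  let ?g = "\<lambda>i. \<Sum>j\<in>?H. ?c i * (sg ?H j * int y ^ j) * f (idx - 2 ^ i - 2 ^ (K + j))"
  define I where "I k u \<longleftrightarrow> same Mod s u \<and> u 23 = 2 ^ k \<and> int (u 24) = ?c k mod int p \<and>
      int (u 17) = (a + (\<Sum>i | i \<in> ?L \<and> i < k. ?g i)) mod int p" for k u
  let ?s = "s(23 := 1, 24 := 1)"
  let ?rest = "Seq (Store (Const 24) (modE (Mul (V 24) (V 20)) (V 8))) (Store (Const 23) (Mul (V 23) (Const 2)))"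
  have modlt: "n mod p < X" for n using pX p by (meson less_trans mod_less_divisor less_le_trans zero_less_numeral)
  have loop: "wp (For 22 (V 3) i_body) (\<lambda>s'. same Mod s s' \<and> int (s' 17) = (a + contrib K y f idx) mod int p)
    ((K + 1) * ((K + 1) * 150 + 120 + 2 + 13)) ?s"
  proof (rule wp_time[OF wp_For[where I = I and N = K and T = "(K + 1) * 150 + 120"]])
    show "I 0 (?s(22 := 0))"
      using a p unfolding I_def Mod_def same_def by auto
    show "val x u (V 3) = K" if "I k u" for k u
      using that s unfolding I_def Mod_def same_def by auto
    show "K < X" using bs[of 3] s by simp
    show "same Mod s u \<and> int (u 17) = (a + contrib K y f idx) mod int p" if "I K u" for u
      using that unfolding I_def lo_below contrib_def by blast
    fix k u assume k: "k < K" and Iu: "I k u" and uk: "u 22 = k" and bu: "\<And>a. u a < X"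
    let ?next = "\<lambda>s'. s' 22 = k \<and> I (Suc k) (s'(22 := Suc k))"
    have sm: "same Mod s u" and u23: "u 23 = 2 ^ k" and u24: "int (u 24) = ?c k mod int p"
      and u17: "int (u 17) = (a + (\<Sum>i | i \<in> ?L \<and> i < k. ?g i)) mod int p"
      using Iu unfolding I_def by auto
    have u: "u 3 = K" "u 4 = 2 ^ K" "u 8 = p" "u 14 = idx" "u 20 = y" "u 21 = b + idx"
      using s sameD[OF sm] unfolding Mod_def by auto
    have pw: "2 ^ k * 2 < X" "2 ^ K < X"
    proof -
      have "(2 :: nat) ^ k * 2 = 2 ^ Suc k" by simp
      also have "\<dots> \<le> 2 ^ K" using k by (intro power_increasing) auto
      finally have "(2 :: nat) ^ k * 2 \<le> 2 ^ K" .
      moreover have "(2 :: nat) ^ K \<le> 2 ^ K * 2 ^ K" by simp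
      ultimately show "2 ^ k * 2 < X" "2 ^ K < X" using X by linarith+
    qed
    have bit: "idx div 2 ^ k mod 2 \<noteq> 0 \<longleftrightarrow> k \<in> ?L"
      unfolding even_iff_mod_2_eq_zero[symmetric] using k by (simp add: lo_def bit_iff_odd)
    have rest: "wp ?rest ?next 40 v"
      if v: "same {17, 24, 25, 26, 27} u v" "int (v 24 * y mod p) = ?c (Suc k) mod int p"
        "int (v 17) = (a + (\<Sum>i | i \<in> ?L \<and> i < Suc k. ?g i)) mod int p" for v
    proof -
      have v': "v 8 = p" "v 20 = y" "v 22 = k" "v 23 = 2 ^ k"
        using u uk u23 sameD[OF v(1)] by auto
      have sv: "same Mod s v" using same_trans[OF sm v(1), of Mod] unfolding Mod_def by simp
      show ?thesis
        by (rule wp_time, (rule wp_Seq wp_Store)+)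
          (use v' v(2,3) pw modlt sv in \<open>auto simp: ok_def I_def Mod_def same_def\<close>)
    qed
    let ?then = "Seq (Store (Const 26) (V 4)) (Seq (Store (Const 27) (V 24))
        (Seq (For 25 (V 3) j_body) (Store (Const 24) (Sub (V 8) (V 24)))))"
    have "wp (Cond (modE (Div (V 14) (V 23)) (Const 2)) ?then Skip)
      (wp ?rest ?next 40) ((K + 1) * 150 + 60) u"
    proof (rule wp_time[OF wp_Cond[where T = "(K + 1) * 150 + 40"]])
      assume "val x u (modE (Div (V 14) (V 23)) (Const 2)) = 0"
      then have k': "k \<notin> ?L" using bit u u23 by simp
      then show "wp Skip (wp ?rest ?next 40) ((K + 1) * 150 + 40) u"
        using mult_mod_residue[OF u24, of y] u17
        by (intro wp_time[OF wp_Skip] rest) (simp_all add: sum_below_Suc sg_Suc mult_ac)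
    next
      assume "val x u (modE (Div (V 14) (V 23)) (Const 2)) \<noteq> 0"
      then have k': "k \<in> ?L" using bit u u23 by simp
      let ?u = "u(26 := 2 ^ K, 27 := u 24)"
      \<comment> \<open>Both columns are present in \<open>idx\<close>, so the truncated
        subtractions take effect within \<open>idx\<close> and never reach into the base address
        \<open>b\<close>.\<close>
      have addr: "b + idx - 2 ^ k - 2 ^ (K + j) = b + (idx - 2 ^ k - 2 ^ (K + j))" if "j \<in> ?H" for j
      proof -
        have "2 ^ k + 2 ^ (K + j) \<le> idx"
          using that k' by (intro lo_hi_diff(3)[of k K j]) (auto simp: lo_def hi_def)
        then show ?thesis by (simp only: diff_diff_left diff_add_assoc)
      qed
      have eq: "?u 21 - ?u 23 - 2 ^ (K + j) = b + (idx - 2 ^ k - 2 ^ (K + j))" if "j \<in> ?H" for j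
        using u(6) u23 addr[OF that] by simp
      have mem: "int (?u (?u 21 - ?u 23 - 2 ^ (K + j))) = f (idx - 2 ^ k - 2 ^ (K + j)) mod int p" if "j \<in> ?H" for j
      proof -
        let ?a = "b + (idx - 2 ^ k - 2 ^ (K + j))"
        have "?u ?a = u ?a" using ge by simp
        also have "\<dots> = s ?a" using ge by (intro sameD[OF sm]) (auto simp: Mod_def)
        finally have e: "?u ?a = s ?a" .
        show ?thesis unfolding eq[OF that] e by (rule f) simp
      qed
      have ge': "50 \<le> ?u 21 - ?u 23 - 2 ^ (K + j)" if "j \<in> ?H" for j
        unfolding eq[OF that] using ge by (rule trans_le_add1)
      have "wp (For 25 (V 3) j_body) (\<lambda>s'. same {17, 25, 26, 27} ?u s' \<and>
          int (s' 17) = ((a + (\<Sum>i | i \<in> ?L \<and> i < k. ?g i)) + ?g k) mod int p) ((K + 1) * 150) ?u"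
        by (rule wp_j_loop[OF _ _ _ _ _ _ _ mem ge' p X]) (use u u24 u17 in simp_all)
      then have inner: "wp (For 25 (V 3) j_body)
          (\<lambda>v. wp (Store (Const 24) (Sub (V 8) (V 24))) (wp ?rest ?next 40) 10 v)
          ((K + 1) * 150) ?u"
      proof (rule wp_mono)
        fix v assume bv: "\<And>a. v a < X" and v: "same {17, 25, 26, 27} ?u v \<and>
          int (v 17) = ((a + (\<Sum>i | i \<in> ?L \<and> i < k. ?g i)) + ?g k) mod int p"
        have v': "v 8 = p" "v 24 = u 24" using v u sameD[of "{17, 25, 26, 27}" ?u v] by auto
        have sv: "same {17, 24, 25, 26, 27} u (v(24 := p - u 24))"
          using v unfolding same_def by auto
        have "int ((p - u 24) * y mod p) = ?c (Suc k) mod int p"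
          using neg_mult_mod_residue[OF u24, of y] p k' by (simp add: sg_Suc mult_ac)
        moreover have "int (v 17) = (a + (\<Sum>i | i \<in> ?L \<and> i < Suc k. ?g i)) mod int p"
          using v k' by (simp add: sum_below_Suc add.assoc)
        ultimately have r: "wp ?rest ?next 40 (v(24 := p - u 24))"
          by (intro rest[OF sv]) simp_all
        show "wp (Store (Const 24) (Sub (V 8) (V 24))) (wp ?rest ?next 40) 10 v"
          by (rule wp_time, rule wp_Store) (use r v' pX in \<open>simp_all add: ok_def\<close>)
      qed simp
      have "wp ?then (wp ?rest ?next 40)
        (cost (Const 26) + cost (V 4) + 1 + (cost (Const 27) + cost (V 24) + 1 + ((K + 1) * 150 + 10))) u"
        by (rule wp_Seq, rule wp_Store, rule wp_Seq, rule wp_Store, rule wp_Seq)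
          (use inner u(2) bu pw(2) in \<open>simp_all add: ok_def\<close>)
      then show "wp ?then (wp ?rest ?next 40) ((K + 1) * 150 + 40) u"
        by (rule wp_time) simp
    qed (simp_all add: ok_def)
    then show "wp i_body ?next ((K + 1) * 150 + 120) u"
      unfolding i_body_def by (rule wp_time[OF wp_Seq]) simp
  qed simp_all
  have "wp add_contrib (\<lambda>s'. same Mod s s' \<and> int (s' 17) = (a + contrib K y f idx) mod int p)
    (3 + (3 + (K + 1) * ((K + 1) * 150 + 120 + 2 + 13))) s"
    unfolding add_contrib_def
    by (rule wp_time, rule wp_Seq, rule wp_Store, rule wp_Seq, rule wp_Store) (use loop X_ge in \<open>auto simp: ok_def\<close>)
  then show ?thesis by (rule wp_time) (simp add: algebra_simps)
qed

end

text \<open>The row is the outermost coordinate: addresses do not depend on the number of vertices,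
  and both graphs can share the initial layer.\<close>

definition cell :: "nat \<Rightarrow> nat \<Rightarrow> nat \<Rightarrow> nat \<Rightarrow> nat" where
  "cell K row t idx = 50 + ((row * (K + 1) + t) * (2 ^ K * 2 ^ K) + idx)"

lemma cell_ge: "50 \<le> cell K row t idx"
  by (simp add: cell_def)

lemma cell_add: "cell K row t 0 + l = cell K row t l"
  by (simp add: cell_def)

lemma cell_inj:
  assumes "cell K row t idx = cell K row' t' idx'" "t \<le> K" "t' \<le> K" "idx < 2 ^ K * 2 ^ K" "idx' < 2 ^ K * 2 ^ K"
  shows "row = row' \<and> t = t' \<and> idx = idx'"
proof -
  define Q :: nat where "Q = 2 ^ K * 2 ^ K"
  have e: "(row * (K + 1) + t) * Q + idx = (row' * (K + 1) + t') * Q + idx'"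
    using assms(1) unfolding cell_def Q_def[symmetric] by (metis add_left_cancel)
  have lt: "idx < Q" "idx' < Q" using assms unfolding Q_def by auto
  have "((row * (K + 1) + t) * Q + idx) div Q = row * (K + 1) + t" "((row' * (K + 1) + t') * Q + idx') div Q = row' * (K + 1) + t'"
    using lt by (simp_all add: div_add1_eq)
  then have e2: "row * (K + 1) + t = row' * (K + 1) + t'" using e by metis
  then have "idx = idx'" using e by simp
  have "(row * (K + 1) + t) div (K + 1) = row" "(row' * (K + 1) + t') div (K + 1) = row'"
    using assms(2,3) by (simp_all only: div_mult_self3 div_less less_Suc_eq_le Suc_eq_plus1[symmetric] add_0_right nat.simps not_False_eq_True)
  then have "row = row'" using e2 by metis
  then show ?thesis using e2 \<open>idx = idx'\<close> by simp
qed

abbreviation cube :: "nat \<Rightarrow> nat" where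
  "cube k \<equiv> k * k * k"

definition inp :: "nat list \<Rightarrow> nat \<Rightarrow> nat" where
  "inp x i = (if i < length x then x ! i else 0)"

text \<open>The case \<open>v = length L\<close>, the end of the last list, is included so that
  every degree is a difference of consecutive offsets.\<close>

definition graph_at :: "nat list \<Rightarrow> nat \<Rightarrow> nat list list \<Rightarrow> bool" where
  "graph_at x g L \<longleftrightarrow> inp x g = length L \<and>
     (\<forall>v \<le> length L. inp x (g + 1 + v) = length (concat (take v L))) \<and>
     (\<forall>v < length L. \<forall>l < length (L ! v).
        inp x (g + length L + 2 + length (concat (take v L)) + l) = L ! v ! l)"

lemma nth_concat:
  "v < length L \<Longrightarrow> l < length (L ! v) \<Longrightarrow>
    length (concat (take v L)) + l < length (concat L) \<and> concat L ! (length (concat (take v L)) + l) = L ! v ! l"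
proof (induction L arbitrary: v)
  case (Cons a L)
  then show ?case by (cases v) (auto simp: nth_append)
qed simp

lemma length_graph_words: "length (graph_words L) = length L + 2 + length (concat L)"
  by (simp add: graph_words_def)

lemma graph_at_graph_words: "graph_at (pre @ graph_words L @ post) (length pre) L"
proof -
  let ?x = "pre @ graph_words L @ post"
  have inp: "inp ?x (length pre + i) = graph_words L ! i" if "i < length (graph_words L)" for i
    using that by (simp add: inp_def nth_append)
  have "inp ?x (length pre) = length L"
    using inp[of 0] by (simp add: length_graph_words) (simp add: graph_words_def)
  moreover have "inp ?x (length pre + 1 + v) = length (concat (take v L))" if "v \<le> length L" for v
  proof -
    have "graph_words L ! Suc v = length (concat (take v L))"
      using that by (simp add: graph_words_def nth_append del: upt_Suc)
    then show ?thesis using inp[of "Suc v"] that by (simp add: length_graph_words)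
  qed
  moreover have "inp ?x (length pre + length L + 2 + length (concat (take v L)) + l) = L ! v ! l"
    if "v < length L" "l < length (L ! v)" for v l
  proof -
    note c = nth_concat[OF that]
    have "graph_words L ! (length L + 2 + (length (concat (take v L)) + l)) = concat L ! (length (concat (take v L)) + l)"
      by (simp add: graph_words_def nth_append del: upt_Suc length_concat)
    then show ?thesis
      using inp[of "length L + 2 + (length (concat (take v L)) + l)"] c
      by (simp add: length_graph_words add.assoc del: length_concat)
  qed
  ultimately show ?thesis unfolding graph_at_def by blast
qed

lemma val_Inp: "val x s (Inp e) = inp x (val x s e)"
  by (simp add: inp_def)

definition cellE :: "exp \<Rightarrow> exp \<Rightarrow> exp" where
  "cellE r t = Add (Const 50) (Add (Mul (Add (Mul r (Add (V 3) (Const 1))) t) (V 5)) (V 14))"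

lemma cellE_simps [simp]:
  "s 3 = K \<Longrightarrow> s 5 = 2 ^ K * 2 ^ K \<Longrightarrow> val x s (cellE r t) = cell K (val x s r) (val x s t) (s 14)"
  "leaves (cellE r t) = leaves r + leaves t + 5"
  "consts_below 100 (cellE r t) \<longleftrightarrow> consts_below 100 r \<and> consts_below 100 t"
  "cost (cellE r t) = cost r + cost t + 14"
  by (auto simp: cellE_def cell_def)

abbreviation "entryE \<equiv> Inp (Add (Add (Add (Add (V 10) (V 11)) (Const 2)) (Inp (Add (Add (V 10) (Const 1)) (V 15)))) (V 18))"

abbreviation "degreeE \<equiv> Sub (Inp (Add (Add (V 10) (Const 1)) (Add (V 15) (Const 1)))) (Inp (Add (Add (V 10) (Const 1)) (V 15)))"

abbreviation "vertex_cellE \<equiv> cellE (Add (V 15) (Const 1)) (V 12)"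

abbreviation "new_cellE \<equiv> cellE (Add (V 15) (Const 1)) (Add (V 12) (Const 1))"

section \<open>Filling the table for one graph, one pattern and one modulus\<close>

definition list_body :: com where
  "list_body = Seq
     (Cond (V 13) (Store (Const 20) entryE)
       (Store (Const 20) (V 15)))
     add_contrib"

text \<open>A centre is treated as a leaf position with a list of length 1 that consists of the
  vertex itself, taken from row 0. Multiplication by the bit in cell 13 makes the row contribute to
  row 0 only at leaf positions.\<close>

definition vertex_body :: com where
  "vertex_body = Seq (Store (Const 17) (Const 0)) (Seq
     (Cond (V 13)
       (Seq (Store (Const 19) degreeE)
         (Seq (Cond (Sub (V 19) (V 3)) (Store (Const 19) (V 3)) Skip)
           (Store (Const 21) vertex_cellE)))
       (Seq (Store (Const 19) (Const 1)) (Store (Const 21) (cellE (Const 0) (V 12)))))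
     (Seq (For 18 (V 19) list_body)
       (Seq (Store new_cellE (V 17))
         (Store (Const 16) (modE (Add (V 16) (Mul (V 13) (V 17))) (V 8))))))"

definition index_body :: com where
  "index_body = Seq (Store (Const 16) (Const 0)) (Seq (For 15 (V 11) vertex_body)
     (Store (cellE (Const 0) (Add (V 12) (Const 1))) (V 16)))"

definition layer_body :: com where
  "layer_body = Seq (Store (Const 13) (modE (V 32) (Const 2))) (Seq (For 14 (V 5) index_body)
     (Store (Const 32) (Div (V 32) (Const 2))))"

definition fill_table :: com where
  "fill_table = Seq (Store (Const 11) (Inp (V 10))) (Seq (Store (Const 32) (V 9)) (For 12 (V 3) layer_body))"

abbreviation scratch :: "nat set" where
  "scratch \<equiv> {16, 17, 18, 19, 20, 21, 22, 23, 24, 25, 26, 27}"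

locale table_run = ram +
  fixes K p g r :: nat and L :: "nat list list"
  assumes K: "1 \<le> K" "2 ^ K * 2 ^ K < X"
    and p: "2 \<le> p"
    and graph: "graph_at x g L"
    and nbs: "\<And>v y. v < length L \<Longrightarrow> y \<in> set (L ! v) \<Longrightarrow> y < length L"
    and cells: "\<And>row t idx. row \<le> length L \<Longrightarrow> t \<le> K \<Longrightarrow> idx < 2 ^ K * 2 ^ K \<Longrightarrow> cell K row t idx < X"
begin

abbreviation "n \<equiv> length L"
abbreviation "Q \<equiv> 2 ^ K * 2 ^ K"
abbreviation "tab \<equiv> table (bit r) (\<lambda>v. take K (L ! v)) (length L) K"

definition env :: "mem \<Rightarrow> bool" where
  "env s \<longleftrightarrow> s 3 = K \<and> s 4 = 2 ^ K \<and> s 5 = Q \<and> s 8 = p \<and> s 10 = g \<and> s 11 = n"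

definition correct :: "mem \<Rightarrow> nat \<Rightarrow> nat \<Rightarrow> nat \<Rightarrow> bool" where
  "correct s row t idx \<longleftrightarrow> int (s (cell K row t idx)) = tab t row idx mod int p"

lemma correct_same: "correct s row t idx \<Longrightarrow> same A s s' \<Longrightarrow> cell K row t idx \<notin> A \<Longrightarrow> correct s' row t idx"
  unfolding correct_def same_def by auto

lemma cell_scalar: "a < 50 \<Longrightarrow> cell K row t idx \<noteq> a"
  using cell_ge[of K row t idx] by linarith

text \<open>The bit of the pattern determines the one row that is read, and expansion only removes
  columns, so indices up to \<open>idx\<close> suffice in \<open>src\<close>.\<close>

lemma wp_vertex_body:
  defines "Mod \<equiv> scratch"
  assumes env: "env s" and s: "s 12 = t" "s 14 = idx" "s 15 = v" "s 13 = of_bool (bit r t)"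
    and S: "int (s 16) = S mod int p"
    and lt: "t < K" "idx < Q" "v < n"
    and src: "\<And>l. l \<le> idx \<Longrightarrow> correct s (if bit r t then Suc v else 0) t l"
  shows "wp vertex_body (\<lambda>s'. same (insert (cell K (Suc v) (Suc t) idx) Mod) s s' \<and>
      correct s' (Suc v) (Suc t) idx \<and>
      int (s' 16) = (S + of_bool (bit r t) * tab (Suc t) (Suc v) idx) mod int p)
    (800 * cube (K + 1)) s"
proof (rule wp_bounded)
  assume bs: "\<And>a. s a < X"
  have e: "s 3 = K" "s 4 = 2 ^ K" "s 5 = Q" "s 8 = p" "s 10 = g" "s 11 = n" using env unfolding env_def by auto
  have pX: "p < X" using bs[of 8] e by simp
  have modlt: "m mod p < X" for m using pX p by (meson less_trans mod_less_divisor less_le_trans zero_less_numeral)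
  let ?b = "bit r t"
  let ?src = "if ?b then Suc v else 0"
  let ?ys = "if ?b then take K (L ! v) else [v]"
  let ?f = "tab t ?src"
  let ?C = "\<lambda>k. \<Sum>l<k. contrib K (?ys ! l) ?f idx"
  define out where "out = cell K (Suc v) (Suc t) idx"
  define Post where "Post s' \<longleftrightarrow> same (insert out Mod) s s' \<and> correct s' (Suc v) (Suc t) idx \<and>
      int (s' 16) = (S + of_bool ?b * tab (Suc t) (Suc v) idx) mod int p" for s'
  have new: "tab (Suc t) (Suc v) idx = ?C (length ?ys)"
    unfolding table_Suc_Suc by (simp only: sum_list_sum_nth length_map atLeast0LessThan) (intro sum.cong, auto)
  let ?M = "{17, 18, 20, 22, 23, 24, 25, 26, 27}"
  let ?fin = "Seq (Store new_cellE (V 17))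
         (Store (Const 16) (modE (Add (V 16) (Mul (V 13) (V 17))) (V 8)))"
  have loop: "wp (For 18 (V 19) list_body) (wp ?fin Post 70) ((K + 1) * (300 * ((K + 1) * (K + 1)) + 60)) u"
    if su: "same {17, 19, 21} s u" and u19: "u 19 = length ?ys" and u21: "u 21 = cell K ?src t idx" and u17: "u 17 = 0" for u
  proof -
    define I where "I k u' \<longleftrightarrow> same ?M u u' \<and> int (u' 17) = ?C k mod int p" for k u'
    have len: "length ?ys \<le> K" using K(1) by auto
    have "wp (For 18 (V 19) list_body) (wp ?fin Post 70) ((length ?ys + 1) * ((300 * ((K + 1) * (K + 1)) + 40) + cost (V 19) + 13)) u"
    proof (rule wp_For[where I = I])
      show "I 0 (u(18 := 0))" using u17 unfolding I_def same_def by auto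
      show "val x u' (V 19) = length ?ys" if "I k u'" for k u'
        using that u19 unfolding I_def same_def by auto
      show "length ?ys < X" using len bs[of 3] e by simp
      show "wp ?fin Post 70 u'" if "I (length ?ys) u'" and bu: "\<And>a. u' a < X" for u'
      proof -
        have suu: "same ?M u u'" and u17': "int (u' 17) = tab (Suc t) (Suc v) idx mod int p"
          using that unfolding I_def new by auto
        have s1: "same Mod s u'" using same_trans[OF su suu, of Mod] unfolding Mod_def by simp
        have s2: "same (insert 17 (insert 18 (insert 19 (insert 20 {21, 22, 23, 24, 25, 26, 27})))) s u'"
          using same_trans[OF su suu] by simp
        have u': "u' 3 = K" "u' 5 = Q" "u' 8 = p" "u' 12 = t" "u' 13 = of_bool ?b" "u' 14 = idx" "u' 15 = v" "u' 16 = s 16"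
          using e s sameD[OF s2] by auto
        have outX: "out < X" unfolding out_def using lt by (intro cells) auto
        have out_ne: "out \<noteq> a" if "a < 50" for a using cell_scalar that unfolding out_def by blast
        let ?u = "u'(out := u' 17)"
        have "int ((s 16 + of_bool ?b * u' 17) mod p) = (S + of_bool ?b * tab (Suc t) (Suc v) idx) mod int p"
          by (rule add_mult_mod_residue[OF S _ u17']) (use p in auto)
        moreover have "same (insert out Mod) s (?u(16 := m))" for m
          using s1 unfolding same_def Mod_def by auto
        ultimately have post: "Post (?u(16 := (s 16 + of_bool ?b * u' 17) mod p))"
          unfolding Post_def correct_def out_def[symmetric] using u17' out_ne[of 16] by simp
        have v1: "val x u' new_cellE = out"
          using u' by (simp add: out_def)
        have v2: "val x ?u (modE (Add (V 16) (Mul (V 13) (V 17))) (V 8)) = (s 16 + of_bool ?b * u' 17) mod p"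
          using u' out_ne[of 16] out_ne[of 13] out_ne[of 17] out_ne[of 8] by simp
        have "wp (Store (Const 16) (modE (Add (V 16) (Mul (V 13) (V 17))) (V 8))) Post
            (cost (Const 16) + cost (modE (Add (V 16) (Mul (V 13) (V 17))) (V 8)) + 1) ?u"
          by (rule wp_Store) (use post v2 modlt in \<open>simp_all add: ok_def del: modE_simps(1)\<close>)
        then show ?thesis
          by (intro wp_time[OF wp_Seq[OF wp_Store]]) (use v1 bu in \<open>auto simp: ok_def simp del: cellE_simps(1)\<close>)
      qed
      fix k u' assume k: "k < length ?ys" and Iu: "I k u'" and uk: "u' 18 = k" and bu: "\<And>a. u' a < X"
      let ?next = "\<lambda>s'. s' 18 = k \<and> I (Suc k) (s'(18 := Suc k))"
      have suu: "same ?M u u'" and u17': "int (u' 17) = ?C k mod int p" using Iu unfolding I_def by auto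
      have s2: "same {17, 18, 19, 20, 21, 22, 23, 24, 25, 26, 27} s u'"
        using same_trans[OF su suu] by simp
      have u': "u' 3 = K" "u' 4 = 2 ^ K" "u' 8 = p" "u' 10 = g" "u' 11 = n" "u' 13 = of_bool ?b" "u' 14 = idx" "u' 15 = v"
        using e s sameD[OF s2] by auto
      have u21': "u' 21 = cell K ?src t 0 + idx" using sameD[OF suu, of 21] u21 by (simp add: cell_add)
      let ?u = "u'(20 := ?ys ! k)"
      have mem: "int (?u (cell K ?src t 0 + l)) = ?f l mod int p" if "l \<le> idx" for l
      proof -
        have "?u (cell K ?src t l) = u' (cell K ?src t l)" using cell_scalar[of 20] by (intro fun_upd_other) auto
        also have "\<dots> = s (cell K ?src t l)"
          using cell_ge[of K ?src t l] by (intro sameD[OF s2]) auto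
        finally show ?thesis using src[OF that] unfolding correct_def cell_add by (simp only:)
      qed
      have "wp add_contrib (\<lambda>s'. same {17, 22, 23, 24, 25, 26, 27} ?u s' \<and>
          int (s' 17) = (?C k + contrib K (?ys ! k) ?f idx) mod int p) (300 * ((K + 1) * (K + 1))) ?u"
      proof (rule wp_add_contrib[where f = ?f and b = "cell K ?src t 0"])
        show "int (?u (cell K ?src t 0 + l)) = ?f l mod int p" if "l \<le> idx" for l
          using that by (rule mem)
        show "50 \<le> cell K ?src t 0" by (rule cell_ge)
      qed (use u' u21' u17' p K(2) in simp_all)
      then have ac: "wp add_contrib ?next (300 * ((K + 1) * (K + 1))) ?u"
      proof (rule wp_mono)
        fix s' assume s': "same {17, 22, 23, 24, 25, 26, 27} ?u s' \<and>
          int (s' 17) = (?C k + contrib K (?ys ! k) ?f idx) mod int p"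
        have "s' 18 = k" using sameD[of "{17, 22, 23, 24, 25, 26, 27}" ?u s' 18] s' uk by simp
        moreover have "same ?M u (s'(18 := Suc k))" using suu s' unfolding same_def by auto
        moreover have "int ((s'(18 := Suc k)) 17) = ?C (Suc k) mod int p"
        proof -
          have e: "(s'(18 := Suc k)) 17 = s' 17" by simp
          show ?thesis unfolding e sum.lessThan_Suc using s' by (rule conjunct2)
        qed
        ultimately show "s' 18 = k \<and> I (Suc k) (s'(18 := Suc k))" unfolding I_def by (intro conjI)
      qed simp
      have yX: "?ys ! k < X"
      proof (cases ?b)
        case True
        then have "?ys ! k \<in> set (L ! v)" using k by (simp add: nth_mem)
        then have "?ys ! k < n" by (rule nbs[OF lt(3)])
        then show ?thesis using bs[of 11] e by simp
      next
        case False
        then show ?thesis using k bs[of 15] s by simp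
      qed
      have "wp (Cond (V 13) (Store (Const 20) entryE)
         (Store (Const 20) (V 15))) (\<lambda>u. wp add_contrib ?next (300 * ((K + 1) * (K + 1))) u) 40 u'"
      proof (rule wp_time[OF wp_Cond[where T = 30]])
        assume "val x u' (V 13) \<noteq> 0"
        then have b: ?b using u' by simp
        have k': "k < length (L ! v)" using k b by simp
        have "inp x (g + n + 2 + inp x (g + 1 + v) + k) = L ! v ! k"
          using graph lt(3) k' unfolding graph_at_def by simp
        moreover have "L ! v ! k = ?ys ! k" using b k by simp
        ultimately have val: "val x u' entryE = ?ys ! k"
          using u' uk by (simp add: val_Inp del: val.simps(3))
        show "wp (Store (Const 20) entryE)
          (\<lambda>u. wp add_contrib ?next (300 * ((K + 1) * (K + 1))) u) 30 u'"
          by (rule wp_time, rule wp_Store, unfold val) (use ac yX in \<open>simp_all add: ok_def\<close>)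
      next
        assume "val x u' (V 13) = 0"
        then have b: "\<not> ?b" using u' by simp
        then have val: "val x u' (V 15) = ?ys ! k" using u' k by simp
        show "wp (Store (Const 20) (V 15))
          (\<lambda>u. wp add_contrib ?next (300 * ((K + 1) * (K + 1))) u) 30 u'"
          by (rule wp_time, rule wp_Store, unfold val) (use ac yX in \<open>simp_all add: ok_def\<close>)
      qed (simp_all add: ok_def)
      then show "wp list_body ?next (300 * ((K + 1) * (K + 1)) + 40) u'"
        unfolding list_body_def by (rule wp_time[OF wp_Seq]) simp
    qed simp_all
    then show ?thesis
    proof (rule wp_time)
      have "(length ?ys + 1) * ((300 * ((K + 1) * (K + 1)) + 40) + cost (V 19) + 13) \<le> (K + 1) * ((300 * ((K + 1) * (K + 1)) + 40) + cost (V 19) + 13)"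
        using len by (intro mult_right_mono) auto
      also have "\<dots> \<le> (K + 1) * (300 * ((K + 1) * (K + 1)) + 60)" by (intro mult_left_mono) auto
      finally show "(length ?ys + 1) * ((300 * ((K + 1) * (K + 1)) + 40) + cost (V 19) + 13) \<le> (K + 1) * (300 * ((K + 1) * (K + 1)) + 60)" .
    qed
  qed
  let ?T = "(K + 1) * (300 * ((K + 1) * (K + 1)) + 60) + 70"
  let ?rest = "Seq (For 18 (V 19) list_body) ?fin"
  define R where "R = wp ?rest Post ?T"
  have rest: "R u"
    if "same {17, 19, 21} s u" "u 19 = length ?ys" "u 21 = cell K ?src t idx" "u 17 = 0" for u
    unfolding R_def using loop[OF that] by (rule wp_Seq)
  have srcX: "cell K ?src t idx < X" using lt by (intro cells) auto
  let ?s = "s(17 := 0)"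
  have "wp (Cond (V 13)
       (Seq (Store (Const 19) degreeE)
         (Seq (Cond (Sub (V 19) (V 3)) (Store (Const 19) (V 3)) Skip)
           (Store (Const 21) vertex_cellE)))
       (Seq (Store (Const 19) (Const 1)) (Store (Const 21) (cellE (Const 0) (V 12)))))
     R 110 ?s"
  proof (rule wp_time[OF wp_Cond[where T = 100]])
    assume "val x ?s (V 13) \<noteq> 0"
    then have b: ?b using s by simp
    let ?d = "length (L ! v)"
    have off: "inp x (g + 1 + (v + 1)) - inp x (g + 1 + v) = ?d"
    proof -
      have "inp x (g + 1 + u) = length (concat (take u L))" if "u \<le> n" for u
        using graph that unfolding graph_at_def by blast
      from this[of "v + 1"] this[of v]
      have "inp x (g + 1 + (v + 1)) = length (concat (take (v + 1) L))" "inp x (g + 1 + v) = length (concat (take v L))"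
        using lt(3) by simp_all
      moreover have "take (v + 1) L = take v L @ [L ! v]" using lt(3) by (simp add: take_Suc_conv_app_nth)
      ultimately show ?thesis by simp
    qed
    have v1: "val x ?s degreeE = ?d"
      using off e s by (simp add: val_Inp del: val.simps(3) add_Suc_right)
    have dX: "?d < X"
    proof -
      have "inp x i < X" for i using inputs_below[of "x ! i"] X_ge by (auto simp: inp_def)
      then have "inp x (g + 1 + (v + 1)) < X" by blast
      then show ?thesis using off by linarith
    qed
    define F where "F = wp (Store (Const 21) vertex_cellE) R 30"
    have fin: "F (s(17 := 0, 19 := length ?ys))"
    proof -
      let ?u = "s(17 := 0, 19 := length ?ys)"
      have val: "val x ?u vertex_cellE = cell K ?src t idx" using b e s by simp
      have "R (?u(21 := cell K ?src t idx))" by (rule rest) (auto simp: same_def)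
      then show ?thesis unfolding F_def by (intro wp_time[OF wp_Store], unfold val) (use srcX in \<open>simp_all add: ok_def\<close>)
    qed
    let ?v = "?s(19 := ?d)"
    \<comment> \<open>The truncated difference is non-zero exactly if the degree exceeds
      \<open>K\<close>; afterwards cell 19 holds the length of the truncated list.\<close>
    have "wp (Cond (Sub (V 19) (V 3)) (Store (Const 19) (V 3)) Skip)
        F 20 ?v"
    proof (rule wp_time[OF wp_Cond[where T = 10]])
      assume "val x ?v (Sub (V 19) (V 3)) \<noteq> 0"
      then have "length ?ys = K" using b e by simp
      then have "?v(19 := K) = s(17 := 0, 19 := length ?ys)" by simp
      then show "wp (Store (Const 19) (V 3)) F 10 ?v"
        using fin e bs[of 3] by (intro wp_time[OF wp_Store]) (simp_all add: ok_def)
    next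
      assume "val x ?v (Sub (V 19) (V 3)) = 0"
      then have "length ?ys = ?d" using b e by simp
      then show "wp Skip F 10 ?v"
        using fin by (intro wp_time[OF wp_Skip]) simp_all
    qed (simp_all add: ok_def)
    from wp_Seq[OF this[unfolded F_def]] have c: "wp (Seq (Cond (Sub (V 19) (V 3)) (Store (Const 19) (V 3)) Skip)
           (Store (Const 21) vertex_cellE)) R (20 + 30) ?v" .
    show "wp (Seq (Store (Const 19) degreeE)
         (Seq (Cond (Sub (V 19) (V 3)) (Store (Const 19) (V 3)) Skip)
           (Store (Const 21) vertex_cellE)))
      R 100 ?s"
      by (rule wp_time, rule wp_Seq, rule wp_Store, unfold v1) (use c dX in \<open>auto simp: ok_def\<close>)
  next
    assume "val x ?s (V 13) = 0"
    then have b: "\<not> ?b" using s by simp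
    let ?u = "?s(19 := 1)"
    have val: "val x ?u (cellE (Const 0) (V 12)) = cell K ?src t idx" using b e s by simp
    have "R (?u(21 := cell K ?src t idx))" by (rule rest) (use b in \<open>auto simp: same_def\<close>)
    then have "wp (Store (Const 21) (cellE (Const 0) (V 12))) R 30 ?u"
      by (intro wp_time[OF wp_Store], unfold val) (use srcX in \<open>simp_all add: ok_def\<close>)
    then show "wp (Seq (Store (Const 19) (Const 1)) (Store (Const 21) (cellE (Const 0) (V 12)))) R 100 ?s"
      using X_ge by (intro wp_time[OF wp_Seq[OF wp_Store]]) (auto simp: ok_def)
  qed (simp_all add: ok_def)
  then have "wp vertex_body Post (cost (Const 17) + cost (Const 0) + 1 + (110 + ?T)) s"
    unfolding vertex_body_def R_def using X_ge
    by (intro wp_Seq[OF wp_Store] wp_Seq) (simp_all add: ok_def)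
  then show ?thesis
    unfolding Post_def out_def by (rule wp_time) (simp add: algebra_simps)
qed

end

lemma cell_neq_numeral [simp]:
  "numeral m < (50 :: nat) \<Longrightarrow> cell K row t idx \<noteq> numeral m"
  "numeral m < (50 :: nat) \<Longrightarrow> numeral m \<noteq> cell K row t idx"
  using cell_ge[of K row t idx] by linarith+

context table_run
begin

abbreviation "M \<equiv> {15, 16, 17, 18, 19, 20, 21, 22, 23, 24, 25, 26, 27}"

lemma correct_upd: "a < 50 \<Longrightarrow> correct (s(a := v)) row t l \<longleftrightarrow> correct s row t l"
  unfolding correct_def by (subst fun_upd_other[OF cell_scalar]) simp_all

text \<open>Layer \<open>Suc t\<close> reads only layer \<open>t\<close>, so no source is
  overwritten. Row 0 is written last because it is the sum accumulated in cell 16.\<close>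

lemma wp_index_body:
  assumes env: "env s" and s: "s 12 = t" "s 14 = idx" "s 13 = of_bool (bit r t)"
    and lt: "t < K" "idx < Q"
    and src: "\<And>row l. row \<le> n \<Longrightarrow> l < Q \<Longrightarrow> correct s row t l"
  shows "wp index_body (\<lambda>s'. same (M \<union> range (\<lambda>row. cell K row (Suc t) idx)) s s' \<and>
      (\<forall>row\<le>n. correct s' row (Suc t) idx))
    (1000 * ((n + 1) * cube (K + 1))) s"
proof (rule wp_bounded)
  assume bs: "\<And>a. s a < X"
  let ?b = "bit r t"
  let ?out = "range (\<lambda>row. cell K row (Suc t) idx)"
  define B where "B = cube (K + 1)"
  define S where "S k = (\<Sum>v<k. of_bool ?b * tab (Suc t) (Suc v) idx)" for k
  define Post where "Post s' \<longleftrightarrow> same (M \<union> ?out) s s' \<and> (\<forall>row\<le>n. correct s' row (Suc t) idx)" for s'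
  have S_n: "S n = tab (Suc t) 0 idx" unfolding S_def table_Suc_0 by simp
  define I where "I k u \<longleftrightarrow> same (M \<union> ?out) s u \<and> (\<forall>v<k. correct u (Suc v) (Suc t) idx) \<and>
      int (u 16) = S k mod int p" for k u
  let ?fin = "Store (cellE (Const 0) (Add (V 12) (Const 1))) (V 16)"
  let ?s = "s(16 := 0)"
  have scal: "u a = s a" if "same (M \<union> ?out) s u" "a \<in> {3, 4, 5, 8, 10, 11, 12, 13, 14}" for u a
    using that(2) by (intro sameD[OF that(1)]) auto
  have loop: "wp (For 15 (V 11) vertex_body) (wp ?fin Post 30) ((n + 1) * (800 * B + cost (V 11) + 13)) ?s"
  proof (rule wp_For[where I = I])
    show "I 0 (?s(15 := 0))"
      unfolding I_def S_def same_def by auto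
    show "val x u (V 11) = n" if "I k u" for k u
      using that scal[of u 11] env unfolding I_def env_def by simp
    show "n < X" using bs[of 11] env unfolding env_def by simp
    show "wp ?fin Post 30 u" if I: "I n u" and bu: "\<And>a. u a < X" for u
    proof -
      have sm: "same (M \<union> ?out) s u" and cor: "\<And>v. v < n \<Longrightarrow> correct u (Suc v) (Suc t) idx"
        and u16: "int (u 16) = tab (Suc t) 0 idx mod int p"
        using I unfolding I_def S_n by auto
      let ?o = "cell K 0 (Suc t) idx"
      have val: "val x u (cellE (Const 0) (Add (V 12) (Const 1))) = ?o"
        using scal[OF sm] env s unfolding env_def by simp
      have "same (M \<union> ?out) s (u(?o := u 16))" using sm unfolding same_def by auto
      moreover have "correct (u(?o := u 16)) row (Suc t) idx" if "row \<le> n" for row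
      proof (cases row)
        case 0
        then show ?thesis using u16 unfolding correct_def by simp
      next
        case (Suc v)
        have "cell K (Suc v) (Suc t) idx \<noteq> ?o" using cell_inj[of K "Suc v" "Suc t" idx 0 "Suc t" idx] lt by auto
        then show ?thesis using cor[of v] Suc that unfolding correct_def by simp
      qed
      ultimately have "Post (u(?o := u 16))" unfolding Post_def by blast
      then show ?thesis
        by (intro wp_time[OF wp_Store], unfold val) (use bu in \<open>auto simp: ok_def\<close>)
    qed
    fix k u assume k: "k < n" and Iu: "I k u" and uk: "u 15 = k"
    have sm: "same (M \<union> ?out) s u" and cor: "\<And>v. v < k \<Longrightarrow> correct u (Suc v) (Suc t) idx"
      and u16: "int (u 16) = S k mod int p"
      using Iu unfolding I_def by auto
    have "wp vertex_body (\<lambda>s'. same (insert (cell K (Suc k) (Suc t) idx) scratch) u s' \<and>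
      correct s' (Suc k) (Suc t) idx \<and>
      int (s' 16) = (S k + of_bool (bit r t) * tab (Suc t) (Suc k) idx) mod int p) (800 * cube (K + 1)) u"
    proof (rule wp_vertex_body)
      show "env u" using env scal[OF sm] unfolding env_def by simp
      show "u 12 = t" "u 14 = idx" "u 15 = k" "u 13 = of_bool (bit r t)"
        using s uk scal[OF sm] by simp_all
      show "correct u (if bit r t then Suc k else 0) t l" if "l \<le> idx" for l
      proof (rule correct_same[OF src sm])
        show "(if bit r t then Suc k else 0) \<le> n" using k by simp
        show l: "l < Q" using that lt(2) by (rule le_less_trans)
        show "cell K (if bit r t then Suc k else 0) t l \<notin> M \<union> ?out"
          using cell_inj[of K _ t l _ "Suc t" idx] cell_scalar l lt by fastforce
      qed
    qed (use u16 lt k in auto)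
    then show "wp vertex_body (\<lambda>s'. s' 15 = k \<and> I (Suc k) (s'(15 := Suc k))) (800 * B) u"
      unfolding B_def
    proof (rule wp_mono)
      fix s' assume s': "same (insert (cell K (Suc k) (Suc t) idx) scratch) u s' \<and>
        correct s' (Suc k) (Suc t) idx \<and>
        int (s' 16) = (S k + of_bool (bit r t) * tab (Suc t) (Suc k) idx) mod int p"
      have "s' 15 = u 15"
        by (rule sameD[OF conjunct1[OF s']]) auto
      moreover have "same (M \<union> ?out) s (s'(15 := Suc k))"
      proof -
        have "s' a = s a" if "a \<notin> M \<union> ?out" for a
        proof -
          have "s' a = u a" using that by (intro sameD[OF conjunct1[OF s']]) auto
          also have "u a = s a" using sm that by (rule sameD)
          finally show ?thesis .
        qed
        then show ?thesis unfolding same_def by auto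
      qed
      moreover have "correct (s'(15 := Suc k)) (Suc v) (Suc t) idx" if "v < Suc k" for v
      proof (cases "v = k")
        case True
        then show ?thesis using conjunct1[OF conjunct2[OF s']] by (simp add: correct_upd)
      next
        case False
        then have "correct u (Suc v) (Suc t) idx" using that cor by simp
        moreover have "cell K (Suc v) (Suc t) idx \<noteq> cell K (Suc k) (Suc t) idx"
          using cell_inj[of K "Suc v" "Suc t" idx "Suc k" "Suc t" idx] lt False by auto
        then have "cell K (Suc v) (Suc t) idx \<notin> insert (cell K (Suc k) (Suc t) idx) scratch"
          by simp
        ultimately have "correct s' (Suc v) (Suc t) idx" using correct_same[OF _ conjunct1[OF s']] by blast
        then show ?thesis by (simp add: correct_upd)
      qed
      moreover have "int ((s'(15 := Suc k)) 16) = S (Suc k) mod int p"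
      proof -
        have e: "(s'(15 := Suc k)) 16 = s' 16" by simp
        have "S (Suc k) = S k + of_bool (bit r t) * tab (Suc t) (Suc k) idx" unfolding S_def by (rule sum.lessThan_Suc)
        then show ?thesis unfolding e using s' by argo
      qed
      ultimately show "s' 15 = k \<and> I (Suc k) (s'(15 := Suc k))" using uk unfolding I_def by blast
    qed simp
  qed simp_all
  have "wp index_body Post (cost (Const 16) + cost (Const 0) + 1 + ((n + 1) * (800 * B + cost (V 11) + 13) + 30)) s"
    unfolding index_body_def
    by (intro wp_Seq[OF wp_Store] wp_Seq) (use loop X_ge in \<open>auto simp: ok_def\<close>)
  moreover have "cost (Const 16) + cost (Const 0) + 1 + ((n + 1) * (800 * B + cost (V 11) + 13) + 30) \<le> 1000 * ((n + 1) * B)"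
  proof -
    have "1 \<le> B" unfolding B_def by simp
    then have "n + 1 \<le> (n + 1) * B" using mult_le_mono2[of 1 B "n + 1"] by simp
    then show ?thesis by (simp add: algebra_simps)
  qed
  ultimately show ?thesis
    unfolding Post_def B_def by (rule wp_time)
qed

text \<open>The current bit of the pattern is the parity of the quotient in cell 32, which is halved
  once per layer.\<close>

lemma wp_layer_body:
  assumes env: "env s" and s: "s 12 = t" "s 32 = r div 2 ^ t" and lt: "t < K"
    and src: "\<And>row l. row \<le> n \<Longrightarrow> l < Q \<Longrightarrow> correct s row t l"
  shows "wp layer_body (\<lambda>s'. same (M \<union> {13, 14, 32} \<union> (\<lambda>(row, l). cell K row (Suc t) l) ` (UNIV \<times> {..<Q})) s s' \<and>
      s' 32 = r div 2 ^ Suc t \<and> (\<forall>row\<le>n. \<forall>l<Q. correct s' row (Suc t) l))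
    (1200 * ((Q + 1) * ((n + 1) * cube (K + 1)))) s"
proof (rule wp_bounded)
  assume bs: "\<And>a. s a < X"
  let ?out = "(\<lambda>(row, l). cell K row (Suc t) l) ` (UNIV \<times> {..<Q})"
  let ?M = "M \<union> {13, 14} \<union> ?out"
  define B where "B = (n + 1) * cube (K + 1)"
  define Post where "Post s' \<longleftrightarrow> same (M \<union> {13, 14, 32} \<union> ?out) s s' \<and>
      s' 32 = r div 2 ^ Suc t \<and> (\<forall>row\<le>n. \<forall>l<Q. correct s' row (Suc t) l)" for s'
  define I where "I k u \<longleftrightarrow> same ?M s u \<and> u 13 = of_bool (bit r t) \<and> (\<forall>row\<le>n. \<forall>l<k. correct u row (Suc t) l)" for k u
  let ?fin = "Store (Const 32) (Div (V 32) (Const 2))"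
  have bit: "r div 2 ^ t mod 2 = of_bool (bit r t)"
    unfolding bit_iff_odd by (rule mod_2_eq_odd)
  let ?s = "s(13 := of_bool (bit r t))"
  have scal: "u a = s a" if "same ?M s u" "a \<in> {3, 4, 5, 8, 10, 11, 12, 32}" for u a
    using that(2) by (intro sameD[OF that(1)]) auto
  have loop: "wp (For 14 (V 5) index_body) (wp ?fin Post 30) ((Q + 1) * (1000 * B + cost (V 5) + 13)) ?s"
  proof (rule wp_For[where I = I])
    show "I 0 (?s(14 := 0))" unfolding I_def same_def by auto
    show "val x u (V 5) = Q" if "I k u" for k u
      using that scal[of u 5] env unfolding I_def env_def by simp
    show "Q < X" by (rule K(2))
    show "wp ?fin Post 30 u" if I: "I Q u" and bu: "\<And>a. u a < X" for u
    proof -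
      have sm: "same ?M s u" and cor: "\<And>row l. row \<le> n \<Longrightarrow> l < Q \<Longrightarrow> correct u row (Suc t) l"
        using I unfolding I_def by auto
      have d: "r div 2 ^ Suc t = r div 2 ^ t div 2" unfolding power_Suc2 by (rule div_mult2_eq)
      have val: "val x u (Div (V 32) (Const 2)) = r div 2 ^ Suc t"
        using scal[OF sm, of 32] s d by simp
      have "r div 2 ^ Suc t \<le> r div 2 ^ t" unfolding d by simp
      then have ltX: "r div 2 ^ Suc t < X" using bs[of 32] s by linarith
      have "same (M \<union> {13, 14, 32} \<union> ?out) s (u(32 := r div 2 ^ Suc t))" using sm unfolding same_def by auto
      moreover have "correct (u(32 := r div 2 ^ Suc t)) row (Suc t) l" if "row \<le> n" "l < Q" for row l
        using cor[OF that] by (simp add: correct_upd)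
      ultimately have "Post (u(32 := r div 2 ^ Suc t))" unfolding Post_def by simp
      then show ?thesis
        by (intro wp_time[OF wp_Store], unfold val) (use ltX in \<open>auto simp: ok_def\<close>)
    qed
    fix k u assume k: "k < Q" and Iu: "I k u" and uk: "u 14 = k"
    have sm: "same ?M s u" and u13: "u 13 = of_bool (bit r t)"
      and cor: "\<And>row l. row \<le> n \<Longrightarrow> l < k \<Longrightarrow> correct u row (Suc t) l"
      using Iu unfolding I_def by auto
    have "wp index_body (\<lambda>s'. same (M \<union> range (\<lambda>row. cell K row (Suc t) k)) u s' \<and>
      (\<forall>row\<le>n. correct s' row (Suc t) k)) (1000 * ((n + 1) * cube (K + 1))) u"
    proof (rule wp_index_body)
      show "env u" using env scal[OF sm] unfolding env_def by simp
      show "u 12 = t" using s scal[OF sm] by simp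
      show "correct u row t l" if "row \<le> n" "l < Q" for row l
      proof (rule correct_same[OF src[OF that] sm])
        show "cell K row t l \<notin> ?M"
          using cell_inj[of K row t l _ "Suc t"] cell_scalar that lt by fastforce
      qed
    qed (use u13 uk lt k in auto)
    then show "wp index_body (\<lambda>s'. s' 14 = k \<and> I (Suc k) (s'(14 := Suc k))) (1000 * B) u"
      unfolding B_def
    proof (rule wp_mono)
      fix s' assume s': "same (M \<union> range (\<lambda>row. cell K row (Suc t) k)) u s' \<and> (\<forall>row\<le>n. correct s' row (Suc t) k)"
      have eq: "s' a = u a" if "a \<in> {13, 14}" for a
        using that by (intro sameD[OF conjunct1[OF s']]) auto
      have "s' a = s a" if "a \<notin> ?M" for a
      proof -
        have "a \<notin> M \<union> range (\<lambda>row. cell K row (Suc t) k)" using that k by auto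
        then have "s' a = u a" using s' by (blast intro: sameD)
        also have "u a = s a" using sm that by (rule sameD)
        finally show ?thesis .
      qed
      then have "same ?M s (s'(14 := Suc k))" unfolding same_def by auto
      moreover have "correct (s'(14 := Suc k)) row (Suc t) l" if "row \<le> n" "l < Suc k" for row l
      proof -
        have "correct s' row (Suc t) l"
        proof (cases "l = k")
          case True
          then show ?thesis using s' that by blast
        next
          case False
          then have "correct u row (Suc t) l" using that cor by simp
          moreover have "cell K row (Suc t) l \<notin> M \<union> range (\<lambda>row. cell K row (Suc t) k)"
            using cell_inj[of K row "Suc t" l _ "Suc t" k] cell_scalar lt k that False by fastforce
          ultimately show ?thesis using s' by (blast intro: correct_same)
        qed
        then show ?thesis by (simp add: correct_upd)
      qed
      moreover have "(s'(14 := Suc k)) 13 = of_bool (bit r t)" using eq[of 13] u13 by simp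
      ultimately show "s' 14 = k \<and> I (Suc k) (s'(14 := Suc k))" using eq[of 14] uk unfolding I_def by blast
    qed simp
  qed simp_all
  have "wp layer_body Post (cost (Const 13) + cost (modE (V 32) (Const 2)) + 1 + ((Q + 1) * (1000 * B + cost (V 5) + 13) + 30)) s"
    unfolding layer_body_def
    by (intro wp_Seq[OF wp_Store] wp_Seq) (use loop X_ge bit s in \<open>auto simp: ok_def\<close>)
  moreover have "cost (Const 13) + cost (modE (V 32) (Const 2)) + 1 + ((Q + 1) * (1000 * B + cost (V 5) + 13) + 30) \<le> 1200 * ((Q + 1) * B)"
  proof -
    have "1 \<le> B" unfolding B_def by simp
    then have "Q + 1 \<le> (Q + 1) * B" using mult_le_mono2[of 1 B "Q + 1"] by simp
    then show ?thesis by (simp add: algebra_simps)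
  qed
  ultimately show ?thesis
    unfolding Post_def B_def by (rule wp_time)
qed

text \<open>Only layer 0 has to be right at the start: every other entry is rewritten before it is
  read, so what earlier graphs, patterns and moduli left behind does no harm.\<close>

lemma wp_fill_table:
  defines "out \<equiv> {cell K row t l | row t l. 0 < t \<and> t \<le> K \<and> l < Q}"
  assumes s: "s 3 = K" "s 4 = 2 ^ K" "s 5 = Q" "s 8 = p" "s 9 = r" "s 10 = g"
    and src: "\<And>row l. row \<le> n \<Longrightarrow> l < Q \<Longrightarrow> correct s row 0 l"
  shows "wp fill_table (\<lambda>s'. same (M \<union> {11, 12, 13, 14, 32} \<union> out) s s' \<and>
      (\<forall>t\<le>K. \<forall>row\<le>n. \<forall>l<Q. correct s' row t l))
    (1400 * ((K + 1) * ((Q + 1) * ((n + 1) * cube (K + 1))))) s"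
proof (rule wp_bounded)
  assume bs: "\<And>a. s a < X"
  let ?M = "M \<union> {11, 12, 13, 14, 32} \<union> out"
  define B where "B = (Q + 1) * ((n + 1) * cube (K + 1))"
  define Post where "Post s' \<longleftrightarrow> same ?M s s' \<and> (\<forall>t\<le>K. \<forall>row\<le>n. \<forall>l<Q. correct s' row t l)" for s'
  define I where "I k u \<longleftrightarrow> same ?M s u \<and> u 11 = n \<and> u 32 = r div 2 ^ k \<and> (\<forall>t\<le>k. \<forall>row\<le>n. \<forall>l<Q. correct u row t l)" for k u
  have scal: "u a = s a" if "same ?M s u" "a \<in> {3, 4, 5, 8, 9, 10}" for u a
    using that(2) by (intro sameD[OF that(1)]) (auto simp: out_def)
  let ?s = "s(11 := n, 32 := r)"
  have loop: "wp (For 12 (V 3) layer_body) Post ((K + 1) * (1200 * B + cost (V 3) + 13)) ?s"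
  proof (rule wp_For[where I = I])
    show "I 0 (?s(12 := 0))"
    proof -
      have "correct (?s(12 := 0)) row 0 l" if "row \<le> n" "l < Q" for row l
        using src[OF that] by (simp add: correct_upd)
      moreover have "same ?M s (?s(12 := 0))" unfolding same_def by auto
      ultimately show ?thesis unfolding I_def by simp
    qed
    show "val x u (V 3) = K" if "I k u" for k u
      using that scal[of u 3] s unfolding I_def by simp
    show "K < X" using bs[of 3] s by simp
    show "Post u" if "I K u" for u using that unfolding I_def Post_def by blast
    fix k u assume k: "k < K" and Iu: "I k u" and uk: "u 12 = k"
    have sm: "same ?M s u" and u: "u 11 = n" "u 32 = r div 2 ^ k"
      and cor: "\<And>t row l. t \<le> k \<Longrightarrow> row \<le> n \<Longrightarrow> l < Q \<Longrightarrow> correct u row t l"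
      using Iu unfolding I_def by auto
    let ?o = "(\<lambda>(row, l). cell K row (Suc k) l) ` (UNIV \<times> {..<Q})"
    let ?N = "M \<union> {13, 14, 32} \<union> ?o"
    have o: "?o \<subseteq> out"
    proof -
      have "cell K row (Suc k) l \<in> out" if "l < Q" for row l
        using k that unfolding out_def by (intro CollectI exI[of _ row] exI[of _ "Suc k"] exI[of _ l]) simp
      then show ?thesis by auto
    qed
    have "wp layer_body (\<lambda>s'. same ?N u s' \<and> s' 32 = r div 2 ^ Suc k \<and> (\<forall>row\<le>n. \<forall>l<Q. correct s' row (Suc k) l))
      (1200 * ((Q + 1) * ((n + 1) * cube (K + 1)))) u"
    proof (rule wp_layer_body)
      show "env u" using s scal[OF sm] u unfolding env_def by simp
    qed (use u uk k cor in auto)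
    then show "wp layer_body (\<lambda>s'. s' 12 = k \<and> I (Suc k) (s'(12 := Suc k))) (1200 * B) u"
      unfolding B_def
    proof (rule wp_mono)
      fix s' assume s': "same ?N u s' \<and> s' 32 = r div 2 ^ Suc k \<and> (\<forall>row\<le>n. \<forall>l<Q. correct s' row (Suc k) l)"
      have eq: "s' a = u a" if "a \<in> {11, 12}" for a
        using that by (intro sameD[OF conjunct1[OF s']]) auto
      have "s' a = s a" if "a \<notin> ?M" for a
      proof -
        have "a \<notin> ?N" using that o by auto
        then have "s' a = u a" using s' by (blast intro: sameD)
        also have "u a = s a" using sm that by (rule sameD)
        finally show ?thesis .
      qed
      then have "same ?M s (s'(12 := Suc k))" unfolding same_def by auto
      moreover have "correct (s'(12 := Suc k)) row t l" if "t \<le> Suc k" "row \<le> n" "l < Q" for row t l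
      proof -
        have "correct s' row t l"
        proof (cases "t = Suc k")
          case True
          then show ?thesis using s' that by blast
        next
          case False
          then have "correct u row t l" using that cor by simp
          moreover have "cell K row t l \<notin> ?N"
            using cell_inj[of K row t l _ "Suc k"] cell_scalar that k False by fastforce
          ultimately show ?thesis using s' by (blast intro: correct_same)
        qed
        then show ?thesis by (simp add: correct_upd)
      qed
      moreover have "(s'(12 := Suc k)) 11 = n" "(s'(12 := Suc k)) 32 = r div 2 ^ Suc k" using eq[of 11] u s' by simp_all
      ultimately show "s' 12 = k \<and> I (Suc k) (s'(12 := Suc k))" using eq[of 12] uk unfolding I_def by blast
    qed simp
  qed simp_all
  have inp: "val x s (Inp (V 10)) = n" using s graph by (simp add: val_Inp graph_at_def del: val.simps(3))
  have "val x s (Inp (V 10)) < X" using inputs_below[OF nth_mem] X_ge by simp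
  then have nX: "n < X" unfolding inp .
  have "wp fill_table Post (cost (Const 11) + cost (Inp (V 10)) + 1 + (cost (Const 32) + cost (V 9) + 1 + (K + 1) * (1200 * B + cost (V 3) + 13))) s"
    unfolding fill_table_def
  proof (intro wp_Seq[OF wp_Store], unfold inp)
    show "wp (For 12 (V 3) layer_body) Post ((K + 1) * (1200 * B + cost (V 3) + 13))
      (s(val x s (Const 11) := n, val x (s(val x s (Const 11) := n)) (Const 32) := val x (s(val x s (Const 11) := n)) (V 9)))"
      using loop s by simp
  qed (use nX bs[of 9] in \<open>auto simp: ok_def\<close>)
  moreover have "cost (Const 11) + cost (Inp (V 10)) + 1 + (cost (Const 32) + cost (V 9) + 1 + (K + 1) * (1200 * B + cost (V 3) + 13)) \<le> 1400 * ((K + 1) * B)"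
  proof -
    have "1 \<le> B" unfolding B_def by simp
    then have "K + 1 \<le> (K + 1) * B" using mult_le_mono2[of 1 B "K + 1"] by simp
    then show ?thesis by (simp add: algebra_simps)
  qed
  ultimately show ?thesis
    unfolding Post_def B_def by (rule wp_time)
qed

end

section \<open>All patterns and moduli on both graphs\<close>

definition resultE :: "exp \<Rightarrow> exp \<Rightarrow> exp" where
  "resultE t m = Mem (Add (Const 50) (Add (Mul t (V 5)) (Mul (Sub m (Const 1)) (Add (V 4) (Const 1)))))"

text \<open>With \<open>m = 2 ^ t\<close> the address in \<open>resultE\<close> is that of
  \<open>full K t\<close> in row 0 of layer \<open>t\<close>. Here \<open>h = K - 1\<close> and
  \<open>2 ^ h\<close> is half of \<open>2 ^ K\<close>.\<close>

abbreviation "resultE_h \<equiv> resultE (Sub (V 3) (Const 1)) (Div (V 4) (Const 2))"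
abbreviation "resultE_K \<equiv> resultE (V 3) (V 4)"

text \<open>A sum of products of natural numbers is non-zero iff both residues are non-zero for one
  of the two lengths. The products must not be reduced, because the modulus may be composite and
  have zero divisors.\<close>

abbreviation "check_results \<equiv> Cond (Add (Mul (V 28) resultE_h) (Mul (V 29) resultE_K)) (Store (Const 0) (Const 1)) Skip"

definition pattern_body :: com where
  "pattern_body = Seq (Store (Const 10) (Const 1)) (Seq fill_table
     (Seq (Store (Const 28) resultE_h) (Seq (Store (Const 29) resultE_K)
     (Seq (Store (Const 10) (V 30)) (Seq fill_table
     check_results)))))"

definition modulus_body :: com where
  "modulus_body = Seq (Store (Const 8) (Add (V 7) (V 31))) (For 9 (V 4) pattern_body)"

text \<open>The second graph starts after \<open>h\<close>, the vertex count, one offset more than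
  there are vertices, and the lists of the first. As memory is initially zero, the last store
  completes layer 0: cell 50 is row 0 with empty column sets.\<close>

definition setup_constants :: com where
  "setup_constants = Seq (Store (Const 3) (Add (Inp (Const 0)) (Const 1)))
     (Seq (Store (Const 4) (Const 1))
     (Seq (For 22 (V 3) (Store (Const 4) (Mul (V 4) (Const 2))))
     (Seq (Store (Const 5) (Mul (V 4) (V 4)))
     (Seq (Store (Const 6) (Mul (Const 26) (Mul (V 3) (V 3))))
     (Seq (Store (Const 30) (Add (Add (Inp (Const 1)) (Const 3)) (Inp (Add (Inp (Const 1)) (Const 2)))))
     (Seq (Store (Const 7) (Mul (Add (Add (Inp (Const 1)) (Inp (V 30))) (Const 2)) (Mul (V 6) (V 6))))
       (Store (Const 50) (Const 1))))))))"

definition mcsf_program :: com where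
  "mcsf_program = Seq setup_constants (For 31 (Add (V 6) (Const 1)) modulus_body)"

lemma cell_neq_0 [simp]: "cell K row t idx \<noteq> 0" "0 \<noteq> cell K row t idx"
  using cell_ge[of K row t idx] by linarith+

text \<open>\<open>X\<close> dominates the moduli, of order \<open>N * B ^ 4\<close>, the table
  addresses, of order \<open>N * B ^ 3\<close>, and the offsets in the input, of order
  \<open>N ^ 2\<close>. Being polynomial in \<open>N\<close> and \<open>2 ^ K\<close>, it keeps the
  word length linear in \<open>h\<close> and logarithmic in the number of vertices.\<close>

locale mcsf_run = ram +
  fixes h :: nat and L1 L2 :: "nat list list"
  assumes x: "x = h # graph_words L1 @ graph_words L2"
    and nbs1: "\<And>v y. v < length L1 \<Longrightarrow> y \<in> set (L1 ! v) \<Longrightarrow> y < length L1"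
    and nbs2: "\<And>v y. v < length L2 \<Longrightarrow> y \<in> set (L2 ! v) \<Longrightarrow> y < length L2"
    and X: "X = 1024 * (length L1 + length L2 + 2) ^ 2 * (2 ^ Suc h) ^ 4"
    and words: "1 + length (graph_words L1) < X"
begin

abbreviation "K \<equiv> Suc h"
definition N :: nat where "N = length L1 + length L2 + 2"
definition B :: nat where "B = 2 ^ K"
text \<open>With the exponent \<open>E = 2 * K * K + 4 * K\<close> of \<open>table_full_le\<close>,
  the product of both weights is below \<open>modulus ^ (2 * E + 1)\<close>, and
  \<open>exists_nondivisor\<close> asks for \<open>2 * (2 * E + 1) = 8 * K * K + 16 * K + 2\<close>
  candidates, at most \<open>26 * K * K\<close>.\<close>

definition tries :: nat where "tries = 26 * (K * K)"
text \<open>The square of \<open>tries\<close> is required by \<open>exists_nondivisor\<close>; the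
  factor \<open>N\<close> makes the modulus exceed the numbers of vertices.\<close>

definition modulus :: nat where "modulus = N * (tries * tries)"
definition g2 :: nat where "g2 = 1 + length (graph_words L1)"

definition weight1 :: "nat \<Rightarrow> nat \<Rightarrow> int" where
  "weight1 r t = table (bit r) (\<lambda>v. take K (L1 ! v)) (length L1) K t 0 (full K t)"
definition weight2 :: "nat \<Rightarrow> nat \<Rightarrow> int" where
  "weight2 r t = table (bit r) (\<lambda>v. take K (L2 ! v)) (length L2) K t 0 (full K t)"

definition hit :: "nat \<Rightarrow> nat \<Rightarrow> bool" where
  "hit p r \<longleftrightarrow> (\<exists>t\<in>{h, K}. weight1 r t mod int p \<noteq> 0 \<and> weight2 r t mod int p \<noteq> 0)"

lemma K_less_B: "K < B"
  unfolding B_def by (rule less_exp)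

lemma N_ge: "2 \<le> N"
  by (simp add: N_def)

lemma X_eq: "X = 1024 * N ^ 2 * B ^ 4"
  unfolding X N_def B_def ..

text \<open>The factor 1024 of \<open>X\<close> leaves room for the coefficients that occur, the
  largest being \<open>703 = 676 + 26 + 1\<close> for the largest modulus. It is a power of two so
  that \<open>X\<close> is easily bounded by one.\<close>

lemma N_power_B_less: "a \<le> 2 \<Longrightarrow> b \<le> 4 \<Longrightarrow> c < 1024 \<Longrightarrow> c * (N ^ a * B ^ b) < X"
proof -
  assume a: "a \<le> 2" and b: "b \<le> 4" and c: "c < 1024"
  have "0 < N ^ a * B ^ b" using N_ge K_less_B by simp
  then have "c * (N ^ a * B ^ b) < 1024 * (N ^ a * B ^ b)" using c by simp
  also have "\<dots> \<le> 1024 * (N ^ 2 * B ^ 4)"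
    using a b N_ge K_less_B by (intro mult_le_mono power_increasing) auto
  finally show ?thesis unfolding X_eq by (simp only: mult.assoc)
qed

lemma tries_le: "tries \<le> 26 * (N ^ 0 * B ^ 2)"
proof -
  have "K * K \<le> B * B" using K_less_B by (intro mult_le_mono) auto
  then have "26 * (K * K) \<le> 26 * (B * B)" by (rule mult_le_mono2)
  then show ?thesis by (simp only: tries_def power2_eq_square power_0 mult_1)
qed

lemma modulus_le: "modulus \<le> 676 * (N ^ 1 * B ^ 4)"
proof -
  have "tries * tries \<le> (26 * B ^ 2) * (26 * B ^ 2)" using tries_le by (intro mult_le_mono) simp_all
  also have "\<dots> = 676 * B ^ 4" by (simp add: power_add[symmetric])
  finally have "N * (tries * tries) \<le> N * (676 * B ^ 4)" by (rule mult_le_mono2)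
  then show ?thesis by (simp add: modulus_def)
qed

lemma modulus_ge: "2 \<le> modulus"
proof -
  have "1 \<le> tries * tries" by (simp add: tries_def)
  then have "2 * 1 \<le> N * (tries * tries)" using N_ge by (intro mult_le_mono)
  then show ?thesis by (simp add: modulus_def)
qed

lemma modulus_tries_less: "modulus + tries < X" "tries + 1 < X" "modulus < X"
proof -
  have "B ^ 2 \<le> N ^ 1 * B ^ 4"
    using N_ge K_less_B by (intro order.trans[OF power_increasing[of 2 4 B]]) auto
  moreover have "1 \<le> N ^ 1 * B ^ 4" using N_ge K_less_B by simp
  moreover have "tries \<le> 26 * B ^ 2" using tries_le by simp
  ultimately have "modulus + tries + 1 \<le> 703 * (N ^ 1 * B ^ 4)"
    using modulus_le by linarith
  also have "\<dots> < X" by (rule N_power_B_less) simp_all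
  finally show "modulus + tries < X" "tries + 1 < X" "modulus < X" by simp_all
qed

lemma B2_less: "2 ^ K * 2 ^ K < X" "B < X"
  using N_power_B_less[of 0 2 1] N_power_B_less[of 0 1 1] by (simp_all add: B_def power2_eq_square)

lemma cell_less:
  assumes "row + 2 \<le> N" "t \<le> K" "idx < 2 ^ K * 2 ^ K"
  shows "cell K row t idx < X"
proof -
  have i: "idx < B ^ 2" using assms(3) by (simp add: B_def power2_eq_square)
  have "row * (K + 1) + t + 1 \<le> (row + 1) * (K + 1)" using assms(2) by simp
  also have "\<dots> \<le> N * B" using assms(1) K_less_B by (intro mult_le_mono) auto
  finally have "(row * (K + 1) + t + 1) * B ^ 2 \<le> N * B * B ^ 2" by (rule mult_le_mono1)
  moreover have "(row * (K + 1) + t) * B ^ 2 + idx < (row * (K + 1) + t + 1) * B ^ 2" using i by simp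
  ultimately have "(row * (K + 1) + t) * B ^ 2 + idx < N ^ 1 * B ^ 3"
    by (simp add: power2_eq_square power3_eq_cube)
  moreover have "1 \<le> N ^ 1 * B ^ 3" using N_ge K_less_B by simp
  ultimately have "50 + ((row * (K + 1) + t) * B ^ 2 + idx) < 51 * (N ^ 1 * B ^ 3)" by simp
  also have "\<dots> < X" by (rule N_power_B_less) simp_all
  finally show ?thesis unfolding cell_def B_def by (simp add: power2_eq_square)
qed

lemma graphs: "graph_at x 1 L1" "graph_at x g2 L2"
  using graph_at_graph_words[of "[h]" L1 "graph_words L2"] graph_at_graph_words[of "h # graph_words L1" L2 "[]"]
  unfolding x g2_def by simp_all

lemma table_runs:
  assumes "2 \<le> p"
  shows "table_run w x X K p 1 L1" "table_run w x X K p g2 L2"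
proof -
  show "table_run w x X K p 1 L1"
    by unfold_locales (use B2_less(1) assms graphs(1) nbs1 cell_less in \<open>auto simp: N_def\<close>)
  show "table_run w x X K p g2 L2"
    by unfold_locales (use B2_less(1) assms graphs(2) nbs2 cell_less in \<open>auto simp: N_def\<close>)
qed

text \<open>Layer 0 is described for all rows, also beyond the vertices of either graph, so that one
  initialisation serves every run.\<close>

definition ready :: "mem \<Rightarrow> bool" where
  "ready s \<longleftrightarrow> s 3 = K \<and> s 4 = 2 ^ K \<and> s 5 = 2 ^ K * 2 ^ K \<and> s 6 = tries \<and> s 7 = modulus \<and> s 30 = g2 \<and>
     (\<forall>row l. l < 2 ^ K * 2 ^ K \<longrightarrow> s (cell K row 0 l) = (if row = 0 \<and> l = 0 then 1 else 0))"

abbreviation "outside \<equiv> {0, 8, 9, 10, 11, 12, 13, 14, 15, 16, 17, 18, 19, 20, 21, 22, 23, 24, 25, 26, 27, 28, 29, 31, 32} \<union>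
  {cell K row t l | row t l. 0 < t \<and> t \<le> K \<and> l < 2 ^ K * 2 ^ K}"

lemma ready_same:
  assumes "ready s" "same outside s s'"
  shows "ready s'"
proof -
  have "s' a = s a" if "a \<in> {3, 4, 5, 6, 7, 30}" for a
    using that by (intro sameD[OF assms(2)]) auto
  moreover have "s' (cell K row 0 l) = s (cell K row 0 l)" if "l < 2 ^ K * 2 ^ K" for row l
  proof (rule sameD[OF assms(2)])
    have "cell K row 0 l \<noteq> cell K row' t l'" if "0 < t" "t \<le> K" "l' < 2 ^ K * 2 ^ K" for row' t l'
      using cell_inj[of K row 0 l row' t l'] that \<open>l < 2 ^ K * 2 ^ K\<close> by auto
    then show "cell K row 0 l \<notin> outside" by auto
  qed
  ultimately show ?thesis using assms(1) unfolding ready_def by simp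
qed

lemma val_resultE:
  assumes "ready s"
  shows "val x s resultE_h = s (cell K 0 h (full K h))" "val x s resultE_K = s (cell K 0 K (full K K))"
proof -
  have st: "K - 1 = h" "(2 :: nat) ^ K div 2 = 2 ^ h" "s 3 = K" "s 4 = 2 ^ K" "s 5 = 2 ^ K * 2 ^ K"
    using assms unfolding ready_def by simp_all
  show "val x s resultE_h = s (cell K 0 h (full K h))" "val x s resultE_K = s (cell K 0 K (full K K))"
    by (simp_all only: resultE_def val.simps st cell_def full_def mult_0 add_0)
qed

lemma resultE_simps:
  "leaves (resultE t m) = leaves t + leaves m + 5"
  "consts_below 100 (resultE t m) \<longleftrightarrow> consts_below 100 t \<and> consts_below 100 m"
  "cost (resultE t m) = cost t + cost m + 14"
  by (simp_all add: resultE_def)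

abbreviation "fill_cost m \<equiv> 1400 * ((K + 1) * ((2 ^ K * 2 ^ K + 1) * ((m + 1) * cube (K + 1))))"

abbreviation "filled weight p r s s' \<equiv> same outside s s' \<and> s' 0 = s 0 \<and> s' 8 = p \<and> s' 9 = r \<and>
  s' 28 = s 28 \<and> s' 29 = s 29 \<and> s' 31 = s 31 \<and>
  (\<forall>t\<in>{h, K}. int (s' (cell K 0 t (full K t))) = weight r t mod int p)"

lemma wp_fill:
  assumes s: "ready s" "s 8 = p" "s 9 = r" and p: "2 \<le> p"
  shows "s 10 = 1 \<Longrightarrow> wp fill_table (\<lambda>s'. filled weight1 p r s s') (fill_cost (length L1)) s"
    and "s 10 = g2 \<Longrightarrow> wp fill_table (\<lambda>s'. filled weight2 p r s s') (fill_cost (length L2)) s"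
proof -
  have gen: "wp fill_table (\<lambda>s'. same outside s s' \<and> s' 0 = s 0 \<and> s' 8 = p \<and> s' 9 = r \<and> s' 28 = s 28 \<and> s' 29 = s 29 \<and> s' 31 = s 31 \<and>
      (\<forall>t\<in>{h, K}. int (s' (cell K 0 t (full K t))) =
         table (bit r) (\<lambda>v. take K (L ! v)) (length L) K t 0 (full K t) mod int p)) (fill_cost (length L)) s"
    if run: "table_run w x X K p g L" and g: "s 10 = g" for g L
  proof -
    interpret table_run w x X K p g r L by (rule run)
    have "correct s row 0 l" if "l < Q" for row l
    proof -
      have "s (cell K row 0 l) = (if row = 0 \<and> l = 0 then 1 else 0)" using s(1) that unfolding ready_def by blast
      moreover have "tab 0 row l = (if row = 0 \<and> l = 0 then 1 else 0)" by (rule table_0[OF that])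
      ultimately show ?thesis using p unfolding correct_def by simp
    qed
    then have "wp fill_table (\<lambda>s'. same (M \<union> {11, 12, 13, 14, 32} \<union> {cell K row t l |row t l. 0 < t \<and> t \<le> K \<and> l < Q}) s s' \<and>
      (\<forall>t\<le>K. \<forall>row\<le>n. \<forall>l<Q. correct s' row t l)) (fill_cost (length L)) s"
      using s g by (intro wp_fill_table) (auto simp: ready_def)
    then show ?thesis
    proof (rule wp_mono)
      fix s' assume s': "same (M \<union> {11, 12, 13, 14, 32} \<union> {cell K row t l |row t l. 0 < t \<and> t \<le> K \<and> l < Q}) s s' \<and>
        (\<forall>t\<le>K. \<forall>row\<le>n. \<forall>l<Q. correct s' row t l)"
      have "s' a = s a" if "a \<in> {0, 8, 9, 28, 29, 31}" for a
        using that by (intro sameD[OF conjunct1[OF s']]) auto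
      moreover have "same outside s s'" using conjunct1[OF s'] unfolding same_def by auto
      moreover have "int (s' (cell K 0 t (full K t))) = tab t 0 (full K t) mod int p" if "t \<in> {h, K}" for t
      proof -
        have "t \<le> K" using that by auto
        then show ?thesis using conjunct2[OF s'] full_less[of t K] unfolding correct_def by blast
      qed
      ultimately show "same outside s s' \<and> s' 0 = s 0 \<and> s' 8 = p \<and> s' 9 = r \<and> s' 28 = s 28 \<and> s' 29 = s 29 \<and> s' 31 = s 31 \<and>
        (\<forall>t\<in>{h, K}. int (s' (cell K 0 t (full K t))) = tab t 0 (full K t) mod int p)"
        using s by simp
    qed simp
  qed
  show "s 10 = 1 \<Longrightarrow> wp fill_table (\<lambda>s'. filled weight1 p r s s') (fill_cost (length L1)) s"
    unfolding weight1_def by (rule gen[OF table_runs(1)[OF p]])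
  show "s 10 = g2 \<Longrightarrow> wp fill_table (\<lambda>s'. filled weight2 p r s s') (fill_cost (length L2)) s"
    unfolding weight2_def by (rule gen[OF table_runs(2)[OF p]])
qed

lemma wp_pattern_body:
  assumes s: "ready s" "s 8 = p" "s 9 = r" and p: "2 \<le> p"
  shows "wp pattern_body (\<lambda>s'. ready s' \<and> s' 8 = p \<and> s' 9 = r \<and> s' 31 = s 31 \<and> s' 0 = (if hit p r then 1 else s 0))
    (fill_cost (length L1) + fill_cost (length L2) + 200) s"
proof -
  let ?hK = "\<lambda>val s'. \<forall>t\<in>{h, K}. int (s' (cell K 0 t (full K t))) = val r t mod int p"
  define Post where "Post s' \<longleftrightarrow> ready s' \<and> s' 8 = p \<and> s' 9 = r \<and> s' 31 = s 31 \<and> s' 0 = (if hit p r then 1 else s 0)" for s'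
  define Q3 where "Q3 u \<longleftrightarrow> ready u \<and> u 8 = p \<and> u 9 = r \<and> u 31 = s 31 \<and> u 0 = s 0 \<and>
    int (u 28) = weight1 r h mod int p \<and> int (u 29) = weight1 r K mod int p \<and> ?hK weight2 u" for u
  have ready_upd: "ready (u(a := v)) = ready u" if "a \<in> {0, 8, 9, 10, 28, 29, 31}" for u a v
  proof
    have "same outside u (u(a := v))" "same outside (u(a := v)) u" using that unfolding same_def by auto
    then show "ready u \<Longrightarrow> ready (u(a := v))" "ready (u(a := v)) \<Longrightarrow> ready u" using ready_same by blast+
  qed
  have check: "wp check_results Post 80 u"
    if u: "Q3 u" for u
  proof -
    have r: "ready u" and u28: "int (u 28) = weight1 r h mod int p" and u29: "int (u 29) = weight1 r K mod int p"
      and u2: "?hK weight2 u" and rest: "u 8 = p" "u 9 = r" "u 31 = s 31" "u 0 = s 0"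
      using u unfolding Q3_def by blast+
    have "int (u (cell K 0 h (full K h))) = weight2 r h mod int p" "int (u (cell K 0 K (full K K))) = weight2 r K mod int p"
      using u2 by auto
    note zero = u28 u29 this
    have "hit p r \<longleftrightarrow> weight1 r h mod int p \<noteq> 0 \<and> weight2 r h mod int p \<noteq> 0 \<or>
        weight1 r K mod int p \<noteq> 0 \<and> weight2 r K mod int p \<noteq> 0"
      unfolding hit_def by simp
    then have cond: "val x u (Add (Mul (V 28) resultE_h) (Mul (V 29) resultE_K)) \<noteq> 0 \<longleftrightarrow> hit p r"
      unfolding val.simps(4,6) val_resultE[OF r] zero[symmetric] by simp
    show ?thesis
    proof (rule wp_time[OF wp_Cond[where T = 10]])
      assume "val x u (Add (Mul (V 28) resultE_h) (Mul (V 29) resultE_K)) \<noteq> 0"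
      then have "hit p r" using cond by blast
      then have "Post (u(0 := 1))" unfolding Post_def using r rest by (simp add: ready_upd)
      then show "wp (Store (Const 0) (Const 1)) Post 10 u"
        using X_ge by (intro wp_time[OF wp_Store]) (auto simp: ok_def)
    next
      assume "val x u (Add (Mul (V 28) resultE_h) (Mul (V 29) resultE_K)) = 0"
      then have "\<not> hit p r" using cond by blast
      then have "Post u" unfolding Post_def using r rest by simp
      then show "wp Skip Post 10 u" by (intro wp_time[OF wp_Skip]) simp_all
    qed (simp_all add: ok_def resultE_simps)
  qed
  let ?c = check_results
  define P3 where "P3 u \<longleftrightarrow> ready u \<and> u 8 = p \<and> u 9 = r \<and> u 31 = s 31 \<and> u 0 = s 0 \<and>
    int (u 28) = weight1 r h mod int p \<and> int (u 29) = weight1 r K mod int p \<and> u 10 = g2" for u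
  have second: "wp (Seq fill_table ?c) Post (fill_cost (length L2) + 80) u" if u: "P3 u" for u
  proof (rule wp_Seq, rule wp_mono[OF wp_fill(2)])
    show "ready u" "u 8 = p" "u 9 = r" "u 10 = g2" "2 \<le> p" using u p unfolding P3_def by blast+
    fix s' assume s': "filled weight2 p r u s'"
    then have "ready s'" using ready_same u unfolding P3_def by blast
    then have "Q3 s'" unfolding Q3_def using s' u unfolding P3_def by simp
    then show "wp ?c Post 80 s'" by (rule check)
  qed simp
  define Q1 where "Q1 u \<longleftrightarrow> ready u \<and> u 8 = p \<and> u 9 = r \<and> u 31 = s 31 \<and> u 0 = s 0 \<and> ?hK weight1 u" for u
  let ?rest = "Seq (Store (Const 28) resultE_h) (Seq (Store (Const 29) resultE_K)
     (Seq (Store (Const 10) (V 30)) (Seq fill_table ?c)))"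
  have mid: "wp ?rest Post (fill_cost (length L2) + 80 + 80) u" if u: "Q1 u" for u
  proof (rule wp_bounded)
    assume bu: "\<And>a. u a < X"
    have r: "ready u" and rest: "u 8 = p" "u 9 = r" "u 31 = s 31" "u 0 = s 0" and hK: "?hK weight1 u"
      using u unfolding Q1_def by blast+
    let ?a = "u (cell K 0 h (full K h))" and ?b = "u (cell K 0 K (full K K))"
    have v1: "val x u resultE_h = ?a" by (rule val_resultE(1)[OF r])
    have r2: "ready (u(28 := ?a))" using r ready_upd by simp
    have v2: "val x (u(28 := ?a)) resultE_K = ?b" unfolding val_resultE(2)[OF r2] by simp
    have v3: "val x (u(28 := ?a, 29 := ?b)) (V 30) = g2" using r unfolding ready_def by simp
    have "P3 (u(28 := ?a, 29 := ?b, 10 := g2))"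
      unfolding P3_def using r rest hK by (simp add: ready_upd)
    then have w: "wp (Seq fill_table ?c) Post (fill_cost (length L2) + 80) (u(28 := ?a, 29 := ?b, 10 := g2))" by (rule second)
    have gX: "g2 < X" using bu[of 30] r unfolding ready_def by simp
    have w3: "wp (Seq (Store (Const 10) (V 30)) (Seq fill_table ?c)) Post (cost (Const 10) + cost (V 30) + 1 + (fill_cost (length L2) + 80)) (u(28 := ?a, 29 := ?b))"
      by (rule wp_Seq, rule wp_Store, unfold v3 val.simps(1)) (use w gX in \<open>simp_all add: ok_def\<close>)
    have w2: "wp (Seq (Store (Const 29) resultE_K) (Seq (Store (Const 10) (V 30)) (Seq fill_table ?c))) Post
        (cost (Const 29) + cost resultE_K + 1 + (cost (Const 10) + cost (V 30) + 1 + (fill_cost (length L2) + 80))) (u(28 := ?a))"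
      by (rule wp_Seq, rule wp_Store, unfold v2 val.simps(1)) (use w3 bu in \<open>simp_all add: ok_def resultE_simps\<close>)
    have "wp ?rest Post (cost (Const 28) + cost resultE_h + 1 + (cost (Const 29) + cost resultE_K + 1 +
        (cost (Const 10) + cost (V 30) + 1 + (fill_cost (length L2) + 80)))) u"
      by (rule wp_Seq, rule wp_Store, unfold v1 val.simps(1)) (use w2 bu in \<open>simp_all add: ok_def resultE_simps\<close>)
    then show "wp ?rest Post (fill_cost (length L2) + 80 + 80) u"
      by (rule wp_time) (simp add: resultE_simps)
  qed
  let ?s = "s(10 := 1)"
  have first: "wp (Seq fill_table ?rest) Post (fill_cost (length L1) + (fill_cost (length L2) + 80 + 80)) ?s"
  proof (rule wp_Seq, rule wp_mono[OF wp_fill(1)])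
    show "ready ?s" using s ready_upd by simp
    show "?s 8 = p" "?s 9 = r" "?s 10 = 1" "2 \<le> p" using s p by simp_all
    fix s' assume s': "filled weight1 p r ?s s'"
    then have "ready s'" using ready_same \<open>ready ?s\<close> by blast
    then have "Q1 s'" unfolding Q1_def using s' by simp
    then show "wp ?rest Post (fill_cost (length L2) + 80 + 80) s'" by (rule mid)
  qed simp
  have "wp pattern_body Post (cost (Const 10) + cost (Const 1) + 1 + (fill_cost (length L1) + (fill_cost (length L2) + 80 + 80))) s"
    unfolding pattern_body_def
    by (rule wp_Seq, rule wp_Store) (use first X_ge in \<open>simp_all add: ok_def\<close>)
  then show ?thesis unfolding Post_def by (rule wp_time) simp
qed

end

context mcsf_run
begin

abbreviation "pattern_cost \<equiv> fill_cost (length L1) + fill_cost (length L2) + 200"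
abbreviation "modulus_cost \<equiv> (2 ^ K + 1) * (pattern_cost + 15) + 10"
abbreviation "total_cost \<equiv> 40 * (K + 1) + 200 + (tries + 2) * (modulus_cost + 20)"

lemma ready_upd:
  assumes "ready u" "a \<in> {0, 8, 9, 31}"
  shows "ready (u(a := v))"
proof (rule ready_same[OF assms(1)])
  show "same outside u (u(a := v))" using assms(2) unfolding same_def by auto
qed

lemma wp_modulus_body:
  assumes s: "ready s" "s 31 = i" and i: "i \<le> tries"
  shows "wp modulus_body (\<lambda>s'. ready s' \<and> s' 31 = i \<and> s' 0 = (if \<exists>r<2 ^ K. hit (modulus + i) r then 1 else s 0))
    modulus_cost s"
proof -
  let ?p = "modulus + i"
  define I where "I k u \<longleftrightarrow> ready u \<and> u 8 = ?p \<and> u 31 = i \<and> u 0 = (if \<exists>r<k. hit ?p r then 1 else s 0)" for k u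
  let ?Post = "\<lambda>s'. ready s' \<and> s' 31 = i \<and> s' 0 = (if \<exists>r<2 ^ K. hit ?p r then 1 else s 0)"
  have p: "2 \<le> ?p" using modulus_ge by simp
  have loop: "wp (For 9 (V 4) pattern_body) ?Post ((2 ^ K + 1) * (pattern_cost + cost (V 4) + 13)) (s(8 := ?p))"
  proof (rule wp_For[where I = I])
    have "ready (s(8 := ?p, 9 := 0))" using s by (intro ready_upd) simp_all
    then show "I 0 (s(8 := ?p, 9 := 0))" unfolding I_def using s by simp
    show "val x u (V 4) = 2 ^ K" if "I k u" for k u using that unfolding I_def ready_def by simp
    show "2 ^ K < X" using B2_less(2) unfolding B_def .
    show "?Post u" if "I (2 ^ K) u" for u using that unfolding I_def by blast
    fix k u assume Iu: "I k u" and uk: "u 9 = k"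
    have u: "ready u" "u 8 = ?p" "u 31 = i" "u 0 = (if \<exists>r<k. hit ?p r then 1 else s 0)" using Iu unfolding I_def by blast+
    show "wp pattern_body (\<lambda>s'. s' 9 = k \<and> I (Suc k) (s'(9 := Suc k))) pattern_cost u"
    proof (rule wp_mono[OF wp_pattern_body[OF u(1,2) uk p] order_refl])
      fix s' assume s': "ready s' \<and> s' 8 = ?p \<and> s' 9 = k \<and> s' 31 = u 31 \<and> s' 0 = (if hit ?p k then 1 else u 0)"
      have "ready (s'(9 := Suc k))" using s' by (intro ready_upd) simp_all
      moreover have "s' 0 = (if \<exists>r<Suc k. hit ?p r then 1 else s 0)"
      proof -
        have e: "s' 0 = (if hit ?p k then 1 else u 0)" using s' by blast
        have eq: "(\<exists>r<Suc k. hit ?p r) \<longleftrightarrow> hit ?p k \<or> (\<exists>r<k. hit ?p r)" by (auto simp: less_Suc_eq)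
        show ?thesis unfolding e u(4) eq by auto
      qed
      ultimately show "s' 9 = k \<and> I (Suc k) (s'(9 := Suc k))" using s' u(3) unfolding I_def by simp
    qed
  qed simp_all
  have val: "val x s (Add (V 7) (V 31)) = ?p" using s unfolding ready_def by simp
  have pX: "?p < X" using modulus_tries_less(1) i by linarith
  have "wp modulus_body ?Post (cost (Const 8) + cost (Add (V 7) (V 31)) + 1 + (2 ^ K + 1) * (pattern_cost + cost (V 4) + 13)) s"
    unfolding modulus_body_def
    by (rule wp_Seq, rule wp_Store, unfold val val.simps(1), rule loop) (use pX in \<open>simp_all add: ok_def\<close>)
  then show ?thesis
  proof (rule wp_time)
    have c: "cost (V 4) = 2" "cost (Const 8) + cost (Add (V 7) (V 31)) + 1 = 7" by simp_all
    have le: "7 + a * (b + 2 + 13) \<le> a * (b + 15) + 10" for a b :: nat by (simp add: algebra_simps)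
    show "cost (Const 8) + cost (Add (V 7) (V 31)) + 1 + (2 ^ K + 1) * (pattern_cost + cost (V 4) + 13) \<le> modulus_cost"
      unfolding c by (rule le)
  qed
qed

lemma wp_setup_constants:
  "wp setup_constants (\<lambda>s. ready s \<and> s 0 = 0) (40 * (K + 1) + 180) (\<lambda>_. 0)"
proof -
  let ?Post = "\<lambda>s. ready s \<and> s 0 = 0"
  let ?c5 = "Store (Const 5) (Mul (V 4) (V 4))"
  let ?c6 = "Store (Const 6) (Mul (Const 26) (Mul (V 3) (V 3)))"
  let ?c30 = "Store (Const 30) (Add (Add (Inp (Const 1)) (Const 3)) (Inp (Add (Inp (Const 1)) (Const 2))))"
  let ?c7 = "Store (Const 7) (Mul (Add (Add (Inp (Const 1)) (Inp (V 30))) (Const 2)) (Mul (V 6) (V 6)))"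
  let ?c50 = "Store (Const 50) (Const 1)"
  have inp0: "inp x 0 = h" unfolding x inp_def by simp
  have inp1: "inp x 1 = length L1" using graphs(1) unfolding graph_at_def by blast
  have inp2: "inp x g2 = length L2" using graphs(2) unfolding graph_at_def by blast
  have "inp x (1 + 1 + length L1) = length (concat (take (length L1) L1))"
    using graphs(1) unfolding graph_at_def by blast
  then have inp3: "length L1 + 3 + inp x (length L1 + 2) = g2"
    unfolding g2_def length_graph_words by simp
  have rest: "wp (Seq ?c5 (Seq ?c6 (Seq ?c30 (Seq ?c7 ?c50)))) ?Post 100 u"
    if u: "u 3 = K" "u 4 = 2 ^ K" "\<And>a. a \<notin> {3, 4, 22} \<Longrightarrow> u a = 0" for u
  proof -
    let ?u5 = "u(5 := 2 ^ K * 2 ^ K)"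
    let ?u6 = "?u5(6 := tries)"
    let ?u30 = "?u6(30 := g2)"
    let ?u7 = "?u30(7 := modulus)"
    have v5: "val x u (Mul (V 4) (V 4)) = 2 ^ K * 2 ^ K" using u by simp
    have v6: "val x ?u5 (Mul (Const 26) (Mul (V 3) (V 3))) = tries" using u by (simp add: tries_def)
    have v30: "val x ?u6 (Add (Add (Inp (Const 1)) (Const 3)) (Inp (Add (Inp (Const 1)) (Const 2)))) = g2"
      using inp1 inp3 by (simp add: val_Inp del: val.simps(3))
    have v7: "val x ?u30 (Mul (Add (Add (Inp (Const 1)) (Inp (V 30))) (Const 2)) (Mul (V 6) (V 6))) = modulus"
      using inp1 inp2 by (simp add: val_Inp modulus_def N_def del: val.simps(3))
    have "?Post (?u7(50 := 1))"
    proof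
      have "(?u7(50 := 1)) (cell K row 0 l) = (if row = 0 \<and> l = 0 then 1 else 0)" if l: "l < 2 ^ K * 2 ^ K" for row l
      proof (cases "row = 0 \<and> l = 0")
        case True
        then have "cell K row 0 l = 50" by (simp add: cell_def)
        then show ?thesis using True by simp
      next
        case False
        have "cell K 0 0 0 = 50" by (simp add: cell_def)
        then have "cell K row 0 l \<noteq> 50" using cell_inj[of K row 0 l 0 0 0] l False by auto
        moreover have "u (cell K row 0 l) = 0" by (rule u(3)) simp
        ultimately show ?thesis using False by simp
      qed
      then show "ready (?u7(50 := 1))" unfolding ready_def using u by simp
      show "(?u7(50 := 1)) 0 = 0" using u(3) by simp
    qed
    then have w50: "wp ?c50 ?Post 10 ?u7"
      using X_ge by (intro wp_time[OF wp_Store]) (auto simp: ok_def)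
    have gX: "g2 < X" using words unfolding g2_def .
    have w7: "wp (Seq ?c7 ?c50) ?Post (20 + 10) ?u30"
      by (rule wp_time, rule wp_Seq, rule wp_Store, unfold v7 val.simps(1), rule w50)
        (use modulus_tries_less in \<open>auto simp: ok_def\<close>)
    have w30: "wp (Seq ?c30 (Seq ?c7 ?c50)) ?Post (20 + (20 + 10)) ?u6"
      by (rule wp_time, rule wp_Seq, rule wp_Store, unfold v30 val.simps(1), rule w7)
        (use gX in \<open>auto simp: ok_def\<close>)
    have w6: "wp (Seq ?c6 (Seq ?c30 (Seq ?c7 ?c50))) ?Post (20 + (20 + (20 + 10))) ?u5"
      by (rule wp_time, rule wp_Seq, rule wp_Store, unfold v6 val.simps(1), rule w30)
        (use modulus_tries_less in \<open>auto simp: ok_def\<close>)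
    show ?thesis
      by (rule wp_time, rule wp_Seq, rule wp_Store, unfold v5 val.simps(1), rule w6)
        (use B2_less in \<open>auto simp: ok_def\<close>)
  qed
  let ?s = "(\<lambda>_. 0)(3 := K, 4 := 1) :: mem"
  let ?rest = "Seq ?c5 (Seq ?c6 (Seq ?c30 (Seq ?c7 ?c50)))"
  define I where "I k u \<longleftrightarrow> same {4, 22} ?s u \<and> u 4 = 2 ^ k" for k u
  have KX: "K < X" using K_less_B B2_less(2) by linarith
  have "wp (For 22 (V 3) (Store (Const 4) (Mul (V 4) (Const 2)))) (\<lambda>u. wp ?rest ?Post 100 u) ((K + 1) * (20 + cost (V 3) + 13)) ?s"
  proof (rule wp_For[where I = I])
    show "I 0 (?s(22 := 0))" unfolding I_def same_def by simp
    show "val x u (V 3) = K" if "I k u" for k u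
      using that unfolding I_def same_def by simp
    show "K < X" by (rule KX)
    show "wp ?rest ?Post 100 u" if "I K u" for u
      using that by (intro rest) (auto simp: I_def same_def)
    fix k u assume k: "k < K" and Iu: "I k u" and uk: "u 22 = k"
    have val: "val x u (Mul (V 4) (Const 2)) = 2 ^ Suc k" using Iu unfolding I_def by simp
    have "(2 :: nat) ^ Suc k \<le> 2 ^ K" using k by (intro power_increasing) auto
    then have lt: "2 ^ Suc k < X" using B2_less(2) unfolding B_def by linarith
    have "I (Suc k) (u(4 := 2 ^ Suc k, 22 := Suc k))" using Iu unfolding I_def same_def by auto
    then have "(\<lambda>s'. s' 22 = k \<and> I (Suc k) (s'(22 := Suc k))) (u(4 := 2 ^ Suc k))" using uk by simp
    then show "wp (Store (Const 4) (Mul (V 4) (Const 2))) (\<lambda>s'. s' 22 = k \<and> I (Suc k) (s'(22 := Suc k))) 20 u"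
      by (intro wp_time[OF wp_Store], unfold val val.simps(1)) (use lt in \<open>auto simp: ok_def\<close>)
  qed simp_all
  then have w: "wp (Seq (For 22 (V 3) (Store (Const 4) (Mul (V 4) (Const 2)))) ?rest) ?Post ((K + 1) * (20 + cost (V 3) + 13) + 100) ?s"
    by (rule wp_Seq)
  let ?s3 = "(\<lambda>_. 0)(3 := K) :: mem"
  have v3: "val x (\<lambda>_. 0) (Add (Inp (Const 0)) (Const 1)) = K"
    using inp0 by (simp add: val_Inp del: val.simps(3))
  have w4: "wp (Seq (Store (Const 4) (Const 1)) (Seq (For 22 (V 3) (Store (Const 4) (Mul (V 4) (Const 2)))) ?rest)) ?Post
    (cost (Const 4) + cost (Const 1) + 1 + ((K + 1) * (20 + cost (V 3) + 13) + 100)) ?s3"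
    by (rule wp_Seq, rule wp_Store, unfold val.simps(1), rule w) (use X_ge in \<open>auto simp: ok_def\<close>)
  have "wp setup_constants ?Post (cost (Const 3) + cost (Add (Inp (Const 0)) (Const 1)) + 1 +
    (cost (Const 4) + cost (Const 1) + 1 + ((K + 1) * (20 + cost (V 3) + 13) + 100))) (\<lambda>_. 0)"
    unfolding setup_constants_def
    by (rule wp_Seq, rule wp_Store, unfold v3 val.simps(1), rule w4) (use KX in \<open>auto simp: ok_def\<close>)
  then show ?thesis by (rule wp_time) simp
qed

lemma wp_mcsf_program:
  "wp mcsf_program (\<lambda>s. s 0 = (if \<exists>i\<le>tries. \<exists>r<2 ^ K. hit (modulus + i) r then 1 else 0)) total_cost (\<lambda>_. 0)"
proof -
  define H where "H i \<longleftrightarrow> (\<exists>r<2 ^ K. hit (modulus + i) r)" for i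
  define I where "I k u \<longleftrightarrow> ready u \<and> u 0 = (if \<exists>i<k. H i then 1 else 0)" for k u
  let ?Post = "\<lambda>s. s 0 = (if \<exists>i\<le>tries. H i then 1 else 0)"
  have loop: "wp (For 31 (Add (V 6) (Const 1)) modulus_body) ?Post
    ((tries + 1 + 1) * (modulus_cost + cost (Add (V 6) (Const 1)) + 13)) s" if s: "ready s" "s 0 = 0" for s
  proof (rule wp_For[where I = I])
    have "ready (s(31 := 0))" using s by (intro ready_upd) simp_all
    then show "I 0 (s(31 := 0))" unfolding I_def using s by simp
    show "val x u (Add (V 6) (Const 1)) = tries + 1" if "I k u" for k u using that unfolding I_def ready_def by simp
    show "tries + 1 < X" by (rule modulus_tries_less(2))
    show "?Post u" if "I (tries + 1) u" for u
      using that unfolding I_def by (simp only: less_Suc_eq_le Suc_eq_plus1[symmetric])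
    fix k u assume k: "k < tries + 1" and Iu: "I k u" and uk: "u 31 = k"
    have u: "ready u" "u 0 = (if \<exists>i<k. H i then 1 else 0)" using Iu unfolding I_def by blast+
    have "k \<le> tries" using k by simp
    show "wp modulus_body (\<lambda>s'. s' 31 = k \<and> I (Suc k) (s'(31 := Suc k))) modulus_cost u"
    proof (rule wp_mono[OF wp_modulus_body[OF u(1) uk \<open>k \<le> tries\<close>] order_refl])
      fix s' assume "ready s' \<and> s' 31 = k \<and> s' 0 = (if \<exists>r<2 ^ K. hit (modulus + k) r then 1 else u 0)"
      then have s': "ready s'" "s' 31 = k" "s' 0 = (if H k then 1 else u 0)" unfolding H_def by blast+
      have "ready (s'(31 := Suc k))" using s' by (intro ready_upd) simp_all
      moreover have "(\<exists>i<Suc k. H i) \<longleftrightarrow> H k \<or> (\<exists>i<k. H i)" by (auto simp: less_Suc_eq)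
      then have "s' 0 = (if \<exists>i<Suc k. H i then 1 else 0)" using s'(3) u(2) by simp
      ultimately show "s' 31 = k \<and> I (Suc k) (s'(31 := Suc k))" using s'(2) unfolding I_def by simp
    qed
  qed simp_all
  have "wp mcsf_program ?Post ((40 * (K + 1) + 180) + ((tries + 1 + 1) * (modulus_cost + cost (Add (V 6) (Const 1)) + 13))) (\<lambda>_. 0)"
    unfolding mcsf_program_def
    by (rule wp_Seq, rule wp_mono[OF wp_setup_constants order_refl], rule loop) blast+
  then have "wp mcsf_program ?Post total_cost (\<lambda>_. 0)"
  proof (rule wp_time)
    have c: "modulus_cost + cost (Add (V 6) (Const 1)) + 13 \<le> modulus_cost + 20" by simp
    have t: "tries + 1 + 1 = tries + 2" by simp
    show "(40 * (K + 1) + 180) + ((tries + 1 + 1) * (modulus_cost + cost (Add (V 6) (Const 1)) + 13)) \<le> total_cost"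
      unfolding t by (intro add_mono mult_le_mono2 c) simp_all
  qed
  then show ?thesis unfolding H_def .
qed

section \<open>Residues against true weights, and the total running time\<close>

lemma weight_bounds:
  assumes "t \<in> {h, K}"
  shows "0 \<le> weight1 r t" "0 \<le> weight2 r t"
    "weight1 r t \<le> int (modulus ^ (2 * K * K + 4 * K))" "weight2 r t \<le> int (modulus ^ (2 * K * K + 4 * K))"
proof -
  have t: "t \<le> K" using assms by auto
  show "0 \<le> weight1 r t" "0 \<le> weight2 r t"
    unfolding weight1_def weight2_def by (intro table_full_nonneg t)+
  \<comment> \<open>The modulus is at least \<open>K\<close> and both numbers of vertices, so it can
    play the role of \<open>m\<close> in \<open>table_full_le\<close>. This yields a bound by a
    power of the modulus, as \<open>exists_nondivisor\<close> needs it.\<close>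
  have "1 * (1 * K) \<le> 26 * (K * K)" by (intro mult_le_mono) simp_all
  then have k: "K \<le> tries" unfolding tries_def by (simp only: mult_1)
  have one: "1 \<le> tries" unfolding tries_def by simp
  have "1 * 1 \<le> tries * tries" "K * 1 \<le> tries * tries"
    using mult_le_mono[OF one one] mult_le_mono[OF k one] by blast+
  then have tK: "K \<le> tries * tries" "1 \<le> tries * tries" by simp_all
  have "N * 1 \<le> modulus" unfolding modulus_def using tK(2) by (rule mult_le_mono2)
  then have N: "N \<le> modulus" by simp
  have "1 * K \<le> modulus" unfolding modulus_def using N_ge tK(1) by (intro mult_le_mono) auto
  then have KM: "K \<le> modulus" by simp
  have n: "length L1 \<le> modulus" "length L2 \<le> modulus" using N unfolding N_def by simp_all
  show "weight1 r t \<le> int (modulus ^ (2 * K * K + 4 * K))"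
    unfolding weight1_def
    by (rule table_full_le) (use n KM t modulus_ge nbs1 in \<open>auto dest: in_set_takeD\<close>)
  show "weight2 r t \<le> int (modulus ^ (2 * K * K + 4 * K))"
    unfolding weight2_def
    by (rule table_full_le) (use n KM t modulus_ge nbs2 in \<open>auto dest: in_set_takeD\<close>)
qed

text \<open>A non-zero residue comes from a non-zero weight, so there are no false positives. For
  the converse a single modulus has to work for both graphs: it is chosen not to divide the product
  of the two weights, and therefore divides neither.\<close>

lemma hit_iff:
  "(\<exists>i\<le>tries. \<exists>r<2 ^ K. hit (modulus + i) r) \<longleftrightarrow>
   (\<exists>r<2 ^ K. \<exists>t\<in>{h, K}. 0 < weight1 r t \<and> 0 < weight2 r t)"
proof
  assume "\<exists>i\<le>tries. \<exists>r<2 ^ K. hit (modulus + i) r"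
  then obtain i r where r: "r < 2 ^ K" "hit (modulus + i) r" by blast
  then obtain t where t: "t \<in> {h, K}" "weight1 r t mod int (modulus + i) \<noteq> 0" "weight2 r t mod int (modulus + i) \<noteq> 0"
    unfolding hit_def by blast
  have "weight1 r t \<noteq> 0" "weight2 r t \<noteq> 0" using t(2,3) by (auto simp only: mod_0)
  then have "0 < weight1 r t" "0 < weight2 r t" using weight_bounds(1,2)[OF t(1), of r] by linarith+
  then show "\<exists>r<2 ^ K. \<exists>t\<in>{h, K}. 0 < weight1 r t \<and> 0 < weight2 r t" using r(1) t(1) by blast
next
  assume "\<exists>r<2 ^ K. \<exists>t\<in>{h, K}. 0 < weight1 r t \<and> 0 < weight2 r t"
  then obtain r t where rt: "r < 2 ^ K" "t \<in> {h, K}" and pos: "0 < weight1 r t" "0 < weight2 r t" by blast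
  let ?E = "2 * K * K + 4 * K"
  obtain a b where a: "weight1 r t = int a" and b: "weight2 r t = int b"
    using pos by (metis zero_le_imp_eq_int order_less_imp_le)
  have ab: "0 < a" "0 < b" "a \<le> modulus ^ ?E" "b \<le> modulus ^ ?E"
    using pos weight_bounds(3,4)[OF rt(2), of r] unfolding a b by (simp_all only: of_nat_0_less_iff of_nat_le_iff)
  have "a * b \<le> modulus ^ ?E * modulus ^ ?E" using ab by (intro mult_le_mono)
  also have "\<dots> = modulus ^ (?E + ?E)" by (rule power_add[symmetric])
  also have "\<dots> < modulus ^ (?E + ?E + 1)" using modulus_ge by (intro power_strict_increasing) auto
  finally have lt: "a * b < modulus ^ (?E + ?E + 1)" .
  have "1 * K \<le> K * K" by (rule mult_le_mono1) simp
  then have e: "2 * (?E + ?E + 1) \<le> tries" unfolding tries_def by simp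
  have "1 * (tries * tries) \<le> modulus" unfolding modulus_def using N_ge by (intro mult_le_mono1) simp
  then have "tries * tries \<le> modulus" by simp
  then obtain i where i: "i \<le> tries" "\<not> (modulus + i) dvd a * b"
    using exists_nondivisor[of "a * b" modulus "?E + ?E + 1" tries] ab lt e by auto
  then have "\<not> (modulus + i) dvd a" "\<not> (modulus + i) dvd b" by auto
  then have "weight1 r t mod int (modulus + i) \<noteq> 0" "weight2 r t mod int (modulus + i) \<noteq> 0"
    unfolding a b by (metis dvd_eq_mod_eq_0 of_nat_dvd_iff)+
  then show "\<exists>i\<le>tries. \<exists>r<2 ^ K. hit (modulus + i) r" using i(1) rt unfolding hit_def by blast
qed

text \<open>The nine powers of \<open>B\<close>: one for the layers, two for the table indices and
  three for the cube of \<open>K + 1\<close> spent on an entry, one for the patterns, two for the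
  moduli.\<close>

lemma total_cost_le: "total_cost \<le> 2 ^ (9 * h + 30) * max 1 (length L1 + length L2)"
proof -
  have KB: "K + 1 \<le> B" using K_less_B by simp
  have B1: "1 \<le> B" using K_less_B by simp
  have N1: "1 \<le> N" using N_ge by simp
  have fill: "fill_cost m \<le> 2800 * (N * B ^ 6)" if "m + 1 \<le> N" for m
  proof -
    have Q: "2 ^ K * 2 ^ K + 1 \<le> 2 * (B * B)" using B1 unfolding B_def[symmetric] by simp
    have "(K + 1) * ((2 ^ K * 2 ^ K + 1) * ((m + 1) * cube (K + 1))) \<le> B * (2 * (B * B) * (N * (B * B * B)))"
      using that KB by (intro mult_le_mono Q)
    also have "\<dots> = 2 * (N * B ^ 6)" by (simp add: eval_nat_numeral algebra_simps)
    finally show ?thesis by simp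
  qed
  have pat: "pattern_cost + 15 \<le> 5815 * (N * B ^ 6)"
  proof -
    have "1 \<le> N * B ^ 6" using N1 B1 by simp
    then show ?thesis using fill[of "length L1"] fill[of "length L2"] unfolding N_def by linarith
  qed
  have "2 ^ K + 1 \<le> 2 * B" using B1 unfolding B_def[symmetric] by simp
  then have "(2 ^ K + 1) * (pattern_cost + 15) \<le> 2 * B * (5815 * (N * B ^ 6))" using pat by (rule mult_le_mono)
  also have "\<dots> = 11630 * (N * (B * B ^ 6))" by simp
  also have "B * B ^ 6 = B ^ 7" by (simp flip: power_Suc)
  finally have "(2 ^ K + 1) * (pattern_cost + 15) \<le> 11630 * (N * B ^ 7)" .
  moreover have "1 \<le> N * B ^ 7" using N1 B1 by simp
  ultimately have md: "modulus_cost + 20 \<le> 11660 * (N * B ^ 7)" by linarith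
  have "tries + 2 \<le> 28 * B ^ 2"
  proof -
    have "1 \<le> B ^ 2" using B1 by simp
    then show ?thesis using tries_le by simp
  qed
  then have "(tries + 2) * (modulus_cost + 20) \<le> 28 * B ^ 2 * (11660 * (N * B ^ 7))" using md by (rule mult_le_mono)
  also have "\<dots> = 326480 * (N * (B ^ 2 * B ^ 7))" by simp
  also have "B ^ 2 * B ^ 7 = B ^ 9" by (simp flip: power_add)
  finally have m: "(tries + 2) * (modulus_cost + 20) \<le> 326480 * (N * B ^ 9)" .
  have "B * 1 \<le> B ^ 9 * N" using B1 N1 by (intro mult_le_mono self_le_power) auto
  then have "B \<le> N * B ^ 9" by (simp add: mult.commute)
  have "40 * (K + 1) + 200 + a \<le> 326720 * b" if "a \<le> 326480 * b" "B \<le> b" for a b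
  proof -
    have "40 * (K + 1) \<le> 40 * B" using KB by (rule mult_le_mono2)
    moreover have "200 * 1 \<le> 200 * B" using B1 by (rule mult_le_mono2)
    ultimately show ?thesis using that by linarith
  qed
  from this[OF m \<open>B \<le> N * B ^ 9\<close>] have "total_cost \<le> 326720 * (N * B ^ 9)" .
  \<comment> \<open>\<open>N\<close> is the number of vertices plus 2, hence the factor 3; and
    \<open>3 * 326720\<close> is below \<open>2 ^ 20\<close>.\<close>
  also have "\<dots> \<le> 326720 * (3 * max 1 (length L1 + length L2) * B ^ 9)"
    by (intro mult_le_mono) (auto simp: N_def max_def)
  also have "\<dots> \<le> 2 ^ 20 * (max 1 (length L1 + length L2) * B ^ 9)" by simp
  also have "\<dots> = 2 ^ 20 * 2 ^ (9 * K) * max 1 (length L1 + length L2)"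
    unfolding B_def by (simp only: power_mult[symmetric] mult_ac)
  also have "(2 :: nat) ^ 20 * 2 ^ (9 * K) = 2 ^ (20 + 9 * K)" by (rule power_add[symmetric])
  also have "(2 :: nat) ^ (20 + 9 * K) * max 1 (length L1 + length L2) \<le> 2 ^ (9 * h + 30) * max 1 (length L1 + length L2)"
    by (intro mult_le_mono1 power_increasing) auto
  finally show ?thesis .
qed

end

section \<open>Time and word length\<close>

lemma adjacency_lists_facts:
  assumes "adjacency_lists G L"
  shows "length L = card (verts G)" "length (concat L) \<le> length L * length L"
    "\<And>y. y \<in> set (concat L) \<Longrightarrow> y < length L"
proof -
  obtain vs where vs: "distinct vs" "set vs = verts G" "length L = length vs"
    using assms unfolding adjacency_lists_def by (elim exE conjE) (rule that)
  show "length L = card (verts G)" using vs distinct_card[OF vs(1)] by simp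
  have len: "length l \<le> length L" if "l \<in> set L" for l
  proof -
    obtain u where u: "u < length L" "L ! u = l" using \<open>l \<in> set L\<close> by (metis in_set_conv_nth)
    have "length l = card (set l)" using adjacency_distinct(1)[OF assms u(1)] u(2) by (simp add: distinct_card)
    also have "\<dots> \<le> card {..<length L}"
      using adjacency_distinct(2)[OF assms u(1)] u(2) by (intro card_mono) auto
    finally show ?thesis by simp
  qed
  have "length (concat L) = (\<Sum>l\<leftarrow>L. length l)" by (rule length_concat)
  also have "\<dots> \<le> (\<Sum>l\<leftarrow>L. length L)" using len by (rule sum_list_mono)
  finally show "length (concat L) \<le> length L * length L" by (simp add: sum_list_triv)
  show "y < length L" if y: "y \<in> set (concat L)" for y
  proof -
    obtain l where l: "l \<in> set L" "y \<in> set l" using y by auto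
    obtain u where "u < length L" "L ! u = l" using l(1) by (metis in_set_conv_nth)
    then show ?thesis using adjacency_distinct(2)[OF assms] l(2) by blast
  qed
qed

lemma graph_words_le:
  assumes "length (concat L) \<le> length L * length L" "\<And>y. y \<in> set (concat L) \<Longrightarrow> y < length L" "v \<in> set (graph_words L)"
  shows "v \<le> length L * length L"
proof -
  have off: "length (concat (take i L)) \<le> length (concat L)" for i
  proof -
    have "concat L = concat (take i L) @ concat (drop i L)" by (metis append_take_drop_id concat_append)
    then show ?thesis by simp
  qed
  have "set (graph_words L) = insert (length L) ((\<lambda>i. length (concat (take i L))) ` {0..<Suc (length L)} \<union> set (concat L))"
    unfolding graph_words_def by (simp only: list.set set_append set_map set_upt)
  then have "v = length L \<or> (\<exists>i. v = length (concat (take i L))) \<or> v \<in> set (concat L)"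
    using assms(3) by blast
  then show ?thesis
  proof (elim disjE exE)
    assume "v \<in> set (concat L)"
    then have "v < length L" by (rule assms(2))
    then show ?thesis by (meson le_square less_imp_le order.trans)
  next
    fix i assume "v = length (concat (take i L))"
    then show ?thesis using off[of i] assms(1) by linarith
  qed (simp add: le_square)
qed

lemma mcsf_program_correct:
  assumes "mcsf_input (G1, G2, h) x"
  shows "\<exists>w t s. real w \<le> 400 * (real h + log 2 (real (num_verts (G1, G2, h) + 2))) \<and>
    t \<le> 2 ^ (9 * h + 30) * max 1 (num_verts (G1, G2, h)) \<and>
    exec w x mcsf_program (\<lambda>_. 0) t s \<and> s 0 = (if mcsf (G1, G2, h) then 1 else 0)"
proof -
  obtain L1 L2 where simple: "simple_graph G1" "simple_graph G2"
    and L: "adjacency_lists G1 L1" "adjacency_lists G2 L2"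
    and x: "x = h # graph_words L1 @ graph_words L2"
    using assms by auto
  note f1 = adjacency_lists_facts[OF L(1)] and f2 = adjacency_lists_facts[OF L(2)]
  define m where "m = length L1 + length L2 + 2"
  define X where "X = 1024 * m ^ 2 * (2 ^ Suc h) ^ 4"
  have nv: "num_verts (G1, G2, h) = length L1 + length L2" using f1(1) f2(1) by simp
  have m2: "2 \<le> m" unfolding m_def by simp
  define l where "l = nat \<lceil>log 2 (real m)\<rceil>"
  have logm: "1 \<le> log 2 (real m)" using m2 by (simp add: le_log_iff)
  have "real m = 2 powr log 2 (real m)" using m2 by simp
  also have "\<dots> \<le> 2 powr real l" unfolding l_def by (intro powr_mono) (auto simp: le_nat_iff real_nat_ceiling_ge)
  also have "\<dots> = real (2 ^ l)" by (simp add: powr_realpow)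
  finally have ml: "m \<le> 2 ^ l" by linarith
  \<comment> \<open>The second factor is the exponent of a power of two that is at least
    \<open>X\<close>; the 20 comes from the requirement on \<open>X ^ 20\<close>.\<close>
  define w where "w = 20 * (10 + 4 * Suc h + 2 * l)"
  have "X \<le> 2 ^ 10 * (2 ^ l) ^ 2 * (2 ^ Suc h) ^ 4"
    unfolding X_def using ml by (intro mult_le_mono power_mono) auto
  also have "\<dots> = 2 ^ (10 + 4 * Suc h + 2 * l)"
    by (simp only: power_mult[symmetric] power_add[symmetric]) (simp add: ac_simps)
  finally have "X ^ 20 \<le> (2 ^ (10 + 4 * Suc h + 2 * l)) ^ 20" by (rule power_mono) simp
  then have Xw: "X ^ 20 \<le> 2 ^ w" unfolding w_def by (simp only: power_mult[symmetric] mult.commute)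
  have sqX: "2 * m ^ 2 < X" and hX: "h < X" and X100: "100 \<le> X"
  proof -
    have m1: "1 \<le> m ^ 2" using m2 by simp
    have H1: "(1 :: nat) \<le> (2 ^ Suc h) ^ 4" by simp
    have "1024 * m ^ 2 * 1 \<le> X" unfolding X_def using H1 by (rule mult_le_mono2)
    then show "2 * m ^ 2 < X" "100 \<le> X" using m1 by linarith+
    have "h < 2 ^ Suc h" using less_exp[of "Suc h"] by simp
    also have "\<dots> \<le> (2 ^ Suc h) ^ 4" by (rule self_le_power) simp_all
    also have "\<dots> = 1 * (2 ^ Suc h) ^ 4" by simp
    also have "\<dots> \<le> X" unfolding X_def using m1 by (intro mult_le_mono1) simp
    finally show "h < X" .
  qed
  have sq: "length L1 * length L1 \<le> m ^ 2" "length L2 * length L2 \<le> m ^ 2"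
    unfolding power2_eq_square m_def by (intro mult_le_mono; simp)+
  interpret mcsf_run w x X h L1 L2
  proof
    fix v assume "v \<in> set x"
    then consider "v = h" | "v \<in> set (graph_words L1)" | "v \<in> set (graph_words L2)" unfolding x by auto
    then show "v < X"
    proof cases
      case 1
      then show ?thesis using hX by simp
    next
      case 2
      then show ?thesis using graph_words_le[OF f1(2,3)] sq(1) sqX by fastforce
    next
      case 3
      then show ?thesis using graph_words_le[OF f2(2,3)] sq(2) sqX by fastforce
    qed
  next
    show "y < length L1" if "v < length L1" "y \<in> set (L1 ! v)" for v y
      using adjacency_distinct(2)[OF L(1)] that by blast
    show "y < length L2" if "v < length L2" "y \<in> set (L2 ! v)" for v y
      using adjacency_distinct(2)[OF L(2)] that by blast
    have "length L1 + 2 \<le> m" unfolding m_def by simp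
    moreover have "m * 2 \<le> m * m" using m2 by (rule mult_le_mono2)
    moreover have "length (concat L1) \<le> length L1 * length L1" by (rule f1(2))
    ultimately show "1 + length (graph_words L1) < X"
      using sqX sq(1) unfolding length_graph_words power2_eq_square by linarith
  qed (use X100 Xw x in \<open>simp_all add: X_def m_def\<close>)
  have correct: "(\<exists>i\<le>tries. \<exists>r<2 ^ K. hit (modulus + i) r) \<longleftrightarrow> mcsf (G1, G2, h)"
    unfolding hit_iff mcsf_iff_table[OF simple L] weight1_def weight2_def ..
  have "\<forall>a. (\<lambda>_. 0 :: nat) a < X" using X100 by simp
  then obtain t s where ts: "exec w x mcsf_program (\<lambda>_. 0) t s" "t \<le> total_cost"
    "s 0 = (if mcsf (G1, G2, h) then 1 else 0)"
    using wp_mcsf_program unfolding wp_def correct by blast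
  have "t \<le> 2 ^ (9 * h + 30) * max 1 (num_verts (G1, G2, h))"
    using order.trans[OF ts(2) total_cost_le] unfolding nv .
  moreover have "real w \<le> 400 * (real h + log 2 (real (num_verts (G1, G2, h) + 2)))"
  proof -
    \<comment> \<open>Hence \<open>w\<close> is at most \<open>320 + 80 * h + 40 * log 2 m\<close>,
      and the constant is absorbed because the logarithm is at least 1.\<close>
    have "real l \<le> log 2 (real m) + 1" unfolding l_def using logm by linarith
    then have "real w \<le> 400 * (real h + log 2 (real m))" unfolding w_def using logm by simp
    then show ?thesis unfolding nv m_def .
  qed
  ultimately show ?thesis using ts(1,3) by blast
qed

lemma log_le_self:
  assumes "0 < n"
  shows "log 2 (real n) \<le> real n"
proof -
  have "real n \<le> 2 powr real n"
    using of_nat_less_two_power[of n, where 'a = real] by (simp add: powr_realpow less_imp_le)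
  then show ?thesis using assms by (simp add: log_le_iff)
qed

text \<open>Computability leaves the word length free, so repeated doubling works once
  \<open>X\<close> is chosen above the result.\<close>

lemma computable_power: "computable (\<lambda>h. 2 ^ (9 * h + 30))"
  unfolding computable_def
proof (rule exI, rule allI)
  let ?b = "Add (Mul (Const 9) (Inp (Const 0))) (Const 30)"
  let ?P = "Seq (Store (Const 0) (Const 1)) (For 3 ?b (Store (Const 0) (Mul (V 0) (Const 2))))"
  fix h :: nat
  define N where "N = 9 * h + 30"
  define X :: nat where "X = 2 ^ (N + 1)"
  have NX: "N < 2 ^ N" by (rule less_exp)
  moreover have "(2 :: nat) ^ N \<le> X" unfolding X_def by (intro power_increasing) auto
  moreover have "h \<le> N" unfolding N_def by simp
  ultimately have lt: "N < X" "h < X" by linarith+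
  have "(2 :: nat) ^ 30 \<le> X" unfolding X_def N_def by (intro power_increasing) auto
  then have X100: "100 \<le> X" by simp
  have X20: "X ^ 20 \<le> 2 ^ ((N + 1) * 20)" unfolding X_def by (simp only: power_mult order_refl)
  interpret ram "(N + 1) * 20" "[h]" X
    by unfold_locales (use lt X100 X20 in auto)
  define I where "I k u \<longleftrightarrow> u 0 = 2 ^ k" for k :: nat and u :: mem
  have "wp (For 3 ?b (Store (Const 0) (Mul (V 0) (Const 2)))) (\<lambda>s. s 0 = 2 ^ N) ((N + 1) * (10 + cost ?b + 13)) ((\<lambda>_. 0)(0 := 1))"
  proof (rule wp_For[where I = I])
    show "I 0 (((\<lambda>_. 0)(0 := 1))(3 := 0))" unfolding I_def by simp
    show "val [h] u ?b = N" for u by (simp add: N_def)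
    show "u 0 = 2 ^ N" if "I N u" for u using that unfolding I_def .
    fix k u assume k: "k < N" and Iu: "I k u" and uk: "u 3 = k"
    have val: "val [h] u (Mul (V 0) (Const 2)) = 2 ^ Suc k" using Iu unfolding I_def by simp
    have "(2 :: nat) ^ Suc k < X" unfolding X_def using k by (intro power_strict_increasing) auto
    then show "wp (Store (Const 0) (Mul (V 0) (Const 2))) (\<lambda>s'. s' 3 = k \<and> I (Suc k) (s'(3 := Suc k))) 10 u"
      by (intro wp_time[OF wp_Store], unfold val val.simps(1)) (use uk in \<open>auto simp: ok_def I_def\<close>)
  qed (use lt in simp_all)
  then have "wp ?P (\<lambda>s. s 0 = 2 ^ N) (cost (Const 0) + cost (Const 1) + 1 + (N + 1) * (10 + cost ?b + 13)) (\<lambda>_. 0)"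
    by (intro wp_Seq[OF wp_Store]) (use X100 in \<open>auto simp: ok_def\<close>)
  then obtain t s where "exec ((N + 1) * 20) [h] ?P (\<lambda>_. 0) t s" "s 0 = 2 ^ N"
    unfolding wp_def using X100 by auto
  then show "\<exists>w t s. exec w [h] ?P (\<lambda>_. 0) t s \<and> s 0 = 2 ^ (9 * h + 30)" unfolding N_def by blast
qed

text \<open>The maximum with 1 covers graphs without vertices, on which the program still takes
  time; the summand 2 keeps the logarithm at least 1.\<close>

theorem theorem12:
  "(\<exists>P (f :: nat \<Rightarrow> real) (c :: real). f \<in> O(\<lambda>h. real h) \<and>
      decides_within P mcsf_input mcsf
        (\<lambda>i x. 2 powr f (parameter i) * real (max 1 (num_verts i)))
        (\<lambda>i x. c * (real (parameter i) + log 2 (real (num_verts i + 2)))))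
   \<and> fixed_parameter_tractable mcsf_input mcsf parameter"
proof
  define f :: "nat \<Rightarrow> real" where "f h = real (9 * h + 30)" for h
  have "f \<in> O(\<lambda>h. real h)"
  \<comment> \<open>\<open>39 = 9 + 30\<close> works from \<open>h = 1\<close> on.\<close>
  proof (rule bigoI[of _ 39])
    show "\<forall>\<^sub>F h in sequentially. norm (f h) \<le> 39 * norm (real h)"
      using eventually_ge_at_top[of 1] by eventually_elim (simp add: f_def)
  qed
  moreover have "decides_within mcsf_program mcsf_input mcsf
        (\<lambda>i x. 2 powr f (parameter i) * real (max 1 (num_verts i)))
        (\<lambda>i x. 400 * (real (parameter i) + log 2 (real (num_verts i + 2))))"
    unfolding decides_within_def
  proof (intro allI impI)
    fix i x assume "mcsf_input i x"
    moreover obtain G1 G2 h where i: "i = (G1, G2, h)" by (rule prod_cases3)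
    ultimately obtain w t s where w: "real w \<le> 400 * (real h + log 2 (real (num_verts i + 2)))"
      and t: "t \<le> 2 ^ (9 * h + 30) * max 1 (num_verts i)"
      and s: "exec w x mcsf_program (\<lambda>_. 0) t s" "s 0 = (if mcsf i then 1 else 0)"
      using mcsf_program_correct by blast
    have "real t \<le> real (2 ^ (9 * h + 30) * max 1 (num_verts i))" using t by (rule of_nat_mono)
    also have "\<dots> = 2 powr f (parameter i) * real (max 1 (num_verts i))"
      unfolding i parameter.simps f_def by (simp only: powr_realpow of_nat_mult of_nat_power of_nat_numeral zero_less_numeral)
    finally have "real t \<le> 2 powr f (parameter i) * real (max 1 (num_verts i))" .
    then show "\<exists>w t s. real w \<le> 400 * (real (parameter i) + log 2 (real (num_verts i + 2))) \<and>
        real t \<le> 2 powr f (parameter i) * real (max 1 (num_verts i)) \<and>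
        exec w x mcsf_program (\<lambda>_. 0) t s \<and> s 0 = (if mcsf i then 1 else 0)"
      using w s unfolding i parameter.simps by blast
  qed
  ultimately show "\<exists>P (f :: nat \<Rightarrow> real) (c :: real). f \<in> O(\<lambda>h. real h) \<and>
      decides_within P mcsf_input mcsf
        (\<lambda>i x. 2 powr f (parameter i) * real (max 1 (num_verts i)))
        (\<lambda>i x. c * (real (parameter i) + log 2 (real (num_verts i + 2))))"
    by blast
  \<comment> \<open>The same program serves again. The input is longer than the number of vertices,
    so the linear bound carries over with exponent 1.\<close>
  define g :: "nat \<Rightarrow> nat" where "g h = 2 ^ (9 * h + 30)" for h
  have "decides_within mcsf_program mcsf_input mcsf (\<lambda>i x. real (g (parameter i) * length x ^ 1))
      (\<lambda>i x. real (g (parameter i) * length x ^ 1))"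
    unfolding decides_within_def
  proof (intro allI impI)
    fix i x assume inp: "mcsf_input i x"
    obtain G1 G2 h where i: "i = (G1, G2, h)" by (rule prod_cases3)
    obtain w t s where w: "real w \<le> 400 * (real h + log 2 (real (num_verts i + 2)))"
      and t: "t \<le> 2 ^ (9 * h + 30) * max 1 (num_verts i)"
      and s: "exec w x mcsf_program (\<lambda>_. 0) t s" "s 0 = (if mcsf i then 1 else 0)"
      using mcsf_program_correct inp unfolding i by blast
    obtain L1 L2 where L: "adjacency_lists G1 L1" "adjacency_lists G2 L2"
      and x: "x = h # graph_words L1 @ graph_words L2"
      using inp unfolding i by auto
    have len: "num_verts i + 2 \<le> length x"
      unfolding i x using adjacency_lists_facts(1)[OF L(1)] adjacency_lists_facts(1)[OF L(2)]
      by (simp add: length_graph_words)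
    then have "max 1 (num_verts i) \<le> length x" by simp
    then have "t \<le> g h * length x" using t unfolding g_def by (meson mult_le_mono2 order.trans)
    \<comment> \<open>The word length may be as large as the time bound here, so estimating the
      logarithm by its argument suffices, and \<open>g\<close> has room for
      \<open>400 * (h + 1)\<close>.\<close>
    moreover have "real w \<le> real (g h * length x)"
    proof -
      have "log 2 (real (num_verts i + 2)) \<le> real (num_verts i + 2)"
        by (rule log_le_self) simp
      also have "\<dots> \<le> real (length x)" using len by (rule of_nat_mono)
      finally have "real w \<le> 400 * (real h + real (length x))" using w by simp
      also have "\<dots> \<le> 400 * (real (h + 1) * real (length x))"
      proof -
        have "h * 1 \<le> h * length x" using len by (intro mult_le_mono2) simp
        then have "h + length x \<le> (h + 1) * length x" by simp
        then have "real (h + length x) \<le> real ((h + 1) * length x)" by (rule of_nat_mono)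
        then have "real h + real (length x) \<le> real (h + 1) * real (length x)"
          by (simp only: of_nat_add of_nat_mult)
        then show ?thesis by (rule mult_left_mono) simp
      qed
      also have "\<dots> = real (400 * (h + 1) * length x)" by simp
      also have "400 * (h + 1) * length x \<le> g h * length x"
      proof (rule mult_le_mono1)
        have "h + 1 \<le> 2 ^ (9 * h)" using less_exp[of h] power_increasing[of h "9 * h" "2 :: nat"] by linarith
        then have "400 * (h + 1) \<le> 2 ^ 30 * 2 ^ (9 * h)" by (intro mult_le_mono) simp_all
        then show "400 * (h + 1) \<le> g h" unfolding g_def by (simp only: power_add mult.commute)
      qed
      finally show ?thesis by simp
    qed
    ultimately show "\<exists>w t s. real w \<le> real (g (parameter i) * length x ^ 1) \<and>
        real t \<le> real (g (parameter i) * length x ^ 1) \<and>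
        exec w x mcsf_program (\<lambda>_. 0) t s \<and> s 0 = (if mcsf i then 1 else 0)"
      using s unfolding i parameter.simps power_one_right by (meson of_nat_mono)
  qed
  moreover have "computable g" unfolding g_def by (rule computable_power)
  ultimately show "fixed_parameter_tractable mcsf_input mcsf parameter"
    unfolding fixed_parameter_tractable_def by blast
qed

end
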